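(* The natural homomorphism $\rho_{\mathcal{P}}\colon\mathrm{P\Gamma U}(6,4)\to\mathrm{Aut}(\mathcal{P}_X,\nu_{\mathcal{P}})$ is an isomorphism.
   Context: $\overline{\mathbb{F}}_2$ is an algebraically closed field of characteristic $2$; $X\subset\mathbb{P}^5$ is the Fermat cubic $4$-fold $x_1^3+\cdots+x_6^3=0$ over $\mathbb{F}_2$. $\mathcal{P}_X$ is the set of all linear planes ($2$-dimensional projective linear subspaces of $\mathbb{P}^5$) contained in $X\otimes\overline{\mathbb{F}}_2$; they are all defined over $\mathbb{F}_4$. For $\Pi,\Pi'\in\mathcal{P}_X$, $\nu_{\mathcal{P}}(\Pi,\Pi'):=\Pi\cdot\Pi'$ (intersection number of algebraic cycles on $X$), which equals $(1-(-2)^{\dim(\Pi\cap\Pi')+1})/3$ with the convention $\dim(\emptyset)=-1$. $\mathrm{Aut}(\mathcal{P}_X,\nu_{\mathcal{P}})$ is the group of permutations of $\mathcal{P}_X$ preserving $\nu_{\mathcal{P}}$. For a matrix $g$ over $\overline{\mathbb{F}}_2$, $\bar g$ is obtained by applying $a\mapsto a^2$ to all entries. $\mathrm{GU}(6,4):=\{g\in\mathrm{GL}(6,\overline{\mathbb{F}}_2)\mid g\cdot{}^{T}\bar g=I_6\}$ and $\mathrm{PGU}(6,4):=\mathrm{GU}(6,4)/\mathbb{F}_4^\times$, which acts on the set $X(\mathbb{F}_4)$ of $\mathbb{F}_4$-rational points of $X$. $\mathrm{P\Gamma U}(6,4)$ is the subgroup of the full symmetric group of $X(\mathbb{F}_4)$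 generated by the permutations induced by the actions of $\mathrm{PGU}(6,4)$ and $\mathrm{Gal}(\mathbb{F}_4/\mathbb{F}_2)$. $\rho_{\mathcal{P}}$ is given by the induced action on the planes (which are defined over $\mathbb{F}_4$). *)

theory Defs
  imports
    "HOL-Analysis.Analysis"
    "HOL-Algebra.Bij"
    "HOL-Algebra.Coset"
    "HOL-Algebra.Generated_Groups"
    "HOL-Computational_Algebra.Polynomial"
begin

text \<open>
  Throughout, the type variable is the algebraically closed base field of characteristic 2. The
  characteristic is a hypothesis of the theorem and not part of the definitions.
\<close>

section \<open>The Fermat cubic 4-fold, its rational points and its planes\<close>

definition F4 :: "'a::field set"
  where "F4 = {a. a ^ 4 = a}"

text \<open>Points of projective 5-space are lines through the origin in affine 6-space; a subvariety is
  identified with its set of points over the algebraically closed base field.\<close>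

definition proj_space :: "('a::field ^ 6) set set"
  where "proj_space = {p. vec.subspace p \<and> vec.dim p = 1}"

definition fermat_cubic :: "('a::field ^ 6) set set"
  where "fermat_cubic = {p \<in> proj_space. \<forall>x\<in>p. (\<Sum>i\<in>UNIV. (x $ i) ^ 3) = 0}"

definition rational_vectors :: "('a::field ^ 6) set"
  where "rational_vectors = {v. \<forall>i. v $ i \<in> F4}"

text \<open>A point is rational over the field with 4 elements if it has homogeneous coordinates there.\<close>

definition fermat_cubic_F4 :: "('a::field ^ 6) set set"
  where "fermat_cubic_F4 = {p \<in> fermat_cubic. \<exists>v\<in>p. v \<noteq> 0 \<and> v \<in> rational_vectors}"

definition proj_planes :: "('a::field ^ 6) set set set"
  where "proj_planes =
    {P. \<exists>W. vec.subspace W \<and> vec.dim W = 3 \<and> P = {p \<in> proj_space. p \<subseteq> W}}"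

definition planes :: "('a::field ^ 6) set set set"
  where "planes = {P \<in> proj_planes. P \<subseteq> fermat_cubic}"


section \<open>Intersection numbers of planes\<close>

text \<open>Projective dimension of a linear subspace given as a set of points; the empty subspace gets
  dimension \<open>-1\<close>, because the empty set of vectors has \<open>vec.dim\<close> equal to 0.\<close>

definition proj_dim :: "('a::field ^ 6) set set \<Rightarrow> int"
  where "proj_dim L = int (vec.dim (\<Union>L)) - 1"

text \<open>The intersection number on the cubic 4-fold of two planes contained in it, through its value
  \<open>(1 - (-2) ^ (d + 1)) / 3\<close> where \<open>d\<close> is the dimension of their intersection: it is 0, 1, -1, 3
  for \<open>d\<close> = -1, 0, 1, 2. (This is the excess intersection formula: the coefficient of
  \<open>h ^ d\<close> in \<open>(1 + h) ^ (d + 1) / (1 + 3 * h)\<close>.) The integer division is exact by the lemma below.\<close>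

definition intersection_number :: "('a::field ^ 6) set set \<Rightarrow> ('a ^ 6) set set \<Rightarrow> int"
  where "intersection_number P Q = (1 - (-2) ^ nat (proj_dim (P \<inter> Q) + 1)) div 3"

lemma intersection_number_exact:
  "3 * intersection_number P Q = 1 - (-2) ^ nat (proj_dim (P \<inter> Q) + 1)"
proof -
  have "(3::int) dvd 1 - (-2) ^ n" for n
  proof (induction n)
    case (Suc n)
    then obtain k :: int where "1 - (-2) ^ n = 3 * k" by (elim dvdE)
    then have "1 - (-2) ^ Suc n = 3 * (1 - 2 * k)" by simp
    then show ?case by (metis dvd_triv_left)
  qed simp
  then show ?thesis
    unfolding intersection_number_def by (rule dvd_mult_div_cancel)
qed

definition Aut_planes :: "(('a::field ^ 6) set set \<Rightarrow> ('a ^ 6) set set) monoid"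
  where "Aut_planes = (BijGroup planes)\<lparr>carrier :=
    {f \<in> Bij planes. \<forall>P\<in>planes. \<forall>Q\<in>planes.
       intersection_number (f P) (f Q) = intersection_number P Q}\<rparr>"


section \<open>The unitary groups\<close>

definition bar :: "'a::field ^ 6 ^ 6 \<Rightarrow> 'a ^ 6 ^ 6"
  where "bar g = (\<chi> i j. (g $ i $ j) ^ 2)"

definition GU :: "('a::field ^ 6 ^ 6) monoid"
  where "GU = \<lparr>carrier = {g. invertible g \<and> g ** transpose (bar g) = mat 1},
    mult = (**), one = mat 1\<rparr>"

definition scalars_F4 :: "('a::field ^ 6 ^ 6) set"
  where "scalars_F4 = {mat c | c. c \<in> F4 \<and> c \<noteq> 0}"

definition PGU :: "('a::field ^ 6 ^ 6) set monoid"
  where "PGU = GU Mod scalars_F4"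

text \<open>All matrices in a class \<open>C\<close> modulo scalars map a point to the same point, so that the union
  below is the image of \<open>p\<close> under any one of them.\<close>

definition PGU_perm :: "('a::field ^ 6 ^ 6) set \<Rightarrow> ('a ^ 6) set \<Rightarrow> ('a ^ 6) set"
  where "PGU_perm C = (\<lambda>p\<in>fermat_cubic_F4. \<Union>g\<in>C. (*v) g ` p)"

text \<open>The Galois group of the field with 4 elements over its prime field. Fixing the prime field is
  automatic. Maps are not normalised outside \<open>F4\<close>, where their values are never used.\<close>

definition Gal_F4 :: "('a::field \<Rightarrow> 'a) set"
  where "Gal_F4 = {\<tau>. bij_betw \<tau> F4 F4 \<and> \<tau> 0 = 0 \<and> \<tau> 1 = 1 \<and>
    (\<forall>a\<in>F4. \<forall>b\<in>F4. \<tau> (a + b) = \<tau> a + \<tau> b \<and> \<tau> (a * b) = \<tau> a * \<tau> b)}"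

text \<open>The Galois action applies \<open>\<tau>\<close> to homogeneous coordinates with entries in \<open>F4\<close>.\<close>

definition Gal_perm :: "('a::field \<Rightarrow> 'a) \<Rightarrow> ('a ^ 6) set \<Rightarrow> ('a ^ 6) set"
  where "Gal_perm \<tau> =
    (\<lambda>p\<in>fermat_cubic_F4. vec.span ((\<lambda>v. \<chi> i. \<tau> (v $ i)) ` (p \<inter> rational_vectors)))"

definition PGammaU :: "(('a::field ^ 6) set \<Rightarrow> ('a ^ 6) set) monoid"
  where "PGammaU = (BijGroup fermat_cubic_F4)\<lparr>carrier :=
    generate (BijGroup fermat_cubic_F4) (PGU_perm ` carrier PGU \<union> Gal_perm ` Gal_F4)\<rparr>"


section \<open>The action on planes\<close>

text \<open>A plane in the cubic is defined over the field with 4 elements, hence determined by its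
  rational points, so a permutation of the rational points of the cubic coming from a semilinear map
  acts on planes through their sets of rational points.\<close>

definition rho_planes :: "(('a::field ^ 6) set \<Rightarrow> ('a ^ 6) set)
    \<Rightarrow> ('a ^ 6) set set \<Rightarrow> ('a ^ 6) set set"
  where "rho_planes \<sigma> = (\<lambda>P\<in>planes.
    THE Q. Q \<in> planes \<and> Q \<inter> fermat_cubic_F4 = \<sigma> ` (P \<inter> fermat_cubic_F4))"

end

theory Submission
  imports Defs
begin

text \<open>
  The cubic form is \<open>h x x\<close> for \<open>h x y = (\<Sum>i. x\<^sub>i * y\<^sub>i\<^sup>2)\<close>, which is linear in \<open>x\<close>, Frobenius
  semilinear in \<open>y\<close>, and a Hermitian form on vectors with coordinates in the field with four elements.
  If the cubic contains the plane of a 3-dimensional subspace \<open>W\<close>, then polarisation makes \<open>h\<close> vanish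
  on \<open>W\<close>, and by dimension \<open>W\<close> is its own perpendicular space. Since applying Frobenius twice to the
  first argument turns \<open>h x y\<close> into \<open>(h y x)\<^sup>2\<close>, the space \<open>W\<close> is stable under the Frobenius map of
  the field with four elements and is therefore spanned by rational vectors. So the planes are the
  generators (maximal totally isotropic subspaces) of a Hermitian polar space of rank 3 whose points
  are the rational points of the cubic. As the intersection number takes the distinct values 0, 1, -1,
  3 when the intersection has vector space dimension 0, 1, 2, 3, the group to be determined consists
  of the permutations of the generators that preserve the dimensions of intersections.

  Such a permutation \<open>F\<close> comes from a permutation of the points. A generator that meets two different
  generators in lines contains their intersection (\<open>adjacent_to_both\<close>), and starting from two
  generators \<open>P\<close>, \<open>Q\<close> that meet in a point, all generators through that point are reached by taking
  such common neighbours repeatedly. Hence \<open>F P \<inter> F Q\<close> lies in \<open>F R\<close> for each generator \<open>R\<close>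
  through the point (\<open>generators_through_point_preserved\<close>). It follows that the action on planes identifies the group
  of collineations, the permutations of the points that map generators to generators, with the
  automorphism group (\<open>rho_planes_bij_collineations\<close>).

  It remains to see that every collineation is induced by a semilinear unitary map
  (\<open>collineations_subset_PGammaU\<close>). A collineation preserves perpendicularity, so it maps the points
  of a hyperbolic frame \<open>u\<^sub>0, \<dots>, u\<^sub>5\<close> (\<open>h u\<^sub>i u\<^sub>j\<close> is 1 for \<open>j = i + 3\<close> modulo 6, and 0 otherwise) to the
  points of another frame, and the second frame can be scaled so that also the point of
  \<open>u\<^sub>0 + u\<^sub>1 + u\<^sub>2\<close> goes to the corresponding point. The unitary matrix that carries one frame to the
  other reduces the claim to a collineation that fixes these seven points. With \<open>\<omega>\<close> a primitive cube root
  of unity, it maps the point of \<open>u\<^sub>0 + \<omega> u\<^sub>1\<close> to itself or to that of \<open>u\<^sub>0 + \<omega>\<^sup>2 u\<^sub>1\<close>, and in the second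
  case squaring of the frame coordinates repairs this. A collineation that fixes all eight points is
  the identity (\<open>all_isotropic_fixed\<close>): step by step, further points are fixed because they are
  the only ones with the given perpendicularities to the points already fixed.
\<close>

section \<open>Arithmetic in characteristic 2\<close>

locale char2_closed =
  fixes field_type :: "'a::alg_closed_field itself"
  assumes char2: "CHAR('a) = 2"
begin

lemma two_eq_0: "(2::'a) = 0"
  using of_nat_CHAR[where 'a='a] char2 by simp

lemma add_self: "x + x = (0::'a)"
  using two_eq_0 by (metis mult_2 mult_zero_left)

lemma neg_eq: "- x = (x::'a)"
  using add_self[of x] by (simp add: eq_neg_iff_add_eq_0 flip: neg_eq_iff_add_eq_0)

lemma add_eq_0: "x + y = (0::'a) \<longleftrightarrow> x = y"
  by (metis add_eq_0_iff neg_eq)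

lemma sq_add: "(x + y)\<^sup>2 = x\<^sup>2 + (y::'a)\<^sup>2"
  by (simp add: power2_sum two_eq_0)

lemma sq_inj: "x\<^sup>2 = y\<^sup>2 \<longleftrightarrow> x = (y::'a)"
proof
  assume "x\<^sup>2 = y\<^sup>2"
  then have "(x + y)\<^sup>2 = 0" by (simp only: sq_add add_self)
  then have "x + y = 0" by (simp only: zero_eq_power2)
  then show "x = y" by (simp only: add_eq_0)
qed simp

lemma sq_surj: "\<exists>y::'a. y\<^sup>2 = x"
  using nth_root_exists[of 2 x] by auto

lemma sq_sum: "(sum f A)\<^sup>2 = (\<Sum>i\<in>A. (f i :: 'a)\<^sup>2)"
  by (induction A rule: infinite_finite_induct) (auto simp: sq_add)

lemma F4_0: "(0::'a) \<in> F4" and F4_1: "(1::'a) \<in> F4"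
  by (auto simp: F4_def)

lemma F4_add: "x \<in> F4 \<Longrightarrow> y \<in> F4 \<Longrightarrow> x + y \<in> (F4::'a set)"
proof -
  assume xy: "x \<in> F4" "y \<in> F4"
  have pow4: "z ^ 4 = (z\<^sup>2)\<^sup>2" for z :: 'a by (simp flip: power_mult)
  have "(x + y) ^ 4 = x ^ 4 + y ^ 4" unfolding pow4 sq_add ..
  then show ?thesis using xy by (simp only: F4_def mem_Collect_eq)
qed

lemma F4_mult: "x \<in> F4 \<Longrightarrow> y \<in> F4 \<Longrightarrow> x * y \<in> (F4::'a set)"
  by (simp add: F4_def power_mult_distrib)

lemma F4_power: "x \<in> F4 \<Longrightarrow> x ^ n \<in> (F4::'a set)"
  by (induction n) (auto simp: F4_1 F4_mult)

lemma F4_inverse: "x \<in> F4 \<Longrightarrow> inverse x \<in> (F4::'a set)"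
  by (simp add: F4_def power_inverse)

lemma F4_divide: "x \<in> F4 \<Longrightarrow> y \<in> F4 \<Longrightarrow> x / y \<in> (F4::'a set)"
  by (simp add: F4_mult F4_inverse divide_inverse)

lemma F4_sum: "(\<And>i. i \<in> A \<Longrightarrow> f i \<in> F4) \<Longrightarrow> sum f A \<in> (F4::'a set)"
  by (induction A rule: infinite_finite_induct) (auto simp: F4_0 F4_add)

lemma F4_pow4: "x \<in> F4 \<Longrightarrow> x ^ 4 = (x::'a)"
  by (simp add: F4_def)

lemma F4_sq_sq: "(x::'a) \<in> F4 \<Longrightarrow> (x\<^sup>2)\<^sup>2 = x"
  by (simp add: F4_def flip: power_mult)

lemma F4_pow3: "x \<in> F4 \<Longrightarrow> x \<noteq> 0 \<Longrightarrow> x ^ 3 = (1::'a)"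
proof -
  assume "x \<in> F4" "x \<noteq> 0"
  moreover have "x ^ 4 = x ^ 3 * x" by (simp add: power_numeral_reduce mult.assoc)
  ultimately show ?thesis by (simp add: F4_def)
qed

lemma F4_mult_sq: "x \<in> F4 \<Longrightarrow> x \<noteq> 0 \<Longrightarrow> x * x\<^sup>2 = (1::'a)"
  using F4_pow3[of x] by (simp add: power_numeral_reduce mult.assoc)

lemma exists_omega: "\<exists>w::'a. w\<^sup>2 + w + 1 = 0"
proof -
  have "\<exists>x. poly [:1, 1, 1::'a:] x = 0"
    by (rule alg_closed_imp_poly_has_root) simp
  then show ?thesis by (auto simp: algebra_simps power2_eq_square)
qed

definition omega :: 'a where "omega = (SOME w. w\<^sup>2 + w + 1 = 0)"

lemma omega: "omega\<^sup>2 + omega + 1 = 0"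
  unfolding omega_def by (rule someI_ex, rule exists_omega)

lemma omega_sq: "omega\<^sup>2 = omega + 1"
  using omega by (metis add.assoc add_eq_0)

lemma omega_F4: "omega \<in> F4"
proof -
  have "omega ^ 4 = (omega\<^sup>2)\<^sup>2" by (simp flip: power_mult)
  also have "\<dots> = omega" by (simp add: omega_sq sq_add add.assoc add_self)
  finally show ?thesis by (simp add: F4_def)
qed

lemma omega_neq: "omega \<noteq> 0" "omega \<noteq> 1"
  using omega add_self[of 1] by auto

text \<open>The polynomial \<open>x ^ 4 - x\<close> factors as \<open>x * (x + 1) * (x\<^sup>2 + x + 1)\<close>.\<close>

lemma F4_cases: assumes "x \<in> F4" shows "x = 0 \<or> x = 1 \<or> x = omega \<or> x = omega\<^sup>2"
proof -
  have "x * (x + 1) * (x\<^sup>2 + x + 1) = x ^ 4 + x + 2 * (x ^ 3 + x\<^sup>2)"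
    by (simp add: algebra_simps power2_eq_square power_numeral_reduce)
  also have "\<dots> = 0" using assms by (simp add: F4_def two_eq_0 add_self)
  finally have "x = 0 \<or> x = 1 \<or> x\<^sup>2 + x + 1 = 0" by (auto simp: add_eq_0)
  moreover have "x = omega \<or> x = omega\<^sup>2" if "x\<^sup>2 + x + 1 = 0"
  proof -
    have "(x + omega) * (x + omega\<^sup>2) = x\<^sup>2 + x * (omega + omega\<^sup>2) + omega * omega\<^sup>2"
      by (simp add: algebra_simps power2_eq_square)
    also have "omega + omega\<^sup>2 = 1" by (simp add: omega_sq add_self flip: add.assoc)
    also have "omega * omega\<^sup>2 = 1" using F4_mult_sq omega_F4 omega_neq by blast
    finally show ?thesis using that by (auto simp: add_eq_0)
  qed
  ultimately show ?thesis by blast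
qed

end

lemma UNIV_6: "UNIV = {0, 1, 2, 3, 4, 5 :: 6}"
proof -
  have "i \<in> {0, 1, 2, 3, 4, 5}" for i :: 6
  proof (cases i)
    case (of_int z)
    then have "z \<in> {0, 1, 2, 3, 4, 5}" by auto
    then show ?thesis using of_int by auto
  qed
  then show ?thesis by blast
qed

lemma sum_6: "sum f UNIV = f 0 + f 1 + f 2 + f 3 + f 4 + f (5 :: 6)"
  for f :: "6 \<Rightarrow> 'b::comm_monoid_add"
  unfolding UNIV_6 by (simp add: add_ac)

lemma dim_UNIV_6: "vec.dim (UNIV :: ('a::field ^ 6) set) = 6"
  by (simp only: vec.dim_UNIV card_cart_basis) simp

section \<open>The Hermitian form\<close>

definition frob :: "'a::field ^ 'n \<Rightarrow> 'a ^ 'n"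
  where "frob x = (\<chi> i. (x $ i)\<^sup>2)"

definition herm :: "'a::field ^ 'n \<Rightarrow> 'a ^ 'n \<Rightarrow> 'a"
  where "herm x y = (\<Sum>i\<in>UNIV. x $ i * (y $ i)\<^sup>2)"

definition perp :: "('a::field ^ 'n) set \<Rightarrow> ('a ^ 'n) set"
  where "perp B = {x. \<forall>b\<in>B. herm x b = 0}"

lemma herm_add_left: "herm (x + y) z = herm x z + herm y z"
  by (simp add: herm_def algebra_simps sum.distrib)

lemma herm_scale_left: "herm (c *s x) z = c * herm x z"
  by (simp add: herm_def algebra_simps sum_distrib_left)

lemma herm_scale_right: "herm x (c *s z) = c\<^sup>2 * herm x z"
  by (simp add: herm_def algebra_simps sum_distrib_left)

lemma herm_0_left [simp]: "herm 0 z = 0" and herm_0_right [simp]: "herm x 0 = 0"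
  by (simp_all add: herm_def)

lemma subspace_perp: "vec.subspace (perp B)"
  by (auto simp: vec.subspace_def perp_def herm_add_left herm_scale_left)

lemma perp_insert: "perp (insert b B) = perp B \<inter> {x. herm x b = 0}"
  by (auto simp: perp_def)

text \<open>The subspace is spanned by \<open>u\<close> together with the kernel of the functional.\<close>

lemma dim_hyperplane_section:
  fixes U :: "('a::field ^ 'n) set"
  assumes U: "vec.subspace U" and u: "u \<in> U" "l u \<noteq> 0"
    and add: "\<And>x y. l (x + y) = l x + l y" and scale: "\<And>c x. l (c *s x) = c * (l x :: 'a)"
  shows "vec.dim U = Suc (vec.dim (U \<inter> {x. l x = 0}))"
proof -
  let ?K = "U \<inter> {x. l x = 0}"
  have l0: "l 0 = 0" using scale[of 0 0] by simp
  have K: "vec.subspace ?K"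
    using U by (auto simp: vec.subspace_def add scale l0)
  have "u \<notin> vec.span ?K" using K u by (simp add: vec.span_eq_iff[THEN iffD2])
  then have "vec.dim (insert u ?K) = Suc (vec.dim ?K)" by (simp add: vec.dim_insert)
  moreover have "vec.span (insert u ?K) = U"
  proof
    show "vec.span (insert u ?K) \<subseteq> U" using U u by (intro vec.span_minimal) auto
    show "U \<subseteq> vec.span (insert u ?K)"
    proof
      fix x assume x: "x \<in> U"
      let ?k = "l x / l u"
      have "x - ?k *s u \<in> U" using U x u by (simp add: vec.subspace_diff vec.subspace_scale)
      moreover have "l (x - ?k *s u) = 0"
        using add[of "x - ?k *s u" "?k *s u"] u by (simp add: scale)
      ultimately have "x - ?k *s u \<in> vec.span ?K" by (simp add: vec.span_base)
      then show "x \<in> vec.span (insert u ?K)" by (auto simp: vec.span_breakdown_eq)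
    qed
  qed
  ultimately show ?thesis by (metis vec.dim_span)
qed

context char2_closed
begin

lemma herm_add_right: "herm x (y + z) = herm x y + herm x (z :: 'a ^ 'n)"
  by (simp add: herm_def algebra_simps sum.distrib sq_add)

lemma frob_add: "frob (x + y) = frob x + frob (y :: 'a ^ 'n)"
  by (simp add: frob_def vec_eq_iff sq_add)

lemma frob_scale: "frob (c *s x) = c\<^sup>2 *s frob (x :: 'a ^ 'n)"
  by (simp add: frob_def vec_eq_iff power_mult_distrib)

lemma frob_0 [simp]: "frob (0 :: 'a ^ 'n) = 0"
  by (simp add: frob_def vec_eq_iff)

lemma frob_inj: "frob x = frob y \<longleftrightarrow> x = (y :: 'a ^ 'n)"
  by (simp add: frob_def vec_eq_iff sq_inj)

lemma herm_frob: "herm (frob x) (frob y) = (herm x (y :: 'a ^ 'n))\<^sup>2"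
  by (simp add: herm_def frob_def sq_sum power_mult_distrib)

text \<open>This replaces Hermitian symmetry, which fails off the rational vectors, and explains why totally
  isotropic subspaces are stable under the double Frobenius map.\<close>

lemma herm_frob_left: "herm (frob (frob x)) y = (herm y (x :: 'a ^ 'n))\<^sup>2"
  by (simp add: herm_def frob_def sq_sum power_mult_distrib mult.commute)

text \<open>Extend \<open>B\<close> and \<open>v\<close> to a basis and take the linear functional that is 1 at \<open>v\<close> and 0 on \<open>B\<close>. As \<open>h\<close>
  is semilinear in its second argument, \<open>herm x\<close> is the square of this functional when \<open>x\<close> has the
  squares of its coefficients as coordinates.\<close>

lemma herm_separates:
  fixes v :: "'a ^ 'n"
  assumes "vec.independent B" "v \<notin> vec.span B"
  shows "\<exists>x\<in>perp B. herm x v \<noteq> 0"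
proof -
  have "vec.independent (insert v B)" using assms by (simp add: vec.independent_insert)
  from vec.linear_independent_extend[OF this, of "\<lambda>x. if x = v then 1 else 0 :: 'a ^ 1"]
  obtain g where g: "Vector_Spaces.linear (*s) (*s) g"
    and gv: "\<And>x. x \<in> insert v B \<Longrightarrow> g x = (if x = v then 1 else 0 :: 'a ^ 1)"
    by blast
  interpret g: Vector_Spaces.linear "(*s)" "(*s)" g by (rule g)
  define x where "x = (\<chi> i. (g (axis i 1) $ 1)\<^sup>2)"
  have "herm x y = (g y $ 1)\<^sup>2" for y
  proof -
    have "g y = g (\<Sum>i\<in>UNIV. (y $ i) *s axis i 1)" by (simp add: basis_expansion)
    also have "\<dots> = (\<Sum>i\<in>UNIV. (y $ i) *s g (axis i 1))" by (simp add: g.sum g.scale)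
    finally show ?thesis
      by (simp add: herm_def x_def sq_sum power_mult_distrib mult.commute)
  qed
  moreover have "v \<notin> B" using assms vec.span_base by blast
  ultimately show ?thesis
    using gv by (intro bexI[of _ x]) (auto simp: perp_def)
qed

text \<open>By \<open>herm_separates\<close>, each further vector of an independent set cuts down the perpendicular space
  properly, hence by exactly one dimension.\<close>

lemma dim_perp_independent:
  fixes B :: "('a ^ 'n) set"
  assumes "finite B" "vec.independent B"
  shows "vec.dim (perp B) + card B = CARD('n)"
  using assms
proof (induction B)
  case empty
  then show ?case by (simp add: perp_def card_cart_basis)
next
  case (insert b B)
  then have ind: "vec.independent B" and b: "b \<notin> vec.span B"
    by (auto simp: vec.independent_insert)
  from herm_separates[OF this] obtain x where x: "x \<in> perp B" "herm x b \<noteq> 0" by blast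
  have "vec.dim (perp B) = Suc (vec.dim (perp B \<inter> {x. herm x b = 0}))"
    by (rule dim_hyperplane_section[where l = "\<lambda>x. herm x b", OF subspace_perp x])
       (simp_all add: herm_add_left herm_scale_left)
  then show ?case using insert.IH[OF ind] insert.hyps by (simp add: perp_insert)
qed

lemma perp_span: "perp (vec.span B) = perp (B :: ('a ^ 'n) set)"
proof
  show "perp (vec.span B) \<subseteq> perp B" by (auto simp: perp_def vec.span_base)
  show "perp B \<subseteq> perp (vec.span B)"
  proof
    fix x assume x: "x \<in> perp B"
    have "vec.subspace {y. herm x y = 0}"
      by (auto simp: vec.subspace_def herm_add_right herm_scale_right)
    then have "vec.span B \<subseteq> {y. herm x y = 0}"
      using x by (intro vec.span_minimal) (auto simp: perp_def)
    then show "x \<in> perp (vec.span B)" by (auto simp: perp_def)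
  qed
qed

lemma dim_perp: "vec.dim (perp U) + vec.dim U = CARD('n)" for U :: "('a ^ 'n) set"
proof -
  obtain B where B: "B \<subseteq> U" "vec.independent B" "U \<subseteq> vec.span B" "card B = vec.dim U"
    by (rule vec.basis_exists)
  then have "vec.span B = vec.span U"
    by (metis vec.span_mono vec.span_span subset_antisym)
  then have "perp B = perp U" by (metis perp_span)
  then show ?thesis using dim_perp_independent[OF _ B(2)] B vec.finiteI_independent by metis
qed

section \<open>Descent to the field with four elements\<close>

lemma rational_iff: "v \<in> rational_vectors \<longleftrightarrow> frob (frob v) = (v :: 'a ^ 6)"
  by (simp add: rational_vectors_def F4_def frob_def vec_eq_iff flip: power_mult)

lemma frob_rational: "v \<in> rational_vectors \<Longrightarrow> frob v \<in> (rational_vectors :: ('a ^ 6) set)"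
  by (simp add: rational_iff)

lemma rational_add: "v \<in> rational_vectors \<Longrightarrow> w \<in> rational_vectors \<Longrightarrow>
    v + w \<in> (rational_vectors :: ('a ^ 6) set)"
  and rational_scale: "v \<in> rational_vectors \<Longrightarrow> c \<in> F4 \<Longrightarrow>
    c *s v \<in> (rational_vectors :: ('a ^ 6) set)"
  by (auto simp: rational_vectors_def F4_add F4_mult)

lemma herm_rational: "v \<in> rational_vectors \<Longrightarrow> w \<in> rational_vectors \<Longrightarrow> herm v w \<in> (F4 :: 'a set)"
  by (auto simp: rational_vectors_def herm_def intro!: F4_sum F4_mult F4_power)

lemma herm_sym: "v \<in> rational_vectors \<Longrightarrow> herm v w = (herm w (v :: 'a ^ 6))\<^sup>2"
  using herm_frob_left[of v w] by (simp add: rational_iff)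

lemma herm_sym_0: "v \<in> rational_vectors \<Longrightarrow> herm v w = 0 \<longleftrightarrow> herm w (v :: 'a ^ 6) = 0"
  by (simp add: herm_sym)

text \<open>Galois descent by supports. A nonzero vector of minimal support, scaled to have an entry 1, is
  rational: its difference to its double Frobenius image lies in \<open>W\<close> and has a smaller support.
  Subtracting multiples of such vectors shrinks the support of any given vector to the empty set.\<close>

lemma frobenius_stable_spanned_by_rational:
  fixes W :: "('a ^ 6) set"
  assumes W: "vec.subspace W" and stable: "\<And>w. w \<in> W \<Longrightarrow> frob (frob w) \<in> W"
  shows "vec.span (W \<inter> rational_vectors) = W"
proof
  show "vec.span (W \<inter> rational_vectors) \<subseteq> W" using W by (intro vec.span_minimal) auto
  define supp where "supp w = {i. w $ i \<noteq> (0::'a)}" for w :: "'a ^ 6"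
  have "w \<in> W \<Longrightarrow> w \<in> vec.span (W \<inter> rational_vectors)" for w
  proof (induction "card (supp w)" arbitrary: w rule: less_induct)
    case less
    show ?case
    proof (cases "w = 0")
      case True then show ?thesis by (simp add: vec.span_zero)
    next
      case False
      let ?P = "\<lambda>m. m \<in> W \<and> m \<noteq> 0 \<and> supp m \<subseteq> supp w"
      define m where "m = arg_min (\<lambda>m. card (supp m)) ?P"
      have m: "?P m" and min: "\<And>y. ?P y \<Longrightarrow> card (supp m) \<le> card (supp y)"
        using arg_min_natI[of ?P w "\<lambda>m. card (supp m)"] arg_min_nat_le[of ?P _ "\<lambda>m. card (supp m)"]
          less.prems False unfolding m_def by auto
      then obtain i where i: "m $ i \<noteq> 0" by (auto simp: vec_eq_iff)
      define n where "n = inverse (m $ i) *s m"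
      have n: "n \<in> W" "n $ i = 1" "supp n = supp m"
        using W m i by (auto simp: n_def vec.subspace_scale supp_def)
      define d where "d = frob (frob n) - n"
      have dW: "d \<in> W" using W n stable by (simp add: d_def vec.subspace_diff)
      \<comment> \<open>Entries 0 and 1 are fixed by the Frobenius map, so \<open>d\<close> vanishes where \<open>n\<close> does, and at \<open>i\<close>.\<close>
      have dsupp: "supp d \<subset> supp m"
      proof
        show "supp d \<subseteq> supp m" unfolding n(3)[symmetric] by (auto simp: d_def supp_def frob_def)
        have "i \<notin> supp d" "i \<in> supp m" using n(2) i by (simp_all add: d_def supp_def frob_def)
        then show "supp d \<noteq> supp m" by blast
      qed
      have "d = 0"
      proof (rule ccontr)
        assume "d \<noteq> 0"
        with dW dsupp m have "?P d" by auto
        then have "card (supp m) \<le> card (supp d)" by (rule min)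
        moreover have "card (supp d) < card (supp m)" using dsupp by (simp add: psubset_card_mono)
        ultimately show False by simp
      qed
      then have nr: "n \<in> rational_vectors" by (simp add: rational_iff d_def)
      define w' where "w' = w - (w $ i) *s n"
      have "supp w' \<subset> supp w"
      proof
        show "supp w' \<subseteq> supp w" using m n(3) by (auto simp: w'_def supp_def)
        have "i \<notin> supp w'" using n(2) by (simp add: w'_def supp_def)
        moreover have "i \<in> supp w" using m i by (auto simp: supp_def)
        ultimately show "supp w' \<noteq> supp w" by blast
      qed
      then have "card (supp w') < card (supp w)" by (simp add: psubset_card_mono)
      moreover have "w' \<in> W" using W less.prems n by (simp add: w'_def vec.subspace_diff vec.subspace_scale)
      ultimately have "w' \<in> vec.span (W \<inter> rational_vectors)" by (rule less.hyps)
      moreover have "(w $ i) *s n \<in> vec.span (W \<inter> rational_vectors)"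
        using n nr by (simp add: vec.span_base vec.span_scale)
      ultimately have "w' + (w $ i) *s n \<in> vec.span (W \<inter> rational_vectors)" by (rule vec.span_add)
      then show ?thesis by (simp add: w'_def)
    qed
  qed
  then show "W \<subseteq> vec.span (W \<inter> rational_vectors)" by blast
qed

end

section \<open>Maximal totally isotropic subspaces\<close>

text \<open>In the language of polar spaces, a generator is a maximal totally isotropic subspace.\<close>

definition generators :: "('a::field ^ 6) set set"
  where "generators = {W. vec.subspace W \<and> vec.dim W = 3 \<and> (\<forall>x\<in>W. herm x x = 0)}"

definition isotropic_vectors :: "('a::field ^ 6) set"
  where "isotropic_vectors = {v \<in> rational_vectors. v \<noteq> 0 \<and> herm v v = 0}"

text \<open>When \<open>x\<close> is an isotropic point outside the generator \<open>Q\<close>, this is the unique generator through \<open>x\<close>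
  that meets \<open>Q\<close> in a line.\<close>

definition generator_through :: "'a::field ^ 6 \<Rightarrow> ('a ^ 6) set \<Rightarrow> ('a ^ 6) set"
  where "generator_through x Q = vec.span (insert x (Q \<inter> perp {x}))"

lemma generatorD:
  assumes "W \<in> generators"
  shows "vec.subspace W" "vec.dim W = 3" "\<And>x. x \<in> W \<Longrightarrow> herm x x = 0" "0 \<in> W"
  using assms vec.subspace_0 by (auto simp: generators_def)

lemma dim_eq_imp_eq:
  "vec.subspace A \<Longrightarrow> vec.subspace B \<Longrightarrow> A \<subseteq> B \<Longrightarrow> vec.dim B \<le> vec.dim A \<Longrightarrow> A = (B :: ('a::field^'n) set)"
  using vec.subspace_dim_equal by blast

context char2_closed
begin

text \<open>Polarisation: the values of the cubic form at \<open>x + y\<close> and \<open>x + \<omega> y\<close> give two linear equations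
  for \<open>herm x y\<close> and \<open>herm y x\<close> that have only the zero solution.\<close>

lemma generator_herm:
  fixes W :: "('a ^ 6) set"
  assumes W: "W \<in> generators" and xy: "x \<in> W" "y \<in> W"
  shows "herm x y = 0"
proof -
  have eq: "t\<^sup>2 * herm x y + t * herm y x = 0" for t
  proof -
    have "x + t *s y \<in> W" using generatorD(1)[OF W] xy by (simp add: vec.subspace_add vec.subspace_scale)
    then have "herm (x + t *s y) (x + t *s y) = 0" using generatorD(3)[OF W] by blast
    then show ?thesis using generatorD(3)[OF W] xy
      by (simp add: herm_add_left herm_add_right herm_scale_left herm_scale_right add.commute)
  qed
  have "herm x y = herm y x" using eq[of 1] by (simp add: add_eq_0)
  then have "(omega\<^sup>2 + omega) * herm x y = 0" using eq[of omega] by (simp add: algebra_simps)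
  moreover have "omega\<^sup>2 + omega = 1" using omega by (simp add: add_eq_0)
  ultimately show ?thesis by simp
qed

lemma generator_perp:
  fixes W :: "('a ^ 6) set"
  assumes W: "W \<in> generators"
  shows "perp W = W"
proof (rule sym, rule dim_eq_imp_eq)
  show "W \<subseteq> perp W" using generator_herm[OF W] by (auto simp: perp_def)
  show "vec.dim (perp W) \<le> vec.dim W" using dim_perp[of W] generatorD(2)[OF W] by simp
qed (use generatorD[OF W] subspace_perp in auto)

lemma generator_stable:
  fixes W :: "('a ^ 6) set"
  assumes W: "W \<in> generators" and w: "w \<in> W"
  shows "frob (frob w) \<in> W"
proof -
  have "herm (frob (frob w)) y = 0" if "y \<in> W" for y
    using generator_herm[OF W that w] by (simp add: herm_frob_left)
  then have "frob (frob w) \<in> perp W" by (simp add: perp_def)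
  then show ?thesis by (simp add: generator_perp[OF W])
qed

lemma subspace_int_generators:
  "W1 \<in> generators \<Longrightarrow> W2 \<in> generators \<Longrightarrow> vec.subspace (W1 \<inter> W2 :: ('a ^ 6) set)"
  by (simp add: generatorD vec.subspace_inter)

lemma int_generators_rational:
  fixes W1 W2 :: "('a ^ 6) set"
  assumes "W1 \<in> generators" "W2 \<in> generators"
  shows "vec.span (W1 \<inter> W2 \<inter> rational_vectors) = W1 \<inter> W2"
  using assms by (intro frobenius_stable_spanned_by_rational subspace_int_generators) (auto simp: generator_stable)

lemma generator_rational:
  fixes W :: "('a ^ 6) set"
  assumes "W \<in> generators"
  shows "vec.span (W \<inter> rational_vectors) = W"
  using int_generators_rational[OF assms assms] by simp

text \<open>Intersections of generators are spanned by rational vectors, so points outside a given subspace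
  can always be chosen rational.\<close>

lemma exists_rational_notin:
  fixes W1 W2 :: "('a ^ 6) set"
  assumes "W1 \<in> generators" "W2 \<in> generators" "vec.subspace U" "\<not> W1 \<inter> W2 \<subseteq> U"
  shows "\<exists>x\<in>W1 \<inter> W2 \<inter> isotropic_vectors. x \<notin> U"
proof -
  have "\<not> W1 \<inter> W2 \<inter> rational_vectors \<subseteq> U"
    using assms int_generators_rational[of W1 W2] by (metis vec.span_minimal)
  then obtain x where x: "x \<in> W1 \<inter> W2" "x \<in> rational_vectors" "x \<notin> U" by blast
  moreover have "x \<noteq> 0" using x(3) vec.subspace_0[OF assms(3)] by blast
  moreover have "herm x x = 0" using x generatorD(3)[OF assms(1)] by blast
  ultimately show ?thesis by (auto simp: isotropic_vectors_def)
qed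

lemma exists_rational_notin_dim:
  fixes W1 W2 :: "('a ^ 6) set"
  assumes "W1 \<in> generators" "W2 \<in> generators" "vec.subspace U" "vec.dim U < vec.dim (W1 \<inter> W2)"
  shows "\<exists>x\<in>W1 \<inter> W2 \<inter> isotropic_vectors. x \<notin> U"
  using exists_rational_notin[OF assms(1-3)] assms(4) vec.dim_subset[of "W1 \<inter> W2" U] by linarith

lemma isotropic_rational: "x \<in> isotropic_vectors \<Longrightarrow> x \<in> (rational_vectors :: ('a^6) set)"
  by (simp add: isotropic_vectors_def)

context
  fixes Q :: "('a ^ 6) set" and x :: "'a ^ 6"
  assumes Q: "Q \<in> generators" and x: "x \<in> isotropic_vectors" "x \<notin> Q"
begin

lemma subspace_section: "vec.subspace (Q \<inter> perp {x})"
  by (simp add: vec.subspace_inter generatorD(1)[OF Q] subspace_perp)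

lemma dim_section: "vec.dim (Q \<inter> perp {x}) = 2"
proof -
  have "\<exists>u\<in>Q. herm u x \<noteq> 0"
  proof (rule ccontr)
    assume "\<not> ?thesis"
    then have "herm x u = 0" if "u \<in> Q" for u
      using that herm_sym_0[OF isotropic_rational[OF x(1)]] by blast
    then have "x \<in> perp Q" by (simp add: perp_def)
    then show False using x generator_perp[OF Q] by simp
  qed
  then obtain u where "u \<in> Q" "herm u x \<noteq> 0" by blast
  from dim_hyperplane_section[OF generatorD(1)[OF Q], where l = "\<lambda>y. herm y x", OF this]
  have "vec.dim Q = Suc (vec.dim (Q \<inter> {y. herm y x = 0}))"
    by (simp add: herm_add_left herm_scale_left)
  then show ?thesis using generatorD(2)[OF Q] by (simp add: perp_def)
qed

lemma generator_through_cases: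
  assumes "z \<in> generator_through x Q"
  obtains c q where "z = c *s x + q" "q \<in> Q" "herm q x = 0"
proof -
  from assms obtain c where "z - c *s x \<in> vec.span (Q \<inter> perp {x})"
    by (auto simp: generator_through_def vec.span_breakdown_eq)
  then have "z - c *s x \<in> Q \<inter> perp {x}" using subspace_section by (metis vec.span_eq_iff)
  then show ?thesis using that[of c "z - c *s x"] by (auto simp: perp_def)
qed

lemma generator_through: "generator_through x Q \<in> generators"
proof -
  have "x \<notin> vec.span (Q \<inter> perp {x})"
    using subspace_section x by (simp add: vec.span_eq_iff[THEN iffD2])
  then have "vec.dim (generator_through x Q) = 3"
    by (simp add: generator_through_def vec.dim_insert dim_section)
  moreover have "herm z z = 0" if zin: "z \<in> generator_through x Q" for z
  proof -
    obtain c q where z: "z = c *s x + q" "q \<in> Q" "herm q x = 0"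
      using zin by (rule generator_through_cases)
    moreover have "herm x q = 0" using z herm_sym_0[OF isotropic_rational[OF x(1)]] by blast
    moreover have "herm q q = 0" using z generatorD(3)[OF Q] by blast
    ultimately show ?thesis using x(1)
      by (simp add: herm_add_left herm_add_right herm_scale_left herm_scale_right isotropic_vectors_def)
  qed
  ultimately show ?thesis by (simp add: generators_def generator_through_def)
qed

lemma in_generator_through: "x \<in> generator_through x Q"
  "q \<in> Q \<Longrightarrow> herm q x = 0 \<Longrightarrow> q \<in> generator_through x Q"
  by (auto simp: generator_through_def perp_def intro: vec.span_base)

lemma generator_through_neq: "generator_through x Q \<noteq> Q"
  using in_generator_through(1) x by blast

end

lemma dim_int_le_2:
  fixes P Q :: "('a ^ 6) set"
  assumes "P \<in> generators" "Q \<in> generators" "P \<noteq> Q"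
  shows "vec.dim (P \<inter> Q) \<le> 2"
proof (rule ccontr)
  assume "\<not> ?thesis"
  then have "3 \<le> vec.dim (P \<inter> Q)" by simp
  then have "P \<inter> Q = P" "P \<inter> Q = Q"
    using assms by (intro dim_eq_imp_eq; simp add: generatorD vec.subspace_inter)+
  then show False using assms by simp
qed

lemma dim_generator_through_int:
  fixes Q :: "('a ^ 6) set"
  assumes Q: "Q \<in> generators" and x: "x \<in> isotropic_vectors" "x \<notin> Q"
  shows "vec.dim (generator_through x Q \<inter> Q) = 2"
proof (rule antisym)
  show "vec.dim (generator_through x Q \<inter> Q) \<le> 2"
    by (rule dim_int_le_2[OF generator_through[OF Q x] Q generator_through_neq[OF Q x]])
  have "Q \<inter> perp {x} \<subseteq> generator_through x Q \<inter> Q"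
    using in_generator_through(2)[OF Q x] by (auto simp: perp_def)
  then show "2 \<le> vec.dim (generator_through x Q \<inter> Q)"
    using dim_section[OF Q x] vec.dim_subset by metis
qed

subsection \<open>Existence of generators, opposite generators and points as intersections\<close>

text \<open>The subspace in which coordinates are equal in pairs; cubes cancel in pairs.\<close>

lemma exists_generator: "\<exists>W :: ('a ^ 6) set. W \<in> generators"
proof -
  define K :: "6 \<Rightarrow> 6 \<Rightarrow> ('a ^ 6) set" where "K i j = {x. x $ i + x $ j = 0}" for i j
  have K: "vec.subspace (K i j)" for i j
    by (auto simp: K_def vec.subspace_def add.commute add.left_commute simp flip: distrib_left)
  have drop: "vec.dim U = Suc (vec.dim (U \<inter> K i j))" if "vec.subspace U" "axis i 1 \<in> U" "i \<noteq> j"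
    for U i j
    using dim_hyperplane_section[where l = "\<lambda>x. x $ i + x $ j", OF that(1,2)] that(3)
    by (simp add: K_def axis_def algebra_simps)
  let ?W = "UNIV \<inter> K 0 1 \<inter> K 2 3 \<inter> K 4 5"
  have "vec.dim (UNIV :: ('a ^ 6) set) = Suc (vec.dim (UNIV \<inter> K 0 1))"
    by (rule drop) auto
  moreover have "vec.dim (UNIV \<inter> K 0 1) = Suc (vec.dim (UNIV \<inter> K 0 1 \<inter> K 2 3))"
    using K by (intro drop) (auto simp: K_def axis_def)
  moreover have "vec.dim (UNIV \<inter> K 0 1 \<inter> K 2 3) = Suc (vec.dim ?W)"
    using K by (intro drop vec.subspace_inter) (auto simp: K_def axis_def)
  moreover have "vec.dim (UNIV :: ('a ^ 6) set) = 6" by (rule dim_UNIV_6)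
  ultimately have "vec.dim ?W = 3" by simp
  moreover have "herm x x = 0" if "x \<in> ?W" for x
  proof -
    from that show ?thesis by (simp add: herm_def sum_6 K_def add_eq_0 add_self)
  qed
  ultimately have "?W \<in> generators" using K by (simp add: generators_def vec.subspace_inter)
  then show ?thesis by blast
qed

text \<open>The vectors with two nonzero entries 1 and \<open>c\<close> are isotropic because \<open>c ^ 3 = 1\<close>, and together
  only the zero vector is perpendicular to all of them.\<close>

lemma exists_isotropic_not_perp:
  fixes x :: "'a ^ 6"
  assumes "x \<noteq> 0"
  shows "\<exists>y\<in>isotropic_vectors. herm x y \<noteq> 0"
proof (rule ccontr)
  assume none: "\<not> ?thesis"
  have "x $ j = 0" for j
  proof -
    obtain i where i: "i \<noteq> j" using UNIV_6 by (metis one_neq_zero)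
    have eq: "x $ i + x $ j * c\<^sup>2 = 0" if c: "c \<in> F4" "c \<noteq> 0" for c
    proof -
      define y where "y = (\<chi> k. if k = i then 1 else if k = j then c else 0)"
      have sum: "herm z y = z $ i + z $ j * c\<^sup>2" for z
      proof -
        have "herm z y = (\<Sum>k\<in>{i, j}. z $ k * (y $ k)\<^sup>2)"
          unfolding herm_def by (rule sum.mono_neutral_right) (auto simp: y_def)
        then show ?thesis using i by (simp add: y_def)
      qed
      have "herm y y = 0" using F4_mult_sq[OF c] i by (simp add: sum add_self) (simp add: y_def add_self)
      moreover have "y \<noteq> 0" by (auto simp: y_def vec_eq_iff)
      moreover have "y \<in> rational_vectors"
        using c by (auto simp: y_def rational_vectors_def F4_0 F4_1)
      ultimately have "y \<in> isotropic_vectors" by (simp add: isotropic_vectors_def)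
      then show ?thesis using none sum by auto
    qed
    have "x $ i = x $ j" using eq[of 1] F4_1 by (simp add: add_eq_0)
    then have "(1 + omega\<^sup>2) * x $ j = 0"
      using eq[OF omega_F4 omega_neq(1)] by (simp add: algebra_simps)
    moreover have "1 + omega\<^sup>2 = omega" by (simp add: omega_sq two_eq_0)
    ultimately show ?thesis using omega_neq by simp
  qed
  then show False using assms by (simp add: vec_eq_iff)
qed

text \<open>Take \<open>Q\<close> with the smallest possible intersection with \<open>P\<close>. If \<open>x \<noteq> 0\<close> were in the intersection, an
  isotropic \<open>y\<close> that is not perpendicular to \<open>x\<close> would give the generator through \<open>y\<close> adjacent to
  \<open>Q\<close>, which meets \<open>P\<close> only in vectors of \<open>P \<inter> Q\<close> perpendicular to \<open>y\<close>.\<close>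

lemma exists_opposite_generator:
  fixes P :: "('a ^ 6) set"
  assumes P: "P \<in> generators"
  shows "\<exists>Q\<in>generators. P \<inter> Q = {0}"
proof -
  obtain Q where Q: "Q \<in> generators"
    and min: "\<And>R. R \<in> generators \<Longrightarrow> vec.dim (P \<inter> Q) \<le> vec.dim (P \<inter> R)"
    using ex_has_least_nat[of "\<lambda>Q. Q \<in> generators" P "\<lambda>Q. vec.dim (P \<inter> Q)"] P by blast
  have "P \<inter> Q \<subseteq> {0}"
  proof (rule ccontr)
    assume "\<not> ?thesis"
    then obtain x where x: "x \<in> P" "x \<in> Q" "x \<noteq> 0"
      by blast
    obtain y where y: "y \<in> isotropic_vectors" "herm x y \<noteq> 0"
      using exists_isotropic_not_perp[OF x(3)] by blast
    have yQ: "y \<notin> Q" using y(2) generator_herm[OF Q x(2)] by blast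
    let ?R = "generator_through y Q"
    have R: "?R \<in> generators" by (rule generator_through[OF Q y(1) yQ])
    have sub: "P \<inter> ?R \<subseteq> P \<inter> Q \<inter> perp {y}"
    proof
      fix z assume z: "z \<in> P \<inter> ?R"
      then obtain c q where zc: "z = c *s y + q" "q \<in> Q" "herm q y = 0"
        using generator_through_cases[OF Q y(1) yQ] by blast
      have "herm y x \<noteq> 0" using y herm_sym_0[OF isotropic_rational[OF y(1)]] by blast
      moreover have "herm z x = 0" using generator_herm[OF P] z x by blast
      moreover have "herm q x = 0" using generator_herm[OF Q] zc x by blast
      ultimately have "c = 0" by (simp add: zc herm_add_left herm_scale_left)
      then show "z \<in> P \<inter> Q \<inter> perp {y}" using z zc by (auto simp: perp_def)
    qed
    moreover have "x \<in> P \<inter> Q" "x \<notin> perp {y}" using x y by (auto simp: perp_def)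
    ultimately have "P \<inter> ?R \<subset> P \<inter> Q" by blast
    then have "vec.dim (P \<inter> ?R) < vec.dim (P \<inter> Q)"
      using subspace_int_generators[OF P R] subspace_int_generators[OF P Q]
      by (metis vec.dim_psubset vec.span_eq_iff)
    then show False using min[OF R] by simp
  qed
  then show ?thesis using Q generatorD(4)[OF P] generatorD(4)[OF Q] by blast
qed

lemma exists_generator_containing:
  fixes v :: "'a ^ 6"
  assumes "v \<in> isotropic_vectors"
  shows "\<exists>W\<in>generators. v \<in> W"
  using exists_generator generator_through[OF _ assms] in_generator_through(1)[OF _ assms] by metis

text \<open>Project the point onto a generator opposite to a generator that contains it.\<close>

lemma point_is_intersection:
  fixes v :: "'a ^ 6"
  assumes v: "v \<in> isotropic_vectors"
  shows "\<exists>P\<in>generators. \<exists>Q\<in>generators. P \<inter> Q = vec.span {v}"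
proof -
  obtain P where P: "P \<in> generators" "v \<in> P" using exists_generator_containing[OF v] by blast
  obtain P' where P': "P' \<in> generators" "P \<inter> P' = {0}" using exists_opposite_generator[OF P(1)] by blast
  have vP': "v \<notin> P'" using P P' v by (auto simp: isotropic_vectors_def)
  let ?Q = "generator_through v P'"
  have Q: "?Q \<in> generators" by (rule generator_through[OF P'(1) v vP'])
  have "P \<inter> ?Q \<subseteq> vec.span {v}"
  proof
    fix z assume z: "z \<in> P \<inter> ?Q"
    then obtain c q where zc: "z = c *s v + q" "q \<in> P'" "herm q v = 0"
      using generator_through_cases[OF P'(1) v vP'] by blast
    have "z - c *s v \<in> P" using z P generatorD(1)[OF P(1)]
      by (simp add: vec.subspace_diff vec.subspace_scale)
    then have "q = 0" using zc P' by auto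
    then show "z \<in> vec.span {v}" using zc by (simp add: vec.span_base vec.span_scale)
  qed
  moreover have "vec.span {v} \<subseteq> P \<inter> ?Q"
    using P in_generator_through(1)[OF P'(1) v vP'] subspace_int_generators[OF P(1) Q]
    by (intro vec.span_minimal) auto
  ultimately show ?thesis using P Q by blast
qed

end

section \<open>The generators through a point\<close>

definition dual_polar_auts :: "(('a::field ^ 6) set \<Rightarrow> ('a ^ 6) set) set"
  where "dual_polar_auts = {F. bij_betw F generators generators \<and>
    (\<forall>P\<in>generators. \<forall>Q\<in>generators. vec.dim (F P \<inter> F Q) = vec.dim (P \<inter> Q))}"

lemma dual_polar_autsD:
  assumes "F \<in> dual_polar_auts"
  shows "bij_betw F generators generators"
    and "W \<in> generators \<Longrightarrow> F W \<in> generators"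
    and "P \<in> generators \<Longrightarrow> Q \<in> generators \<Longrightarrow> vec.dim (F P \<inter> F Q) = vec.dim (P \<inter> Q)"
    and "P \<in> generators \<Longrightarrow> Q \<in> generators \<Longrightarrow> F P = F Q \<longleftrightarrow> P = Q"
  using assms unfolding dual_polar_auts_def by (auto dest: bij_betwE bij_betw_imp_inj_on inj_onD)

lemma inv_dual_polar_auts:
  assumes F: "F \<in> dual_polar_auts"
  shows "inv_into generators F \<in> dual_polar_auts"
proof -
  let ?G = "inv_into generators F"
  have bij: "bij_betw ?G generators generators"
    using dual_polar_autsD(1)[OF F] by (rule bij_betw_inv_into)
  moreover have "vec.dim (?G P \<inter> ?G Q) = vec.dim (P \<inter> Q)" if "P \<in> generators" "Q \<in> generators" for P Q
    using dual_polar_autsD(3)[OF F, of "?G P" "?G Q"] that bij_betwE[OF bij]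
      bij_betw_inv_into_right[OF dual_polar_autsD(1)[OF F]] by simp
  ultimately show ?thesis by (simp add: dual_polar_auts_def)
qed

lemma dim_ge_2:
  fixes U :: "('a::field ^ 'n) set"
  assumes "v \<in> U" "x \<in> U" "v \<noteq> 0" "x \<notin> vec.span {v}"
  shows "2 \<le> vec.dim U"
proof -
  have "vec.dim (insert x {v}) = 2" using assms by (simp only: vec.dim_insert) simp
  then show ?thesis using vec.dim_subset[of "{x, v}" U] assms by simp
qed

context char2_closed
begin

text \<open>If \<open>R\<close> meets \<open>P\<close> and \<open>Q\<close> in the same line, that line is \<open>P \<inter> Q\<close>. Otherwise the two lines span \<open>R\<close>, so
  \<open>P \<inter> Q\<close>, being perpendicular to \<open>P\<close> and \<open>Q\<close>, is perpendicular to \<open>R\<close> and hence contained in \<open>R\<close>.\<close>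

lemma adjacent_to_both:
  fixes P Q R :: "('a ^ 6) set"
  assumes gen: "P \<in> generators" "Q \<in> generators" "R \<in> generators" and "P \<noteq> Q"
    and dim: "vec.dim (R \<inter> P) = 2" "vec.dim (R \<inter> Q) = 2"
  shows "P \<inter> Q \<subseteq> R"
proof (cases "R \<inter> P \<subseteq> R \<inter> Q")
  case True
  have "R \<inter> P = P \<inter> Q"
    using True gen dim dim_int_le_2[OF gen(1,2) \<open>P \<noteq> Q\<close>]
    by (intro dim_eq_imp_eq subspace_int_generators) auto
  then show ?thesis by blast
next
  case False
  then obtain y where y: "y \<in> R" "y \<in> P" "y \<notin> R \<inter> Q" by blast
  have "vec.dim (insert y (R \<inter> Q)) = 3"
    using y dim subspace_int_generators[OF gen(3,2)]
    by (simp only: vec.dim_insert vec.span_eq_iff[THEN iffD2]) simp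
  then have "vec.span (insert y (R \<inter> Q)) = R"
    using y gen by (intro dim_eq_imp_eq vec.span_minimal) (auto simp: generatorD)
  then have perp: "perp (insert y (R \<inter> Q)) = R"
    by (metis perp_span generator_perp gen(3))
  show ?thesis
  proof
    fix x assume "x \<in> P \<inter> Q"
    then have "x \<in> perp (insert y (R \<inter> Q))"
      using y generator_herm[OF gen(1)] generator_herm[OF gen(2)] by (auto simp: perp_def)
    then show "x \<in> R" by (simp add: perp)
  qed
qed

text \<open>All steps apply \<open>adjacent_to_both\<close> to the images of generators. The fact \<open>close\<close> treats generators \<open>S\<close> through \<open>v\<close> that meet \<open>P\<close> in a line: some \<open>T\<close> is adjacent to both \<open>P\<close>
  and \<open>Q\<close> and meets \<open>P\<close> in the same line as \<open>S\<close>. If \<open>R\<close> meets \<open>P\<close> only in the point, then two different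
  neighbours of \<open>R\<close> through \<open>v\<close> are of the kind just treated, and \<open>R\<close> is adjacent to both.\<close>

lemma generators_through_point_preserved:
  fixes P Q R :: "('a ^ 6) set"
  assumes F: "F \<in> dual_polar_auts" and gen: "P \<in> generators" "Q \<in> generators" "R \<in> generators"
    and v: "v \<noteq> 0" and PQ: "P \<inter> Q = vec.span {v}" and vR: "v \<in> R"
  shows "F P \<inter> F Q \<subseteq> F R"
proof -
  note Fg = dual_polar_autsD(2)[OF F] and Fd = dual_polar_autsD(3)[OF F]
    and Fi = dual_polar_autsD(4)[OF F]
  have vPQ: "v \<in> P" "v \<in> Q" using PQ vec.span_base[of v "{v}"] by auto
  have dPQ: "vec.dim (P \<inter> Q) = 1" using v by (simp add: PQ)
  then have neqPQ: "P \<noteq> Q" using generatorD(2)[OF gen(1)] by auto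
  have adj: "F A \<inter> F B \<subseteq> F C" if "A \<in> generators" "B \<in> generators" "C \<in> generators" "A \<noteq> B"
    "vec.dim (C \<inter> A) = 2" "vec.dim (C \<inter> B) = 2" for A B C
    using that by (intro adjacent_to_both) (auto simp: Fg Fd Fi)
  have spanv: "vec.subspace (vec.span {v})" "vec.dim (vec.span {v}) = 1" using v by simp_all
  have two: "vec.dim (A \<inter> B) = 2" if "A \<in> generators" "B \<in> generators" "A \<noteq> B"
    "v \<in> A" "v \<in> B" "x \<in> A" "x \<in> B" "x \<notin> vec.span {v}" for A B x
    using dim_int_le_2[OF that(1-3)] dim_ge_2[of v "A \<inter> B" x] v that by force
  have close: "F P \<inter> F Q \<subseteq> F S" if S: "S \<in> generators" "v \<in> S" "vec.dim (S \<inter> P) = 2" for S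
  proof -
    obtain x where x: "x \<in> S \<inter> P" "x \<in> isotropic_vectors" "x \<notin> vec.span {v}"
      using exists_rational_notin_dim[OF S(1) gen(1) spanv(1)] S spanv by auto
    have xQ: "x \<notin> Q" using x PQ by blast
    let ?T = "generator_through x Q"
    have T: "?T \<in> generators" by (rule generator_through[OF gen(2) x(2) xQ])
    have vT: "v \<in> ?T" using x vPQ generator_herm[OF gen(1)]
      by (intro in_generator_through(2)[OF gen(2) x(2) xQ]) auto
    have xT: "x \<in> ?T" by (rule in_generator_through(1)[OF gen(2) x(2) xQ])
    have TQ: "vec.dim (?T \<inter> Q) = 2" by (rule dim_generator_through_int[OF gen(2) x(2) xQ])
    then have "?T \<noteq> P" using dPQ by auto
    then have "vec.dim (?T \<inter> P) = 2" using x xT vT vPQ T gen by (intro two) auto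
    then have FT: "F P \<inter> F Q \<subseteq> F ?T" using T TQ gen neqPQ by (intro adj) auto
    show ?thesis
    proof (cases "S = ?T")
      case False
      then have "vec.dim (S \<inter> ?T) = 2" using x xT vT S T by (intro two) auto
      then have "F P \<inter> F ?T \<subseteq> F S" using S T gen \<open>?T \<noteq> P\<close> by (intro adj) auto
      then show ?thesis using FT by blast
    qed (use FT in simp)
  qed
  show ?thesis
  proof (cases "R = P \<or> vec.dim (R \<inter> P) = 2")
    case True
    then show ?thesis using close[OF gen(3) vR] by blast
  next
    case False
    have far: "x \<notin> R" if "x \<in> P" "x \<notin> vec.span {v}" for x
      using two[of R P x] False gen vR vPQ that by blast
    have nbr: "generator_through x R \<in> generators \<and> v \<in> generator_through x R \<and>
        x \<in> generator_through x R \<and> vec.dim (R \<inter> generator_through x R) = 2 \<and>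
        vec.dim (generator_through x R \<inter> P) = 2"
      if x: "x \<in> P" "x \<notin> vec.span {v}" "x \<in> isotropic_vectors" for x
    proof -
      have xR: "x \<notin> R" using far x by blast
      let ?S = "generator_through x R"
      have S: "?S \<in> generators" by (rule generator_through[OF gen(3) x(3) xR])
      have vS: "v \<in> ?S" using x vPQ vR generator_herm[OF gen(1)]
        by (intro in_generator_through(2)[OF gen(3) x(3) xR]) auto
      have xS: "x \<in> ?S" by (rule in_generator_through(1)[OF gen(3) x(3) xR])
      have SR: "vec.dim (R \<inter> ?S) = 2"
        using dim_generator_through_int[OF gen(3) x(3) xR] by (simp add: Int_commute)
      then have "?S \<noteq> P" using False by auto
      then have "vec.dim (?S \<inter> P) = 2" using x xS vS vPQ S gen by (intro two) auto
      then show ?thesis using S vS xS SR by blast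
    qed
    obtain x where x: "x \<in> P" "x \<in> isotropic_vectors" "x \<notin> vec.span {v}"
      using exists_rational_notin_dim[OF gen(1) gen(1) spanv(1)] spanv generatorD(2)[OF gen(1)] by auto
    have dim_vx: "vec.dim (vec.span {x, v}) = 2"
      using x v by (simp only: vec.dim_span vec.dim_insert) simp
    obtain y where y: "y \<in> P" "y \<in> isotropic_vectors" "y \<notin> vec.span {x, v}"
      using exists_rational_notin_dim[OF gen(1) gen(1), of "vec.span {x, v}"] dim_vx
        generatorD(2)[OF gen(1)] by auto
    have yv: "y \<notin> vec.span {v}" using y vec.span_mono[of "{v}" "{x, v}"] by blast
    let ?S = "generator_through x R" and ?T = "generator_through y R"
    note S = nbr[OF x(1,3,2)] and T = nbr[OF y(1) yv y(2)]
    have "?S \<noteq> ?T"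
    proof
      assume "?S = ?T"
      then have sub: "{y, x, v} \<subseteq> ?S \<inter> P" using S T x y vPQ by auto
      have "vec.dim {y, x, v} = 3" using y dim_vx vec.dim_span[of "{x, v}"]
        by (simp only: vec.dim_insert[of y]) simp
      then show False using vec.dim_subset[OF sub] S by simp
    qed
    then have "F ?S \<inter> F ?T \<subseteq> F R" using S T gen by (intro adj) auto
    moreover have "F P \<inter> F Q \<subseteq> F ?S" "F P \<inter> F Q \<subseteq> F ?T" using S T close by blast+
    ultimately show ?thesis by blast
  qed
qed

end

section \<open>Points and planes of the cubic\<close>

definition points_in :: "('a::field ^ 6) set \<Rightarrow> ('a ^ 6) set set"
  where "points_in W = {p \<in> fermat_cubic_F4. p \<subseteq> W}"

context char2_closed
begin

lemma herm_self: "herm x x = (\<Sum>i\<in>UNIV. (x $ i) ^ 3)" for x :: "'a ^ 6"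
  by (simp add: herm_def power_numeral_reduce mult.assoc)

lemma proj_space_iff: "p \<in> proj_space \<longleftrightarrow> (\<exists>v :: 'a ^ 6. v \<noteq> 0 \<and> p = vec.span {v})"
proof
  assume p: "p \<in> proj_space"
  then have "\<not> p \<subseteq> {0}" using vec.dim_eq_0[of p] by (simp add: proj_space_def)
  then obtain v where v: "v \<in> p" "v \<noteq> 0" by blast
  then have "vec.span {v} = p" using p
    by (intro dim_eq_imp_eq vec.span_minimal) (auto simp: proj_space_def)
  then show "\<exists>v. v \<noteq> 0 \<and> p = vec.span {v}" using v by blast
qed (auto simp: proj_space_def)

lemma proj_space_span: "p \<in> proj_space \<Longrightarrow> v \<in> p \<Longrightarrow> v \<noteq> 0 \<Longrightarrow> vec.span {v} = (p :: ('a ^ 6) set)"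
  by (intro dim_eq_imp_eq vec.span_minimal) (auto simp: proj_space_def)

lemma span_isotropic:
  assumes "herm v v = 0" "x \<in> vec.span {v :: 'a ^ 6}"
  shows "herm x x = 0"
  using assms by (auto simp: vec.span_singleton herm_scale_left herm_scale_right)

lemma points_iff: "p \<in> fermat_cubic_F4 \<longleftrightarrow> (\<exists>v\<in>isotropic_vectors :: ('a ^ 6) set. p = vec.span {v})"
proof
  assume p: "p \<in> fermat_cubic_F4"
  then obtain v where v: "v \<in> p" "v \<noteq> 0" "v \<in> rational_vectors"
    by (auto simp: fermat_cubic_F4_def)
  have "herm v v = 0" using p v by (simp add: fermat_cubic_F4_def fermat_cubic_def herm_self)
  moreover have "p = vec.span {v}"
    using p v proj_space_span[of p v] by (simp add: fermat_cubic_F4_def fermat_cubic_def)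
  ultimately show "\<exists>v\<in>isotropic_vectors. p = vec.span {v}"
    using v by (auto simp: isotropic_vectors_def)
next
  assume "\<exists>v\<in>isotropic_vectors. p = vec.span {v}"
  then obtain v where v: "v \<in> rational_vectors" "v \<noteq> 0" "herm v v = 0" "p = vec.span {v}"
    by (auto simp: isotropic_vectors_def)
  then have "p \<in> proj_space" "v \<in> p" by (auto simp: proj_space_iff vec.span_base)
  moreover have "(\<Sum>i\<in>UNIV. (x $ i) ^ 3) = 0" if "x \<in> p" for x
    using span_isotropic[OF v(3)] that v by (simp add: herm_self)
  ultimately show "p \<in> fermat_cubic_F4"
    using v by (auto simp: fermat_cubic_F4_def fermat_cubic_def)
qed

lemma span_in_points: "v \<in> isotropic_vectors \<Longrightarrow> vec.span {v :: 'a ^ 6} \<in> fermat_cubic_F4"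
  by (auto simp: points_iff)

lemma span_subset_generator: "W \<in> generators \<Longrightarrow> vec.span {v :: 'a ^ 6} \<subseteq> W \<longleftrightarrow> v \<in> W"
  using vec.span_minimal[of "{v}" W] vec.span_base[of v "{v}"] by (auto simp: generatorD(1))

lemma isotropic_neq_0: "v \<in> isotropic_vectors \<Longrightarrow> v \<noteq> (0 :: 'a ^ 6)"
  by (simp add: isotropic_vectors_def)

lemma int_dim_1_point:
  fixes P Q :: "('a ^ 6) set"
  assumes "P \<in> generators" "Q \<in> generators" "vec.dim (P \<inter> Q) = 1"
  shows "P \<inter> Q \<in> fermat_cubic_F4"
proof -
  obtain x where x: "x \<in> P \<inter> Q" "x \<in> isotropic_vectors" "x \<notin> {0}"
    using exists_rational_notin_dim[OF assms(1,2), of "{0}"] assms(3) by auto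
  have "P \<inter> Q \<in> proj_space" using assms by (simp add: proj_space_def subspace_int_generators)
  then have "P \<inter> Q = vec.span {x}" using proj_space_span x by auto
  then show ?thesis using x by (simp add: span_in_points)
qed

lemma points_in_mono:
  fixes W1 W2 :: "('a ^ 6) set"
  assumes "W1 \<in> generators" "W2 \<in> generators" "points_in W1 \<subseteq> points_in W2"
  shows "W1 \<subseteq> W2"
proof (rule ccontr)
  assume "\<not> W1 \<subseteq> W2"
  then obtain x where x: "x \<in> W1" "x \<in> isotropic_vectors" "x \<notin> W2"
    using exists_rational_notin[OF assms(1) assms(1) generatorD(1)[OF assms(2)]] by auto
  then have "vec.span {x} \<in> points_in W1"
    using assms(1) by (simp add: points_in_def span_in_points span_subset_generator)
  then have "vec.span {x} \<subseteq> W2" using assms(3) by (auto simp: points_in_def)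
  then show False using x span_subset_generator[OF assms(2)] by blast
qed

lemma points_in_inj:
  "(W1 :: ('a ^ 6) set) \<in> generators \<Longrightarrow> W2 \<in> generators \<Longrightarrow> points_in W1 = points_in W2 \<longleftrightarrow> W1 = W2"
  using points_in_mono by blast

lemma point_is_intersection':
  fixes p :: "('a ^ 6) set"
  assumes "p \<in> fermat_cubic_F4"
  obtains P Q where "P \<in> generators" "Q \<in> generators" "P \<inter> Q = p"
proof -
  obtain v where v: "v \<in> isotropic_vectors" "p = vec.span {v}"
    using assms unfolding points_iff by blast
  from point_is_intersection[OF v(1)] show ?thesis using that v(2) by auto
qed

text \<open>Dimensions of intersections can be read off from the incidence of points with generators alone, so
  that permutations of points that map generators to generators preserve them.\<close>

lemma dim_int_points:
  fixes W1 W2 :: "('a ^ 6) set"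
  assumes W: "W1 \<in> generators" "W2 \<in> generators"
  shows "vec.dim (W1 \<inter> W2) = (if W1 = W2 then 3 else if points_in W1 \<inter> points_in W2 = {} then 0
    else if is_singleton (points_in W1 \<inter> points_in W2) then 1 else 2)"
proof -
  have pts: "p \<in> points_in W1 \<inter> points_in W2 \<longleftrightarrow>
      (\<exists>v\<in>W1 \<inter> W2 \<inter> isotropic_vectors. p = vec.span {v})" for p
  proof
    assume "p \<in> points_in W1 \<inter> points_in W2"
    then have p: "p \<in> fermat_cubic_F4" "p \<subseteq> W1" "p \<subseteq> W2" by (auto simp: points_in_def)
    from p(1) obtain v where v: "v \<in> isotropic_vectors" "p = vec.span {v}"
      unfolding points_iff by blast
    then have "v \<in> W1" "v \<in> W2" using p span_subset_generator W by simp_all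
    then show "\<exists>v\<in>W1 \<inter> W2 \<inter> isotropic_vectors. p = vec.span {v}" using v by blast
  next
    assume "\<exists>v\<in>W1 \<inter> W2 \<inter> isotropic_vectors. p = vec.span {v}"
    then obtain v where v: "v \<in> W1" "v \<in> W2" "v \<in> isotropic_vectors" "p = vec.span {v}"
      by blast
    then show "p \<in> points_in W1 \<inter> points_in W2"
      using W by (simp add: points_in_def span_in_points span_subset_generator)
  qed
  consider "W1 = W2" | "W1 \<noteq> W2" "vec.dim (W1 \<inter> W2) = 0" | "vec.dim (W1 \<inter> W2) = 1" |
    "W1 \<noteq> W2" "vec.dim (W1 \<inter> W2) = 2" using dim_int_le_2[OF W] by linarith
  then show ?thesis
  proof cases
    case 1 then show ?thesis using generatorD(2)[OF W(1)] by simp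
  next
    case 2
    then have "W1 \<inter> W2 \<subseteq> {0}" by simp
    then have "W1 \<inter> W2 \<inter> isotropic_vectors = {}" using isotropic_neq_0 by blast
    then have "points_in W1 \<inter> points_in W2 = {}" using pts by blast
    then show ?thesis using 2 by simp
  next
    case 3
    have "p = W1 \<inter> W2" if "p \<in> points_in W1 \<inter> points_in W2" for p
      using that 3 subspace_int_generators[OF W]
      by (intro dim_eq_imp_eq) (auto simp: points_in_def fermat_cubic_F4_def fermat_cubic_def proj_space_def)
    moreover have "W1 \<inter> W2 \<in> points_in W1 \<inter> points_in W2"
      using int_dim_1_point[OF W 3] by (simp add: points_in_def)
    ultimately have "points_in W1 \<inter> points_in W2 = {W1 \<inter> W2}" by blast
    then show ?thesis using 3 generatorD(2)[OF W(1)] by auto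
  next
    case 4
    obtain x where x: "x \<in> W1 \<inter> W2 \<inter> isotropic_vectors" "x \<notin> {0}"
      using exists_rational_notin_dim[OF W, of "{0}"] 4 by auto
    have "vec.dim (vec.span {x}) < vec.dim (W1 \<inter> W2)" using x 4 by simp
    from exists_rational_notin_dim[OF W vec.subspace_span this]
    obtain y where y: "y \<in> W1 \<inter> W2 \<inter> isotropic_vectors" "y \<notin> vec.span {x}" by blast
    have "vec.span {x} \<in> points_in W1 \<inter> points_in W2" "vec.span {y} \<in> points_in W1 \<inter> points_in W2"
      using x y pts by blast+
    moreover have "vec.span {x} \<noteq> vec.span {y}" using y vec.span_base[of y "{y}"] by blast
    ultimately show ?thesis using 4 by (auto simp: is_singleton_def)
  qed
qed

text \<open>The image of a point \<open>p\<close> is the intersection of the images of all generators through \<open>p\<close>, which is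
  already the intersection of the images of any two generators that meet exactly in \<open>p\<close>. Applying the
  same to the inverse of \<open>F\<close> shows that incidence is preserved in both directions.\<close>

theorem dual_polar_aut_induces_point_permutation:
  assumes F: "F \<in> dual_polar_auts"
  shows "\<exists>\<sigma>\<in>Bij fermat_cubic_F4. \<forall>W\<in>generators. points_in (F W) = \<sigma> ` points_in (W :: ('a ^ 6) set)"
proof -
  note Fg = dual_polar_autsD(2)[OF F] and Fd = dual_polar_autsD(3)[OF F]
    and Fi = dual_polar_autsD(4)[OF F] and Fb = dual_polar_autsD(1)[OF F]
  let ?X = "fermat_cubic_F4 :: ('a ^ 6) set set"
  define \<sigma> where "\<sigma> = (\<lambda>p\<in>?X. \<Inter>(F ` {W \<in> generators. p \<subseteq> W}))"
  have \<sigma>_eq: "\<sigma> (P \<inter> Q) = F P \<inter> F Q"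
    if PQ: "P \<in> generators" "Q \<in> generators" "P \<inter> Q \<in> ?X" for P Q
  proof -
    obtain v where v: "v \<noteq> 0" "P \<inter> Q = vec.span {v}"
      using PQ(3) isotropic_neq_0 by (auto simp: points_iff)
    have "F P \<inter> F Q \<subseteq> F W" if "W \<in> generators" "P \<inter> Q \<subseteq> W" for W
      using that v span_subset_generator
      by (intro generators_through_point_preserved[OF F PQ(1,2) that(1) v]) simp
    then have "\<Inter>(F ` {W \<in> generators. P \<inter> Q \<subseteq> W}) = F P \<inter> F Q" using PQ(1,2) by blast
    then show ?thesis using PQ(3) by (simp add: \<sigma>_def)
  qed
  have dimX: "vec.dim p = 1" if "p \<in> ?X" for p
    using that by (simp add: fermat_cubic_F4_def fermat_cubic_def proj_space_def)
  have \<sigma>_in: "\<sigma> p \<in> ?X" if pX: "p \<in> ?X" for p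
  proof -
    obtain P Q where "P \<in> generators" "Q \<in> generators" "P \<inter> Q = p"
      by (rule point_is_intersection'[OF pX])
    then show ?thesis using \<sigma>_eq[of P Q] pX dimX[OF pX] Fd[of P Q] Fg
      by (auto intro: int_dim_1_point)
  qed
  have incid: "\<sigma> p \<subseteq> F W \<longleftrightarrow> p \<subseteq> W" if p: "p \<in> ?X" and W: "W \<in> generators" for p W
  proof
    assume "p \<subseteq> W" then show "\<sigma> p \<subseteq> F W" using p W by (auto simp: \<sigma>_def)
  next
    assume sub: "\<sigma> p \<subseteq> F W"
    obtain P Q where PQ: "P \<in> generators" "Q \<in> generators" "P \<inter> Q = p"
      by (rule point_is_intersection'[OF p])
    then have eq: "\<sigma> p = F P \<inter> F Q" using \<sigma>_eq p by blast
    obtain v where v: "v \<noteq> 0" "\<sigma> p = vec.span {v}"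
      using \<sigma>_in[OF p] isotropic_neq_0 by (auto simp: points_iff)
    let ?G = "inv_into generators F"
    have "?G (F P) \<inter> ?G (F Q) \<subseteq> ?G (F W)"
      using PQ W v eq sub span_subset_generator[OF Fg[OF W]]
      by (intro generators_through_point_preserved[OF inv_dual_polar_auts[OF F] _ _ _ v(1)]) (auto simp: Fg)
    then show "p \<subseteq> W" using PQ W Fb by (simp add: bij_betw_inv_into_left)
  qed
  have "inj_on \<sigma> ?X"
  proof (rule inj_onI)
    have *: "q \<subseteq> p" if pq: "p \<in> ?X" "q \<in> ?X" "\<sigma> p = \<sigma> q" for p q
    proof -
      obtain P Q where PQ: "P \<in> generators" "Q \<in> generators" "P \<inter> Q = p"
        by (rule point_is_intersection'[OF pq(1)])
      then have "q \<subseteq> P" "q \<subseteq> Q" using incid[OF pq(2)] incid[OF pq(1)] pq(3) by auto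
      then show ?thesis using PQ by blast
    qed
    fix p q assume "p \<in> ?X" "q \<in> ?X" "\<sigma> p = \<sigma> q"
    then show "p = q" using *[of p q] *[of q p] by auto
  qed
  moreover have surj: "\<exists>p\<in>?X. \<sigma> p = r" if r: "r \<in> ?X" for r
  proof -
    obtain A B where AB: "A \<in> generators" "B \<in> generators" "A \<inter> B = r"
      by (rule point_is_intersection'[OF r])
    have "A \<in> F ` generators" "B \<in> F ` generators"
      using AB by (simp_all add: bij_betw_imp_surj_on[OF Fb])
    then obtain P Q where "P \<in> generators" "A = F P" "Q \<in> generators" "B = F Q"
      by (elim imageE)
    with AB(3) have PQ: "P \<in> generators" "Q \<in> generators" "F P \<inter> F Q = r" by simp_all
    then have "P \<inter> Q \<in> ?X" using Fd[of P Q] dimX[OF r] by (simp add: int_dim_1_point)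
    then show ?thesis using \<sigma>_eq PQ by blast
  qed
  moreover have "\<sigma> \<in> extensional ?X" unfolding \<sigma>_def by (rule restrict_extensional)
  moreover have "\<sigma> ` ?X = ?X" using \<sigma>_in surj by blast
  ultimately have "\<sigma> \<in> Bij ?X" by (simp add: Bij_def bij_betw_def)
  moreover have "points_in (F W) = \<sigma> ` points_in W" if W: "W \<in> generators" for W
  proof
    show "\<sigma> ` points_in W \<subseteq> points_in (F W)"
      using \<sigma>_in incid[OF _ W] by (auto simp: points_in_def)
    show "points_in (F W) \<subseteq> \<sigma> ` points_in W"
    proof
      fix r assume r: "r \<in> points_in (F W)"
      then obtain p where p: "p \<in> ?X" "\<sigma> p = r" using surj by (auto simp: points_in_def)
      then have "p \<in> points_in W" using r incid[OF p(1) W] by (auto simp: points_in_def)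
      then show "r \<in> \<sigma> ` points_in W" using p by blast
    qed
  qed
  ultimately show ?thesis by blast
qed

end

section \<open>The group of collineations of the polar space\<close>

definition collineations :: "(('a::field ^ 6) set \<Rightarrow> ('a ^ 6) set) set"
  where "collineations = {\<sigma> \<in> Bij fermat_cubic_F4.
    image \<sigma> ` points_in ` generators = points_in ` generators}"

lemma points_in_subset: "points_in W \<subseteq> fermat_cubic_F4"
  by (auto simp: points_in_def)

lemma image_compose:
  "S \<subseteq> X \<Longrightarrow> compose X f g ` S = f ` g ` S"
  by (auto simp: compose_def)

lemma subgroup_block_stabilizer:
  assumes B: "\<And>S. S \<in> B \<Longrightarrow> S \<subseteq> X"
  shows "subgroup {\<sigma> \<in> Bij X. image \<sigma> ` B = B} (BijGroup X)"
proof (rule group.subgroupI[OF group_BijGroup])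
  have "image (\<lambda>x\<in>X. x) ` B = B"
  proof -
    have "(\<lambda>x\<in>X. x) ` S = S" if "S \<in> B" for S using B[OF that] by auto
    then show ?thesis by simp
  qed
  then show "{\<sigma> \<in> Bij X. image \<sigma> ` B = B} \<noteq> {}" using id_Bij by blast
next
  fix \<sigma> assume "\<sigma> \<in> {\<sigma> \<in> Bij X. image \<sigma> ` B = B}"
  then have \<sigma>: "\<sigma> \<in> Bij X" "image \<sigma> ` B = B" by auto
  let ?i = "restrict (inv_into X \<sigma>) X"
  have inj: "inj_on \<sigma> X" and im: "\<sigma> ` X = X" using \<sigma>(1) by (auto simp: Bij_def bij_betw_def)
  have undo: "?i ` \<sigma> ` S = S" if S: "S \<in> B" for S
  proof -
    have "?i (\<sigma> x) = x" if "x \<in> S" for x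
      using B[OF S] that inj im by auto
    then have "(\<lambda>x. ?i (\<sigma> x)) ` S = (\<lambda>x. x) ` S" by (intro image_cong refl)
    then show ?thesis by (simp only: image_image image_ident)
  qed
  have "image ?i ` image \<sigma> ` B = (\<lambda>S. ?i ` \<sigma> ` S) ` B" by (rule image_image)
  also have "\<dots> = (\<lambda>S. S) ` B" by (rule image_cong[OF refl]) (rule undo)
  finally have "image ?i ` image \<sigma> ` B = B" by (simp only: image_ident)
  then have "image ?i ` B = B" by (simp only: \<sigma>(2))
  then show "inv\<^bsub>BijGroup X\<^esub> \<sigma> \<in> {\<sigma> \<in> Bij X. image \<sigma> ` B = B}"
    using \<sigma>(1) restrict_inv_into_Bij by (simp add: inv_BijGroup)
next
  fix \<sigma> \<tau> assume "\<sigma> \<in> {\<sigma> \<in> Bij X. image \<sigma> ` B = B}" "\<tau> \<in> {\<sigma> \<in> Bij X. image \<sigma> ` B = B}"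
  then have \<sigma>: "\<sigma> \<in> Bij X" "image \<sigma> ` B = B" and \<tau>: "\<tau> \<in> Bij X" "image \<tau> ` B = B" by auto
  have "image (compose X \<sigma> \<tau>) ` B = (\<lambda>S. \<sigma> ` \<tau> ` S) ` B"
    by (rule image_cong[OF refl], rule image_compose, rule B)
  also have "\<dots> = image \<sigma> ` image \<tau> ` B" by (rule image_image[symmetric])
  also have "\<dots> = B" by (simp only: \<sigma> \<tau>)
  finally have "image (compose X \<sigma> \<tau>) ` B = B" .
  then show "\<sigma> \<otimes>\<^bsub>BijGroup X\<^esub> \<tau> \<in> {\<sigma> \<in> Bij X. image \<sigma> ` B = B}"
    using \<sigma>(1) \<tau>(1) by (simp add: BijGroup_def compose_Bij)
qed (auto simp: BijGroup_def)

lemma subgroup_collineations: "subgroup collineations (BijGroup fermat_cubic_F4)"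
  unfolding collineations_def
  by (rule subgroup_block_stabilizer) (use points_in_subset in blast)

lemma collineation_generator:
  assumes "\<sigma> \<in> collineations" "W \<in> generators"
  shows "\<exists>W'\<in>generators. points_in W' = \<sigma> ` points_in W"
proof -
  have "\<sigma> ` points_in W \<in> image \<sigma> ` points_in ` generators" using assms(2) by blast
  also have "\<dots> = points_in ` generators" using assms(1) by (simp add: collineations_def)
  finally show ?thesis by auto
qed

lemma collineation_generator_inverse:
  assumes "\<sigma> \<in> collineations" "W' \<in> generators"
  shows "\<exists>W\<in>generators. points_in W' = \<sigma> ` points_in W"
proof -
  have "points_in W' \<in> points_in ` generators" using assms(2) by blast
  also have "\<dots> = image \<sigma> ` points_in ` generators" using assms(1) by (simp add: collineations_def)
  finally show ?thesis by auto
qed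

lemma collineationD:
  assumes "\<sigma> \<in> collineations"
  shows "\<sigma> \<in> Bij fermat_cubic_F4" "bij_betw \<sigma> fermat_cubic_F4 fermat_cubic_F4"
    "inj_on \<sigma> fermat_cubic_F4" "p \<in> fermat_cubic_F4 \<Longrightarrow> \<sigma> p \<in> fermat_cubic_F4"
    "\<sigma> \<in> extensional fermat_cubic_F4"
  using assms by (auto simp: collineations_def Bij_def bij_betw_def)

section \<open>The action on planes\<close>

definition plane_of :: "('a::field ^ 6) set \<Rightarrow> ('a ^ 6) set set"
  where "plane_of W = {p \<in> proj_space. p \<subseteq> W}"

context char2_closed
begin

lemma plane_of_points: "plane_of W \<inter> fermat_cubic_F4 = points_in (W :: ('a ^ 6) set)"
  by (auto simp: plane_of_def points_in_def fermat_cubic_F4_def fermat_cubic_def)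

lemma planes_eq: "planes = plane_of ` (generators :: ('a ^ 6) set set)"
proof -
  have "plane_of W \<subseteq> fermat_cubic \<longleftrightarrow> (\<forall>x\<in>W. herm x x = 0)" if W: "vec.subspace W"
    for W :: "('a ^ 6) set"
  proof
    assume sub: "plane_of W \<subseteq> fermat_cubic"
    show "\<forall>x\<in>W. herm x x = 0"
    proof
      fix x assume x: "x \<in> W"
      show "herm x x = 0"
      proof (cases "x = 0")
        case False
        have "vec.span {x} \<subseteq> W" using W x by (intro vec.span_minimal) auto
        then have "vec.span {x} \<in> fermat_cubic" using sub False
          by (auto simp: plane_of_def proj_space_iff)
        then show ?thesis using vec.span_base[of x "{x}"] by (simp add: fermat_cubic_def herm_self)
      qed simp
    qed
  next
    assume "\<forall>x\<in>W. herm x x = 0"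
    then show "plane_of W \<subseteq> fermat_cubic" by (auto simp: plane_of_def fermat_cubic_def herm_self)
  qed
  then show ?thesis
    unfolding planes_def proj_planes_def generators_def plane_of_def[symmetric] by blast
qed

lemma plane_of_inj:
  "W1 \<in> generators \<Longrightarrow> W2 \<in> generators \<Longrightarrow> plane_of W1 = plane_of W2 \<longleftrightarrow> W1 = (W2 :: ('a ^ 6) set)"
  using plane_of_points points_in_inj by metis

lemma dim_Union_planes:
  fixes W1 W2 :: "('a ^ 6) set"
  assumes "W1 \<in> generators" "W2 \<in> generators"
  shows "vec.dim (\<Union>(plane_of W1 \<inter> plane_of W2)) = vec.dim (W1 \<inter> W2)"
proof (rule antisym)
  show "vec.dim (\<Union>(plane_of W1 \<inter> plane_of W2)) \<le> vec.dim (W1 \<inter> W2)"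
    by (rule vec.dim_subset) (auto simp: plane_of_def)
  have "x \<in> vec.span (\<Union>(plane_of W1 \<inter> plane_of W2))" if x: "x \<in> W1 \<inter> W2" for x
  proof (cases "x = 0")
    case False
    then have "vec.span {x} \<in> plane_of W1 \<inter> plane_of W2"
      using x assms by (auto simp: plane_of_def proj_space_iff span_subset_generator[THEN iffD2, THEN subsetD])
    then show ?thesis using vec.span_base[of x "{x}"] by (intro vec.span_base) blast
  qed (simp add: vec.span_zero)
  then show "vec.dim (W1 \<inter> W2) \<le> vec.dim (\<Union>(plane_of W1 \<inter> plane_of W2))"
    by (intro vec.dim_mono) blast
qed

text \<open>The four possible dimensions 0, 1, 2, 3 give the distinct values 0, 1, -1, 3.\<close>

lemma intersection_number_eq_iff:
  fixes W1 W2 V1 V2 :: "('a ^ 6) set"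
  assumes "W1 \<in> generators" "W2 \<in> generators" "V1 \<in> generators" "V2 \<in> generators"
  shows "intersection_number (plane_of W1) (plane_of W2) = intersection_number (plane_of V1) (plane_of V2)
    \<longleftrightarrow> vec.dim (W1 \<inter> W2) = vec.dim (V1 \<inter> V2)"
proof -
  define \<nu> :: "nat \<Rightarrow> int" where "\<nu> d = (1 - (-2) ^ d) div 3" for d
  have inum: "intersection_number (plane_of A) (plane_of B) = \<nu> (vec.dim (A \<inter> B))"
    if "A \<in> generators" "B \<in> generators" for A B :: "('a ^ 6) set"
    by (simp add: intersection_number_def proj_dim_def dim_Union_planes[OF that] \<nu>_def)
  have le: "vec.dim (A \<inter> B) \<in> {0, 1, 2, 3}" if "A \<in> generators" for A B :: "('a ^ 6) set"
  proof -
    have small: "d \<in> {0, 1, 2, 3}" if "d \<le> 3" for d :: nat using that by auto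
    show ?thesis using vec.dim_subset[of "A \<inter> B" A] generatorD(2)[OF that] by (intro small) simp
  qed
  have \<nu>_inj: "\<nu> d = \<nu> e \<longleftrightarrow> d = e" if "d \<in> {0, 1, 2, 3}" "e \<in> {0, 1, 2, 3}" for d e
    using that by (auto simp: \<nu>_def)
  show ?thesis unfolding inum[OF assms(1,2)] inum[OF assms(3,4)]
    by (rule \<nu>_inj[OF le[OF assms(1)] le[OF assms(3)]])
qed

lemma rho_planes_plane_of:
  fixes W W' :: "('a ^ 6) set"
  assumes "W \<in> generators" "W' \<in> generators" "points_in W' = \<sigma> ` points_in W"
  shows "rho_planes \<sigma> (plane_of W) = plane_of W'"
proof -
  have "(THE Q. Q \<in> planes \<and> Q \<inter> fermat_cubic_F4 = \<sigma> ` (plane_of W \<inter> fermat_cubic_F4)) = plane_of W'"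
  proof (rule the_equality)
    show "plane_of W' \<in> planes \<and> plane_of W' \<inter> fermat_cubic_F4 = \<sigma> ` (plane_of W \<inter> fermat_cubic_F4)"
      using assms by (simp add: planes_eq plane_of_points)
  next
    fix Q assume Q: "Q \<in> planes \<and> Q \<inter> fermat_cubic_F4 = \<sigma> ` (plane_of W \<inter> fermat_cubic_F4)"
    then obtain V where V: "V \<in> generators" "Q = plane_of V" by (auto simp: planes_eq)
    then have "points_in V = points_in W'" using Q assms by (simp add: plane_of_points)
    then show "Q = plane_of W'" using V assms points_in_inj by blast
  qed
  then show ?thesis using assms by (simp add: rho_planes_def planes_eq)
qed

lemma dim_int_collineation:
  fixes W1 W2 :: "('a ^ 6) set"
  assumes \<sigma>: "\<sigma> \<in> collineations" and W: "W1 \<in> generators" "W2 \<in> generators"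
    and V: "V1 \<in> generators" "V2 \<in> generators"
      "points_in V1 = \<sigma> ` points_in W1" "points_in V2 = \<sigma> ` points_in W2"
  shows "vec.dim (V1 \<inter> V2) = vec.dim (W1 \<inter> W2)"
proof -
  note inj = collineationD(3)[OF \<sigma>]
  have eq: "points_in V1 \<inter> points_in V2 = \<sigma> ` (points_in W1 \<inter> points_in W2)"
    unfolding V(3,4) by (rule inj_on_image_Int[OF inj points_in_subset points_in_subset, symmetric])
  have "V1 = V2 \<longleftrightarrow> W1 = W2"
    unfolding points_in_inj[OF V(1,2), symmetric] points_in_inj[OF W, symmetric] V(3,4)
    by (rule inj_on_image_eq_iff[OF inj points_in_subset points_in_subset])
  moreover have "is_singleton (\<sigma> ` S) \<longleftrightarrow> is_singleton S" if "S \<subseteq> fermat_cubic_F4" for S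
    using card_image[OF inj_on_subset[OF inj that]] by (simp add: is_singleton_altdef)
  then have "is_singleton (points_in V1 \<inter> points_in V2) \<longleftrightarrow> is_singleton (points_in W1 \<inter> points_in W2)"
    unfolding eq using points_in_subset by blast
  ultimately show ?thesis unfolding dim_int_points[OF V(1,2)] dim_int_points[OF W] by (simp add: eq)
qed

lemma Aut_planes_carrier: "carrier (Aut_planes :: (('a ^ 6) set set \<Rightarrow> _) monoid) =
    {f \<in> Bij planes. \<forall>P\<in>planes. \<forall>Q\<in>planes. intersection_number (f P) (f Q) = intersection_number P Q}"
  by (simp add: Aut_planes_def)

lemma rho_planes_Aut:
  fixes \<sigma> :: "('a ^ 6) set \<Rightarrow> ('a ^ 6) set"
  assumes \<sigma>: "\<sigma> \<in> collineations"
  shows "rho_planes \<sigma> \<in> carrier Aut_planes"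
proof -
  have ex: "\<exists>W'\<in>generators. points_in W' = \<sigma> ` points_in W" if "W \<in> generators" for W
    by (rule collineation_generator[OF \<sigma> that])
  have "inj_on (rho_planes \<sigma>) planes"
  proof (rule inj_onI)
    fix P Q assume "P \<in> planes" "Q \<in> planes" and eq: "rho_planes \<sigma> P = rho_planes \<sigma> Q"
    then obtain W1 W2 where W: "W1 \<in> generators" "P = plane_of W1" "W2 \<in> generators" "Q = plane_of W2"
      by (auto simp: planes_eq)
    obtain V1 where V1: "V1 \<in> generators" "points_in V1 = \<sigma> ` points_in W1" using ex W by blast
    obtain V2 where V2: "V2 \<in> generators" "points_in V2 = \<sigma> ` points_in W2" using ex W by blast
    have "V1 = V2" using eq W V1 V2 by (simp add: rho_planes_plane_of plane_of_inj)
    then have "points_in W1 = points_in W2"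
      using V1 V2 inj_on_image_eq_iff[OF collineationD(3)[OF \<sigma>] points_in_subset points_in_subset] by metis
    then show "P = Q" using W points_in_inj by blast
  qed
  moreover have "rho_planes \<sigma> ` planes = planes"
  proof
    show "rho_planes \<sigma> ` planes \<subseteq> planes"
      using ex rho_planes_plane_of by (force simp: planes_eq)
    show "planes \<subseteq> rho_planes \<sigma> ` planes"
    proof
      fix Q :: "('a ^ 6) set set" assume "Q \<in> planes"
      then obtain V where V: "V \<in> generators" "Q = plane_of V" by (auto simp: planes_eq)
      obtain W where W: "W \<in> generators" "points_in V = \<sigma> ` points_in W"
        using collineation_generator_inverse[OF \<sigma> V(1)] by blast
      have "Q = rho_planes \<sigma> (plane_of W)"
        using rho_planes_plane_of[OF W(1) V(1) W(2)] V(2) by simp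
      moreover have "plane_of W \<in> planes" using W(1) by (simp add: planes_eq)
      ultimately show "Q \<in> rho_planes \<sigma> ` planes" by (rule image_eqI)
    qed
  qed
  moreover have "rho_planes \<sigma> \<in> extensional planes" by (simp add: rho_planes_def)
  ultimately have "rho_planes \<sigma> \<in> Bij planes" by (simp add: Bij_def bij_betw_def)
  moreover have "intersection_number (rho_planes \<sigma> P) (rho_planes \<sigma> Q) = intersection_number P Q"
    if PQ: "P \<in> planes" "Q \<in> planes" for P Q
  proof -
    obtain W1 W2 where W: "W1 \<in> generators" "P = plane_of W1" "W2 \<in> generators" "Q = plane_of W2"
      using PQ by (auto simp: planes_eq)
    obtain V1 where V1: "V1 \<in> generators" "points_in V1 = \<sigma> ` points_in W1" using ex W by blast
    obtain V2 where V2: "V2 \<in> generators" "points_in V2 = \<sigma> ` points_in W2" using ex W by blast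
    show ?thesis using W V1 V2 dim_int_collineation[OF \<sigma>]
      by (simp add: rho_planes_plane_of intersection_number_eq_iff)
  qed
  ultimately show ?thesis by (simp add: Aut_planes_carrier)
qed

lemma rho_planes_compose:
  fixes \<sigma> \<tau> :: "('a ^ 6) set \<Rightarrow> ('a ^ 6) set"
  assumes \<sigma>: "\<sigma> \<in> collineations" and \<tau>: "\<tau> \<in> collineations"
  shows "rho_planes (compose fermat_cubic_F4 \<sigma> \<tau>) = compose planes (rho_planes \<sigma>) (rho_planes \<tau>)"
proof (rule extensionalityI[of _ planes])
  fix P :: "('a ^ 6) set set" assume "P \<in> planes"
  then obtain W where W: "W \<in> generators" "P = plane_of W" by (auto simp: planes_eq)
  obtain V where V: "V \<in> generators" "points_in V = \<tau> ` points_in W"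
    using collineation_generator[OF \<tau> W(1)] by blast
  obtain U where U: "U \<in> generators" "points_in U = \<sigma> ` points_in V"
    using collineation_generator[OF \<sigma> V(1)] by blast
  have "points_in U = compose fermat_cubic_F4 \<sigma> \<tau> ` points_in W"
    by (simp add: image_compose[OF points_in_subset] U V)
  then have "rho_planes (compose fermat_cubic_F4 \<sigma> \<tau>) P = plane_of U"
    using W U by (simp add: rho_planes_plane_of)
  moreover have "compose planes (rho_planes \<sigma>) (rho_planes \<tau>) P = plane_of U"
    using W V U \<open>P \<in> planes\<close> by (simp add: compose_eq rho_planes_plane_of[OF W(1) V] rho_planes_plane_of[OF V(1) U])
  ultimately show "rho_planes (compose fermat_cubic_F4 \<sigma> \<tau>) P = compose planes (rho_planes \<sigma>) (rho_planes \<tau>) P"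
    by simp
qed (simp_all add: rho_planes_def)

text \<open>Points are intersections of two generators, so a collineation is determined by its action on the
  generators.\<close>

lemma rho_planes_inj: "inj_on rho_planes (collineations :: (('a ^ 6) set \<Rightarrow> ('a ^ 6) set) set)"
proof (rule inj_onI)
  fix \<sigma> \<tau> :: "('a ^ 6) set \<Rightarrow> ('a ^ 6) set"
  assume \<sigma>: "\<sigma> \<in> collineations" and \<tau>: "\<tau> \<in> collineations" and eq: "rho_planes \<sigma> = rho_planes \<tau>"
  have img: "\<sigma> ` points_in W = \<tau> ` points_in W" if W: "W \<in> generators" for W
  proof -
    obtain V where V: "V \<in> generators" "points_in V = \<sigma> ` points_in W"
      using collineation_generator[OF \<sigma> W] by blast
    obtain U where U: "U \<in> generators" "points_in U = \<tau> ` points_in W"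
      using collineation_generator[OF \<tau> W] by blast
    have "plane_of V = plane_of U"
      using rho_planes_plane_of[OF W V] rho_planes_plane_of[OF W U] eq by simp
    then show ?thesis using U V plane_of_inj by metis
  qed
  show "\<sigma> = \<tau>"
  proof (rule extensionalityI)
    fix p assume p: "p \<in> (fermat_cubic_F4 :: ('a ^ 6) set set)"
    obtain P Q where PQ: "P \<in> generators" "Q \<in> generators" "P \<inter> Q = p"
      by (rule point_is_intersection'[OF p])
    have "points_in P \<inter> points_in Q = {p}"
    proof -
      have "vec.dim q = 1 \<and> vec.subspace q" if "q \<in> fermat_cubic_F4" for q :: "('a ^ 6) set"
        using that by (simp add: fermat_cubic_F4_def fermat_cubic_def proj_space_def)
      then have "q = p" if "q \<in> fermat_cubic_F4" "q \<subseteq> p" for q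
        using that p by (intro dim_eq_imp_eq) auto
      then show ?thesis using PQ p by (auto simp: points_in_def)
    qed
    then have "{\<sigma> p} = \<sigma> ` points_in P \<inter> \<sigma> ` points_in Q" "{\<tau> p} = \<tau> ` points_in P \<inter> \<tau> ` points_in Q"
      using inj_on_image_Int[OF collineationD(3)[OF \<sigma>] points_in_subset points_in_subset, of P Q]
        inj_on_image_Int[OF collineationD(3)[OF \<tau>] points_in_subset points_in_subset, of P Q] by auto
    then have "{\<sigma> p} = {\<tau> p}" by (simp only: img[OF PQ(1)] img[OF PQ(2)])
    then show "\<sigma> p = \<tau> p" by simp
  qed (use \<sigma> \<tau> collineationD(5) in auto)
qed

lemma rho_planes_surj:
  fixes f :: "('a ^ 6) set set \<Rightarrow> ('a ^ 6) set set"
  assumes f: "f \<in> carrier Aut_planes"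
  shows "\<exists>\<sigma>\<in>collineations. rho_planes \<sigma> = f"
proof -
  have fB: "f \<in> Bij planes" and f\<nu>: "\<And>P Q. P \<in> planes \<Longrightarrow> Q \<in> planes \<Longrightarrow>
      intersection_number (f P) (f Q) = intersection_number P Q"
    using f by (auto simp: Aut_planes_carrier)
  have bij: "bij_betw f planes planes" using fB by (simp add: Bij_def)
  have bijp: "bij_betw plane_of (generators :: ('a ^ 6) set set) planes"
    unfolding planes_eq by (intro bij_betw_imageI inj_onI) (auto simp: plane_of_inj)
  define F where "F = inv_into generators plane_of \<circ> (f \<circ> plane_of)"
  have bijF: "bij_betw F generators generators"
    unfolding F_def using bijp bij by (intro bij_betw_trans[OF bij_betw_trans] bij_betw_inv_into)
  have pF: "plane_of (F W) = f (plane_of W)" if "W \<in> generators" for W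
    using bij_betw_inv_into_right[OF bijp, of "f (plane_of W)"] bij_betwE[OF bij] bij_betwE[OF bijp] that
    by (simp add: F_def)
  have Fg: "F W \<in> generators" if "W \<in> generators" for W using bij_betwE[OF bijF] that by blast
  have "vec.dim (F P \<inter> F Q) = vec.dim (P \<inter> Q)" if "P \<in> generators" "Q \<in> generators" for P Q
    using f\<nu>[of "plane_of P" "plane_of Q"] intersection_number_eq_iff[OF Fg Fg, of P Q P Q] that pF
    by (simp add: planes_eq)
  then have "F \<in> dual_polar_auts" using bijF by (simp add: dual_polar_auts_def)
  from dual_polar_aut_induces_point_permutation[OF this]
  obtain \<sigma> where \<sigma>: "\<sigma> \<in> Bij fermat_cubic_F4" "\<And>W. W \<in> generators \<Longrightarrow> points_in (F W) = \<sigma> ` points_in W"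
    by blast
  have "image \<sigma> ` points_in ` generators = (\<lambda>W. \<sigma> ` points_in W) ` generators"
    by (rule image_image)
  also have "\<dots> = (\<lambda>W. points_in (F W)) ` generators"
    by (rule image_cong[OF refl]) (simp only: \<sigma>(2))
  also have "\<dots> = points_in ` F ` generators" by (rule image_image[symmetric])
  finally have "image \<sigma> ` points_in ` generators = points_in ` F ` generators" .
  then have "\<sigma> \<in> collineations"
    using \<sigma> bij_betw_imp_surj_on[OF bijF] by (simp add: collineations_def)
  moreover have "rho_planes \<sigma> = f"
  proof (rule extensionalityI[of _ planes])
    fix P :: "('a ^ 6) set set" assume "P \<in> planes"
    then obtain W where W: "W \<in> generators" "P = plane_of W" by (auto simp: planes_eq)
    then show "rho_planes \<sigma> P = f P" using rho_planes_plane_of[OF W(1) Fg \<sigma>(2)] pF by simp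
  qed (use fB in \<open>simp_all add: rho_planes_def Bij_def\<close>)
  ultimately show ?thesis by blast
qed

theorem rho_planes_bij_collineations:
  "bij_betw rho_planes (collineations :: (('a ^ 6) set \<Rightarrow> ('a ^ 6) set) set) (carrier Aut_planes)"
  using rho_planes_inj rho_planes_Aut rho_planes_surj by (auto simp: bij_betw_def)

end

section \<open>Unitary matrices\<close>

lemma bar_nth [simp]: "bar g $ i $ j = (g $ i $ j)\<^sup>2"
  by (simp add: bar_def)

lemma transpose_nth [simp]: "transpose g $ i $ j = g $ j $ i"
  by (simp add: transpose_def)

lemma bar_transpose: "bar (transpose g) = transpose (bar g)"
  by (simp add: vec_eq_iff)

lemma bar_mat_1: "bar (mat 1) = mat 1"
  by (simp add: vec_eq_iff mat_def)

lemma mat_mult_vec: "mat c *v x = c *s (x :: 'a::field ^ 'n)"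
  by (simp add: vec_eq_iff matrix_vector_mult_def mat_def if_distrib[of "\<lambda>a. a * _"] cong: if_cong)

lemma GU_iff: "g \<in> carrier GU \<longleftrightarrow> transpose g ** bar g = (mat 1 :: 'a::field ^ 6 ^ 6)"
proof -
  have "g ** transpose (bar g) = mat 1 \<longleftrightarrow> transpose (bar g) ** g = mat 1"
    by (rule matrix_left_right_inverse)
  also have "\<dots> \<longleftrightarrow> transpose (transpose (bar g) ** g) = transpose (mat 1)"
    by (metis transpose_transpose)
  also have "\<dots> \<longleftrightarrow> transpose g ** bar g = mat 1"
    by (simp add: matrix_transpose_mul transpose_mat)
  finally have "g ** transpose (bar g) = mat 1 \<longleftrightarrow> transpose g ** bar g = mat 1" .
  moreover have "invertible g" if "g ** transpose (bar g) = mat 1"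
    using that matrix_left_right_inverse[of g "transpose (bar g)"] unfolding invertible_def by blast
  ultimately show ?thesis by (auto simp: GU_def)
qed

lemma GU_inverse:
  assumes "g \<in> carrier GU"
  shows "g ** transpose (bar g) = mat 1" "transpose (bar g) ** g = (mat 1 :: 'a::field ^ 6 ^ 6)"
  using assms matrix_left_right_inverse[of g "transpose (bar g)"] by (auto simp: GU_def)

lemma subspace_image_matrix:
  fixes g :: "'a::field ^ 'n ^ 'm"
  assumes W: "vec.subspace W"
  shows "vec.subspace ((*v) g ` W)"
  unfolding vec.subspace_def
proof (intro conjI ballI allI)
  show "0 \<in> (*v) g ` W" using vec.subspace_0[OF W] by (intro image_eqI[of _ _ 0]) simp_all
  fix x assume "x \<in> (*v) g ` W"
  then obtain a where a: "a \<in> W" "x = g *v a" by blast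
  show "x + y \<in> (*v) g ` W" if "y \<in> (*v) g ` W" for y
    using that a vec.subspace_add[OF W] by (auto simp flip: matrix_vector_right_distrib)
  show "c *s x \<in> (*v) g ` W" for c
    using a vec.subspace_scale[OF W] by (auto simp flip: vector_scalar_commute)
qed

context char2_closed
begin

lemma bar_mult: "bar (A ** B) = bar A ** bar (B :: 'a ^ 6 ^ 6)"
  by (simp add: vec_eq_iff matrix_matrix_mult_def sq_sum power_mult_distrib)

lemma frob_matrix: "frob (g *v x) = bar g *v frob (x :: 'a ^ 6)"
  by (simp add: vec_eq_iff matrix_vector_mult_def frob_def sq_sum power_mult_distrib)

text \<open>The matrix on the right is the Gram matrix of the columns of \<open>M\<close>.\<close>

lemma herm_matrix:
  "herm (M *v x) (M *v y) = (\<Sum>j\<in>UNIV. \<Sum>k\<in>UNIV. x $ j * (y $ k)\<^sup>2 * (transpose M ** bar M) $ j $ k)"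
  for M :: "'a ^ 6 ^ 6"
proof -
  have "herm (M *v x) (M *v y) =
      (\<Sum>i\<in>UNIV. (\<Sum>j\<in>UNIV. M $ i $ j * x $ j) * (\<Sum>k\<in>UNIV. (M $ i $ k)\<^sup>2 * (y $ k)\<^sup>2))"
    by (simp add: herm_def matrix_vector_mult_def sq_sum power_mult_distrib)
  also have "\<dots> = (\<Sum>i\<in>UNIV. \<Sum>j\<in>UNIV. \<Sum>k\<in>UNIV. x $ j * (y $ k)\<^sup>2 * (M $ i $ j * (M $ i $ k)\<^sup>2))"
    by (simp add: sum_product mult_ac)
  also have "\<dots> = (\<Sum>j\<in>UNIV. \<Sum>i\<in>UNIV. \<Sum>k\<in>UNIV. x $ j * (y $ k)\<^sup>2 * (M $ i $ j * (M $ i $ k)\<^sup>2))"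
    by (rule sum.swap)
  also have "\<dots> = (\<Sum>j\<in>UNIV. \<Sum>k\<in>UNIV. \<Sum>i\<in>UNIV. x $ j * (y $ k)\<^sup>2 * (M $ i $ j * (M $ i $ k)\<^sup>2))"
    by (rule sum.cong[OF refl], rule sum.swap)
  also have "\<dots> = (\<Sum>j\<in>UNIV. \<Sum>k\<in>UNIV. x $ j * (y $ k)\<^sup>2 * (transpose M ** bar M) $ j $ k)"
    by (simp add: matrix_matrix_mult_def sum_distrib_left)
  finally show ?thesis .
qed

lemma GU_herm:
  assumes "g \<in> carrier GU"
  shows "herm (g *v x) (g *v y) = herm x (y :: 'a ^ 6)"
proof -
  have "transpose g ** bar g = mat 1" using assms by (simp add: GU_iff)
  then have "herm (g *v x) (g *v y) = (\<Sum>j\<in>UNIV. \<Sum>k\<in>UNIV. x $ j * (y $ k)\<^sup>2 * (if j = k then 1 else 0))"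
    by (simp add: herm_matrix mat_def)
  also have "\<dots> = herm x y"
    by (simp add: herm_def if_distrib[of "\<lambda>a. _ * a"] cong: if_cong)
  finally show ?thesis .
qed

text \<open>The inverse of \<open>bar g\<close> can be computed in two ways, from the unitarity of \<open>g\<close> and from its Frobenius
  image. Thus unitary matrices over the algebraically closed field have entries in the field with
  four elements.\<close>

lemma GU_bar_bar:
  assumes g: "g \<in> carrier GU"
  shows "bar (bar g) = (g :: 'a ^ 6 ^ 6)"
proof -
  have "bar (g ** transpose (bar g)) = mat 1" by (simp only: GU_inverse[OF g] bar_mat_1)
  then have right: "bar g ** transpose (bar (bar g)) = mat 1"
    by (simp only: bar_mult bar_transpose)
  have left: "transpose g ** bar g = mat 1" using g by (simp add: GU_iff)
  have "transpose g = transpose g ** (bar g ** transpose (bar (bar g)))"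
    by (simp only: right matrix_mul_rid)
  also have "\<dots> = transpose (bar (bar g))" by (simp only: matrix_mul_assoc left matrix_mul_lid)
  finally show ?thesis by (metis transpose_transpose)
qed

lemma GU_closed_inverse:
  assumes g: "g \<in> carrier GU"
  shows "transpose (bar g) \<in> carrier (GU :: ('a ^ 6 ^ 6) monoid)"
  using g matrix_left_right_inverse[of "transpose g" "bar g"]
  by (simp add: GU_iff bar_transpose GU_bar_bar[OF g])

lemma GU_isotropic:
  assumes g: "g \<in> carrier GU" and v: "v \<in> isotropic_vectors"
  shows "g *v v \<in> (isotropic_vectors :: ('a ^ 6) set)"
proof -
  have "frob (frob (g *v v)) = g *v v"
    using v by (simp add: frob_matrix GU_bar_bar[OF g] isotropic_vectors_def rational_iff)
  moreover have "g *v v \<noteq> 0"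
  proof
    assume "g *v v = 0"
    then have "transpose (bar g) *v (g *v v) = 0" by simp
    then have "v = 0" by (simp add: matrix_vector_mul_assoc GU_inverse[OF g])
    then show False using v by (simp add: isotropic_vectors_def)
  qed
  ultimately show ?thesis
    using v GU_herm[OF g] by (simp add: isotropic_vectors_def rational_iff)
qed

lemma GU_inj:
  assumes g: "g \<in> carrier GU"
  shows "inj ((*v) (g :: 'a ^ 6 ^ 6))"
proof (rule injI)
  fix x y assume "g *v x = g *v y"
  then have "transpose (bar g) *v (g *v x) = transpose (bar g) *v (g *v y)" by simp
  then show "x = y" by (simp add: matrix_vector_mul_assoc GU_inverse[OF g])
qed

lemma GU_generator:
  assumes g: "g \<in> carrier GU" and W: "W \<in> generators"
  shows "(*v) g ` W \<in> (generators :: ('a ^ 6) set set)"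
proof -
  have "vec.dim ((*v) g ` W) = vec.dim W"
    by (rule vec.dim_image_eq[OF matrix_vector_mul_linear_gen inj_on_subset[OF GU_inj[OF g]]]) simp
  then show ?thesis using W GU_herm[OF g] by (auto simp: generators_def subspace_image_matrix)
qed

section \<open>The generating permutations are collineations\<close>

text \<open>The common part of the arguments for unitary matrices and for the Frobenius map.\<close>

lemma collineation_of_vector_map:
  fixes T :: "'a ^ 6 \<Rightarrow> 'a ^ 6"
  assumes inj: "inj T" and span: "\<And>v. T ` vec.span {v} = vec.span {T v}"
    and iso: "T ` isotropic_vectors = isotropic_vectors" and gen: "image T ` generators = generators"
  shows "(\<lambda>p\<in>fermat_cubic_F4. T ` p) \<in> collineations"
proof -
  let ?X = "fermat_cubic_F4 :: ('a ^ 6) set set"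
  let ?\<sigma> = "\<lambda>p\<in>?X. T ` p"
  have X: "?X = (\<lambda>v. vec.span {v}) ` isotropic_vectors" using points_iff by blast
  have "image T ` ?X = (\<lambda>v. vec.span {T v}) ` isotropic_vectors"
    unfolding X image_image span ..
  also have "\<dots> = (\<lambda>v. vec.span {v}) ` T ` isotropic_vectors" by (simp only: image_image)
  finally have TX: "image T ` ?X = ?X" by (simp only: iso X)
  have "bij_betw ?\<sigma> ?X ?X"
    using TX inj_image_eq_iff[OF inj] by (auto simp: bij_betw_def inj_on_def)
  then have "?\<sigma> \<in> Bij ?X" by (simp add: Bij_def)
  moreover have "?\<sigma> ` points_in W = points_in (T ` W)" for W
  proof
    show "?\<sigma> ` points_in W \<subseteq> points_in (T ` W)"
    proof
      fix q assume "q \<in> ?\<sigma> ` points_in W"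
      then obtain p where p: "p \<in> ?X" "p \<subseteq> W" "q = T ` p" by (auto simp: points_in_def)
      have "T ` p \<in> ?X" using TX p(1) by blast
      then show "q \<in> points_in (T ` W)" using p by (auto simp: points_in_def)
    qed
    show "points_in (T ` W) \<subseteq> ?\<sigma> ` points_in W"
    proof
      fix q assume q: "q \<in> points_in (T ` W)"
      then have "q \<in> image T ` ?X" using TX by (simp add: points_in_def)
      then obtain p where p: "p \<in> ?X" "q = T ` p" by blast
      then have "p \<subseteq> W" using q inj_image_subset_iff[OF inj] by (auto simp: points_in_def)
      then show "q \<in> ?\<sigma> ` points_in W" using p by (auto simp: points_in_def intro!: image_eqI[of _ _ p])
    qed
  qed
  then have "image ?\<sigma> ` points_in ` generators = points_in ` image T ` generators"
    by (simp only: image_image)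
  ultimately show ?thesis using gen by (simp only: collineations_def mem_Collect_eq simp_thms)
qed

definition matrix_perm :: "'a ^ 6 ^ 6 \<Rightarrow> ('a ^ 6) set \<Rightarrow> ('a ^ 6) set"
  where "matrix_perm g = (\<lambda>p\<in>fermat_cubic_F4. (*v) g ` p)"

definition frob_perm :: "('a ^ 6) set \<Rightarrow> ('a ^ 6) set"
  where "frob_perm = (\<lambda>p\<in>fermat_cubic_F4. frob ` p)"

lemma matrix_span: "(*v) g ` vec.span {v} = vec.span {g *v v}" for g :: "'a ^ 6 ^ 6"
  by (simp add: vec.span_singleton image_image vector_scalar_commute)

lemma frob_span: "frob ` vec.span {v} = vec.span {frob v}" for v :: "'a ^ 6"
proof -
  have sq: "range (\<lambda>k::'a. k\<^sup>2) = UNIV" using sq_surj by (metis surjI)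
  have "frob ` vec.span {v} = (\<lambda>k. k *s frob v) ` range (\<lambda>k::'a. k\<^sup>2)"
    by (simp add: vec.span_singleton image_image frob_scale)
  also have "\<dots> = vec.span {frob v}" by (simp only: sq vec.span_singleton)
  finally show ?thesis .
qed

lemma matrix_perm_collineation:
  assumes g: "g \<in> carrier GU"
  shows "matrix_perm g \<in> collineations"
  unfolding matrix_perm_def
proof (rule collineation_of_vector_map[OF GU_inj[OF g] matrix_span])
  let ?h = "transpose (bar g)"
  have h: "?h \<in> carrier GU" by (rule GU_closed_inverse[OF g])
  have inv: "g *v (?h *v x) = x" for x
    by (simp only: matrix_vector_mul_assoc GU_inverse[OF g] matrix_vector_mul_lid)
  have "v \<in> (*v) g ` isotropic_vectors" if "v \<in> isotropic_vectors" for v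
    using inv[of v] GU_isotropic[OF h that] by (metis imageI)
  then show "(*v) g ` isotropic_vectors = isotropic_vectors" using GU_isotropic[OF g] by blast
  have "W \<in> image ((*v) g) ` generators" if "W \<in> generators" for W
  proof (rule image_eqI)
    show "W = (*v) g ` (*v) ?h ` W" by (simp only: image_image inv image_ident)
  qed (rule GU_generator[OF h that])
  then show "image ((*v) g) ` generators = generators" using GU_generator[OF g] by blast
qed

lemma subspace_frob_image:
  fixes W :: "('a ^ 6) set"
  assumes W: "vec.subspace W"
  shows "vec.subspace (frob ` W)"
  unfolding vec.subspace_def
proof (intro conjI ballI allI)
  show "0 \<in> frob ` W" using vec.subspace_0[OF W] by (metis frob_0 imageI)
  fix x assume "x \<in> frob ` W"
  then obtain a where a: "a \<in> W" "x = frob a" by blast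
  show "x + y \<in> frob ` W" if "y \<in> frob ` W" for y
    using that a vec.subspace_add[OF W] by (auto simp flip: frob_add)
  fix c :: 'a
  obtain d where "d\<^sup>2 = c" using sq_surj by blast
  then have "c *s x = frob (d *s a)" using a by (simp add: frob_scale)
  then show "c *s x \<in> frob ` W" using a vec.subspace_scale[OF W] by blast
qed

text \<open>The Frobenius map is only semilinear, but it still maps a spanning set to a spanning set.\<close>

lemma dim_frob_image_le: "vec.dim (frob ` U) \<le> vec.dim U" for U :: "('a ^ 6) set"
proof -
  obtain B where B: "B \<subseteq> U" "vec.independent B" "U \<subseteq> vec.span B" "card B = vec.dim U"
    by (rule vec.basis_exists)
  have fin: "finite B" using B(2) by (rule vec.finiteI_independent)
  have "frob ` U \<subseteq> vec.span (frob ` B)"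
  proof -
    have "vec.subspace {x. frob x \<in> vec.span (frob ` B)}"
      by (auto simp: vec.subspace_def frob_add frob_scale vec.span_zero vec.span_add vec.span_scale)
    then have "vec.span B \<subseteq> {x. frob x \<in> vec.span (frob ` B)}"
      by (intro vec.span_minimal) (auto intro: vec.span_base)
    then show ?thesis using B(3) by blast
  qed
  then have "vec.dim (frob ` U) \<le> card (frob ` B)" using fin by (intro vec.dim_le_card) auto
  also have "\<dots> \<le> vec.dim U" using card_image_le[OF fin] B(4) by metis
  finally show ?thesis .
qed

lemma frob_frob_generator:
  fixes W :: "('a ^ 6) set"
  assumes W: "W \<in> generators"
  shows "frob ` frob ` W = W"
proof
  show "frob ` frob ` W \<subseteq> W" using generator_stable[OF W] by blast
  have "W \<inter> rational_vectors \<subseteq> frob ` frob ` W"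
  proof
    fix x assume "x \<in> W \<inter> rational_vectors"
    then show "x \<in> frob ` frob ` W" by (metis IntE imageI rational_iff)
  qed
  then have "vec.span (W \<inter> rational_vectors) \<subseteq> frob ` frob ` W"
    using generatorD(1)[OF W] by (intro vec.span_minimal subspace_frob_image)
  then show "W \<subseteq> frob ` frob ` W" by (simp only: generator_rational[OF W])
qed

lemma frob_generator:
  fixes W :: "('a ^ 6) set"
  assumes W: "W \<in> generators"
  shows "frob ` W \<in> generators"
proof -
  have "vec.dim (frob ` W) = vec.dim W"
    using dim_frob_image_le[of W] dim_frob_image_le[of "frob ` W"] frob_frob_generator[OF W] by simp
  then show ?thesis using W subspace_frob_image by (auto simp: generators_def herm_frob)
qed

lemma frob_isotropic: "v \<in> isotropic_vectors \<Longrightarrow> frob v \<in> (isotropic_vectors :: ('a ^ 6) set)"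
  using frob_inj[of v 0] by (simp add: isotropic_vectors_def frob_rational herm_frob)

lemma frob_perm_collineation: "frob_perm \<in> collineations"
  unfolding frob_perm_def
proof (rule collineation_of_vector_map[OF _ frob_span])
  show "inj (frob :: 'a ^ 6 \<Rightarrow> 'a ^ 6)" by (simp add: inj_def frob_inj)
  have "v \<in> frob ` isotropic_vectors" if "v \<in> isotropic_vectors" for v :: "'a ^ 6"
    using frob_isotropic[OF that] isotropic_rational[OF that] by (metis imageI rational_iff)
  then show "frob ` isotropic_vectors = (isotropic_vectors :: ('a ^ 6) set)" using frob_isotropic by blast
  have "W \<in> image frob ` generators" if "W \<in> generators" for W :: "('a ^ 6) set"
    using frob_frob_generator[OF that] frob_generator[OF that] by (metis imageI)
  then show "image frob ` generators = (generators :: ('a ^ 6) set set)" using frob_generator by blast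
qed

lemma PGU_perm_coset:
  assumes "g \<in> carrier GU"
  shows "PGU_perm (scalars_F4 #>\<^bsub>GU\<^esub> g) = matrix_perm g"
proof -
  have "(\<Union>h\<in>scalars_F4 #>\<^bsub>GU\<^esub> g. (*v) h ` p) = (*v) g ` p"
    if p: "p \<in> fermat_cubic_F4" for p
  proof -
    have sub: "vec.subspace p" using p by (simp add: fermat_cubic_F4_def fermat_cubic_def proj_space_def)
    have coset: "scalars_F4 #>\<^bsub>GU\<^esub> g = {mat c ** g | c. c \<in> F4 \<and> c \<noteq> 0}"
      by (auto simp: r_coset_def scalars_F4_def GU_def)
    show ?thesis
    proof
      show "(\<Union>h\<in>scalars_F4 #>\<^bsub>GU\<^esub> g. (*v) h ` p) \<subseteq> (*v) g ` p"
      proof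
        fix x assume "x \<in> (\<Union>h\<in>scalars_F4 #>\<^bsub>GU\<^esub> g. (*v) h ` p)"
        then obtain c y where y: "y \<in> p" "x = (mat c ** g) *v y" by (auto simp: coset)
        then have "x = g *v (c *s y)"
          by (simp add: mat_mult_vec vector_scalar_commute flip: matrix_vector_mul_assoc)
        then show "x \<in> (*v) g ` p" using y(1) vec.subspace_scale[OF sub] by blast
      qed
      have "g \<in> scalars_F4 #>\<^bsub>GU\<^esub> g"
        unfolding coset using F4_1 by (auto intro!: exI[of _ 1])
      then show "(*v) g ` p \<subseteq> (\<Union>h\<in>scalars_F4 #>\<^bsub>GU\<^esub> g. (*v) h ` p)" by blast
    qed
  qed
  then show ?thesis unfolding PGU_perm_def matrix_perm_def by (intro restrict_ext)
qed

lemma PGU_perms: "PGU_perm ` carrier PGU = matrix_perm ` carrier GU"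
proof -
  have "carrier PGU = (\<lambda>g. scalars_F4 #>\<^bsub>GU\<^esub> g) ` carrier (GU :: ('a ^ 6 ^ 6) monoid)"
    by (auto simp: PGU_def FactGroup_def RCOSETS_def)
  then show ?thesis by (simp add: image_image PGU_perm_coset)
qed

text \<open>An automorphism permutes the two elements of the field other than 0 and 1.\<close>

lemma Gal_F4_cases:
  assumes \<tau>: "\<tau> \<in> Gal_F4"
  shows "(\<forall>a\<in>F4. \<tau> a = (a::'a)) \<or> (\<forall>a\<in>F4. \<tau> a = a\<^sup>2)"
proof -
  have inj: "inj_on \<tau> F4" and 01: "\<tau> 0 = 0" "\<tau> 1 = 1" and maps: "\<tau> omega \<in> F4"
    and mult: "\<And>a b. a \<in> F4 \<Longrightarrow> b \<in> F4 \<Longrightarrow> \<tau> (a * b) = \<tau> a * \<tau> b"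
    using \<tau> omega_F4 by (auto simp: Gal_F4_def bij_betw_def)
  have sq: "\<tau> (omega\<^sup>2) = (\<tau> omega)\<^sup>2" using mult[OF omega_F4 omega_F4] by (simp add: power2_eq_square)
  have "\<tau> omega \<noteq> 0" "\<tau> omega \<noteq> 1"
    using inj_onD[OF inj, of omega 0] inj_onD[OF inj, of omega 1] 01 omega_neq omega_F4 F4_0 F4_1
    by auto
  then consider "\<tau> omega = omega" | "\<tau> omega = omega\<^sup>2" using F4_cases[OF maps] by blast
  then show ?thesis
  proof cases
    case 1
    have "\<tau> a = a" if "a \<in> F4" for a using F4_cases[OF that] 1 sq 01 by auto
    then show ?thesis by blast
  next
    case 2
    have "\<tau> a = a\<^sup>2" if "a \<in> F4" for a using F4_cases[OF that] 2 sq 01 by auto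
    then show ?thesis by blast
  qed
qed

lemma span_rational_image:
  fixes T :: "'a ^ 6 \<Rightarrow> 'a ^ 6"
  assumes p: "p \<in> fermat_cubic_F4" and T: "\<And>v. T ` vec.span {v} = vec.span {T v}"
  shows "vec.span (T ` (p \<inter> rational_vectors)) = T ` p"
proof -
  obtain v where v: "v \<in> isotropic_vectors" "p = vec.span {v}" using p points_iff by blast
  have Tp: "T ` p = vec.span {T v}" using v T by simp
  show ?thesis
  proof
    show "vec.span (T ` (p \<inter> rational_vectors)) \<subseteq> T ` p"
      unfolding Tp by (rule vec.span_minimal) (use Tp in auto)
    show "T ` p \<subseteq> vec.span (T ` (p \<inter> rational_vectors))"
      unfolding Tp using v isotropic_rational by (intro vec.span_mono) (auto simp: vec.span_base)
  qed
qed

lemma Gal_perm_id: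
  assumes "\<forall>a\<in>F4. \<tau> a = (a::'a)"
  shows "Gal_perm \<tau> = (\<lambda>p\<in>fermat_cubic_F4. p)"
proof -
  have "(\<lambda>v. \<chi> i. \<tau> (v $ i)) ` (p \<inter> rational_vectors) = (\<lambda>v. v) ` (p \<inter> rational_vectors)" for p :: "('a ^ 6) set"
    by (rule image_cong[OF refl]) (use assms in \<open>auto simp: rational_vectors_def vec_eq_iff\<close>)
  then show ?thesis
    unfolding Gal_perm_def by (intro restrict_ext) (use span_rational_image[of _ "\<lambda>v. v"] in simp)
qed

lemma Gal_perm_frob:
  assumes "\<forall>a\<in>F4. \<tau> a = (a::'a)\<^sup>2"
  shows "Gal_perm \<tau> = frob_perm"
proof -
  have "(\<lambda>v. \<chi> i. \<tau> (v $ i)) ` (p \<inter> rational_vectors) = frob ` (p \<inter> rational_vectors)" for p :: "('a ^ 6) set"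
    by (rule image_cong[OF refl]) (use assms in \<open>auto simp: rational_vectors_def vec_eq_iff frob_def\<close>)
  then show ?thesis
    unfolding Gal_perm_def frob_perm_def
    by (intro restrict_ext) (simp add: span_rational_image[OF _ frob_span])
qed

lemma square_Gal_F4: "(\<lambda>a. a\<^sup>2) \<in> (Gal_F4 :: ('a \<Rightarrow> 'a) set)"
proof -
  have "(\<lambda>a. a\<^sup>2) ` F4 = (F4 :: 'a set)"
  proof
    show "F4 \<subseteq> (\<lambda>a::'a. a\<^sup>2) ` F4"
    proof
      fix a :: 'a assume "a \<in> F4"
      then show "a \<in> (\<lambda>a. a\<^sup>2) ` F4" by (intro image_eqI[of _ _ "a\<^sup>2"]) (simp_all add: F4_pow4 F4_power)
    qed
  qed (auto intro: F4_power)
  then show ?thesis by (auto simp: Gal_F4_def bij_betw_def inj_on_def sq_inj sq_add power_mult_distrib)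
qed

lemma PGammaU_carrier: "carrier (PGammaU :: (('a ^ 6) set \<Rightarrow> _) monoid) =
    generate (BijGroup fermat_cubic_F4) (PGU_perm ` carrier PGU \<union> Gal_perm ` Gal_F4)"
  by (simp add: PGammaU_def)

lemma PGammaU_subset: "carrier (PGammaU :: (('a ^ 6) set \<Rightarrow> _) monoid) \<subseteq> collineations"
proof -
  have "Gal_perm \<tau> \<in> collineations" if \<tau>: "\<tau> \<in> Gal_F4" for \<tau> :: "'a \<Rightarrow> 'a"
    using Gal_F4_cases[OF \<tau>]
  proof
    assume "\<forall>a\<in>F4. \<tau> a = a"
    then have "Gal_perm \<tau> = \<one>\<^bsub>BijGroup fermat_cubic_F4\<^esub>" by (simp add: Gal_perm_id BijGroup_def)
    then show ?thesis using subgroup.one_closed[OF subgroup_collineations] by metis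
  next
    assume "\<forall>a\<in>F4. \<tau> a = a\<^sup>2"
    then show ?thesis by (simp add: Gal_perm_frob frob_perm_collineation)
  qed
  then have "PGU_perm ` carrier PGU \<union> Gal_perm ` Gal_F4 \<subseteq> (collineations :: (('a ^ 6) set \<Rightarrow> _) set)"
    using matrix_perm_collineation PGU_perms by auto
  then show ?thesis unfolding PGammaU_carrier
    by (rule group.generate_subgroup_incl[OF group_BijGroup _ subgroup_collineations])
qed

lemma subgroup_PGammaU:
  "subgroup (carrier (PGammaU :: (('a ^ 6) set \<Rightarrow> _) monoid)) (BijGroup fermat_cubic_F4)"
proof -
  have "PGU_perm ` carrier PGU \<union> Gal_perm ` Gal_F4 \<subseteq> carrier (PGammaU :: (('a ^ 6) set \<Rightarrow> _) monoid)"
    unfolding PGammaU_carrier by (auto intro: generate.incl)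
  also have "\<dots> \<subseteq> carrier (BijGroup fermat_cubic_F4)"
    using PGammaU_subset subgroup.subset[OF subgroup_collineations] by (rule subset_trans)
  finally show ?thesis
    unfolding PGammaU_carrier by (rule group.generate_is_subgroup[OF group_BijGroup])
qed

lemma matrix_perm_PGammaU: "g \<in> carrier GU \<Longrightarrow> matrix_perm g \<in> carrier PGammaU"
  and frob_perm_PGammaU: "frob_perm \<in> carrier PGammaU"
proof -
  assume "g \<in> carrier GU"
  then have "matrix_perm g \<in> PGU_perm ` carrier PGU" using PGU_perms by blast
  then show "matrix_perm g \<in> carrier PGammaU" unfolding PGammaU_carrier by (auto intro: generate.incl)
next
  have "frob_perm \<in> Gal_perm ` Gal_F4" using square_Gal_F4 Gal_perm_frob by (metis imageI)
  then show "frob_perm \<in> carrier PGammaU" unfolding PGammaU_carrier by (auto intro: generate.incl)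
qed

end

section \<open>Rigidity of the hyperbolic frame\<close>

text \<open>The Hermitian form in the coordinates of a hyperbolic frame. Indices are residues modulo 6, so that
  \<open>i\<close> and \<open>i + 3\<close> are the two members of a hyperbolic pair.\<close>

definition hyp :: "'a::field ^ 6 \<Rightarrow> 'a ^ 6 \<Rightarrow> 'a"
  where "hyp x y = (\<Sum>j\<in>UNIV. x $ j * (y $ (j + 3))\<^sup>2)"

definition hyp_isotropic :: "('a::field ^ 6) set"
  where "hyp_isotropic = {c \<in> rational_vectors. c \<noteq> 0 \<and> hyp c c = 0}"

abbreviation E :: "6 \<Rightarrow> 'a::field ^ 6"
  where "E i \<equiv> axis i 1"

lemma all_6: "(\<forall>i. P i) \<longleftrightarrow> P 0 \<and> P 1 \<and> P 2 \<and> P 3 \<and> P 4 \<and> P (5 :: 6)"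
  using UNIV_6 by (metis UNIV_I insert_iff singletonD)

lemma opp_opp [simp]: "i + 6 = (i :: 6)"
proof -
  have "(6 :: 6) = 0" by simp
  then show ?thesis by (simp only: add_0_right)
qed

lemma numerals_mod_6 [simp]: "(6 :: 6) = 0" "(7 :: 6) = 1" "(8 :: 6) = 2"
  by simp_all

lemma opp_opp' [simp]: "i + 3 + 3 = (i :: 6)"
  by simp

lemma opp_neq [simp]: "i + 3 \<noteq> (i :: 6)" "i \<noteq> i + (3 :: 6)"
  by simp_all

lemma opp_swap: "i = j + 3 \<longleftrightarrow> j = i + (3 :: 6)"
  by auto

lemma hyp_E [simp]: "hyp (E i) y = (y $ (i + 3))\<^sup>2"
proof -
  have "hyp (E i) y = (\<Sum>j\<in>{i}. (E i) $ j * (y $ (j + 3))\<^sup>2)"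
    unfolding hyp_def by (rule sum.mono_neutral_right) (auto simp: axis_def)
  then show ?thesis by (simp add: axis_def)
qed

lemma hyp_add [simp]: "hyp (x + y) z = hyp x z + hyp y z"
  by (simp add: hyp_def algebra_simps sum.distrib)

lemma hyp_scale [simp]: "hyp (c *s x) z = c * hyp x z"
  by (simp add: hyp_def algebra_simps sum_distrib_left)

lemma E_nth [simp]: "E i $ j = (if j = i then 1 else 0)"
  by (simp add: axis_def)

context char2_closed
begin

lemma E_rational: "E i \<in> (rational_vectors :: ('a ^ 6) set)"
  by (simp add: rational_vectors_def F4_0 F4_1)

lemma hyp_isotropic_nth: "c \<in> hyp_isotropic \<Longrightarrow> c $ i \<in> (F4 :: 'a set)"
  by (simp add: hyp_isotropic_def rational_vectors_def)

lemma two_term_isotropic: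
  assumes "i \<noteq> j" "j \<noteq> i + 3" "t \<in> F4"
  shows "E i + t *s E j \<in> (hyp_isotropic :: ('a ^ 6) set)"
proof -
  have "(E i + t *s E j) $ i = (1 :: 'a)" using assms by simp
  then have "E i + t *s E j \<noteq> (0 :: 'a ^ 6)" by force
  then show ?thesis using assms opp_swap[of i j]
    by (auto simp: hyp_isotropic_def rational_add rational_scale E_rational)
qed

text \<open>Only the pair \<open>i\<close>, \<open>i + 3\<close> contributes to \<open>hyp d d\<close>, which is therefore \<open>x * y * (x + y)\<close> for the two
  entries \<open>x\<close> and \<open>y\<close>.\<close>

lemma opposite_pair_ratio:
  fixes d :: "'a ^ 6"
  assumes "d \<in> hyp_isotropic" "\<And>k. k \<noteq> i \<Longrightarrow> k \<noteq> i + 3 \<Longrightarrow> d $ k = 0 \<or> d $ (k + 3) = 0"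
    and "d $ i \<noteq> 0" "d $ (i + 3) \<noteq> 0"
  shows "d $ i = d $ (i + 3)"
proof -
  have "hyp d d = (\<Sum>k\<in>{i, i + 3}. d $ k * (d $ (k + 3))\<^sup>2)"
    unfolding hyp_def by (rule sum.mono_neutral_right) (use assms(2) in auto)
  also have "\<dots> = d $ i * d $ (i + 3) * (d $ i + d $ (i + 3))"
    by (simp add: algebra_simps power2_eq_square)
  finally show ?thesis using assms by (simp add: hyp_isotropic_def add_eq_0)
qed

text \<open>
  The set \<open>Fix\<close> stands for the frame coordinates of the points fixed by a collineation. In the first
  hypothesis, \<open>d\<close> stands for the image of \<open>c\<close>: it has the same perpendicularities to the fixed vectors, and
  \<open>c\<close> is fixed if its image is proportional to it.
\<close>

context
  fixes Fix :: "('a ^ 6) set"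
  assumes determined: "\<And>c. c \<in> hyp_isotropic \<Longrightarrow> \<exists>d\<in>hyp_isotropic.
      (\<forall>a\<in>Fix. hyp a c = 0 \<longleftrightarrow> hyp a d = 0) \<and> (\<forall>k. d = k *s c \<longrightarrow> c \<in> Fix)"
    and basis: "\<And>i. E i \<in> Fix"
begin

text \<open>Perpendicularity to the basis vectors tells which entries vanish, so candidates for the image of \<open>c\<close>
  have the same support as \<open>c\<close>.\<close>

lemma fixed_if_determined:
  assumes c: "c \<in> hyp_isotropic"
    and proportional: "\<And>d. d \<in> hyp_isotropic \<Longrightarrow> (\<And>i. d $ i = 0 \<longleftrightarrow> c $ i = 0) \<Longrightarrow>
      (\<And>a. a \<in> Fix \<Longrightarrow> hyp a d = 0 \<longleftrightarrow> hyp a c = 0) \<Longrightarrow> \<exists>k. d = k *s c"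
  shows "c \<in> Fix"
proof -
  obtain d where d: "d \<in> hyp_isotropic" "\<And>a. a \<in> Fix \<Longrightarrow> hyp a c = 0 \<longleftrightarrow> hyp a d = 0"
    "\<And>k. d = k *s c \<Longrightarrow> c \<in> Fix"
    using determined[OF c] by blast
  have "d $ i = 0 \<longleftrightarrow> c $ i = 0" for i
    using d(2)[OF basis[of "i + 3"]] by simp
  then show ?thesis using proportional[OF d(1)] d by blast
qed

text \<open>All points other than the two basis points on the isotropic line that joins them are fixed.\<close>

definition linked :: "6 \<Rightarrow> 6 \<Rightarrow> bool"
  where "linked i j \<longleftrightarrow> i \<noteq> j \<and> j \<noteq> i + 3 \<and> (\<forall>t\<in>F4. t \<noteq> 0 \<longrightarrow> E i + t *s E j \<in> Fix)"

text \<open>Exactly one fixed point of the line through the basis points \<open>i\<close> and \<open>j\<close> is perpendicular to \<open>c\<close>, and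
  this point determines the ratio of the entries of \<open>c\<close> at \<open>i + 3\<close> and \<open>j + 3\<close>.\<close>

lemma linked_ratio:
  assumes L: "linked i j" and c: "c \<in> hyp_isotropic"
    and test: "\<And>a. a \<in> Fix \<Longrightarrow> hyp a d = 0 \<longleftrightarrow> hyp a c = 0"
    and nz: "c $ (i + 3) \<noteq> 0" "c $ (j + 3) \<noteq> 0"
  shows "d $ (i + 3) * c $ (j + 3) = c $ (i + 3) * d $ (j + 3)"
proof -
  define t where "t = (c $ (i + 3) / c $ (j + 3))\<^sup>2"
  have "t \<in> F4" "t \<noteq> 0" using nz hyp_isotropic_nth[OF c] by (simp_all add: t_def F4_power F4_divide)
  then have "E i + t *s E j \<in> Fix" using L by (simp add: linked_def)
  moreover have "hyp (E i + t *s E j) c = 0"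
    using nz by (simp add: t_def power_divide add_self)
  ultimately have "(d $ (i + 3))\<^sup>2 + t * (d $ (j + 3))\<^sup>2 = 0" using test by fastforce
  then have "(d $ (i + 3))\<^sup>2 = (c $ (i + 3) / c $ (j + 3) * d $ (j + 3))\<^sup>2"
    by (simp add: add_eq_0 t_def power_mult_distrib power_divide)
  then have "d $ (i + 3) = c $ (i + 3) / c $ (j + 3) * d $ (j + 3)" by (simp only: sq_inj)
  then show ?thesis using nz by simp
qed

lemma two_term_fixed:
  assumes ij: "i \<noteq> j" "j \<noteq> i + 3" and t: "t \<in> F4" "t \<noteq> 0"
    and ratio: "\<And>d. d \<in> hyp_isotropic \<Longrightarrow> (\<And>k. d $ k = 0 \<longleftrightarrow> k \<noteq> i \<and> k \<noteq> j) \<Longrightarrow>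
      (\<And>a. a \<in> Fix \<Longrightarrow> hyp a d = 0 \<longleftrightarrow> hyp a (E i + t *s E j) = 0) \<Longrightarrow> d $ j = t * d $ i"
  shows "E i + t *s E j \<in> Fix"
proof (rule fixed_if_determined[OF two_term_isotropic[OF ij t(1)]])
  fix d :: "'a ^ 6"
  assume d: "d \<in> hyp_isotropic" and supp: "\<And>k. d $ k = 0 \<longleftrightarrow> (E i + t *s E j) $ k = 0"
    and test: "\<And>a. a \<in> Fix \<Longrightarrow> hyp a d = 0 \<longleftrightarrow> hyp a (E i + t *s E j) = 0"
  have supp': "d $ k = 0 \<longleftrightarrow> k \<noteq> i \<and> k \<noteq> j" for k
    unfolding supp using ij t by auto
  have "d $ j = t * d $ i" by (rule ratio[OF d supp' test])
  then have "d = d $ i *s (E i + t *s E j)" using ij supp' by (auto simp: vec_eq_iff)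
  then show "\<exists>k. d = k *s (E i + t *s E j)" ..
qed

lemma linked_opposite:
  assumes L: "linked i j"
  shows "linked (i + 3) (j + 3)" "linked (j + 3) (i + 3)"
proof -
  have ij: "i \<noteq> j" "j \<noteq> i + 3" "i \<noteq> j + 3" using L opp_swap by (auto simp: linked_def)
  have "E (i + 3) + t *s E (j + 3) \<in> Fix" if t: "t \<in> F4" "t \<noteq> 0" for t
  proof (rule two_term_fixed[OF _ _ t])
    fix d :: "'a ^ 6"
    assume test: "\<And>a. a \<in> Fix \<Longrightarrow> hyp a d = 0 \<longleftrightarrow> hyp a (E (i + 3) + t *s E (j + 3)) = 0"
    have "E (i + 3) + t *s E (j + 3) \<in> hyp_isotropic"
      using ij t by (intro two_term_isotropic) auto
    from linked_ratio[OF L this test] show "d $ (j + 3) = t * d $ (i + 3)" using ij t by (simp add: mult.commute)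
  qed (use ij in auto)
  then show "linked (i + 3) (j + 3)" using ij by (auto simp: linked_def)
  have "E (j + 3) + t *s E (i + 3) \<in> Fix" if t: "t \<in> F4" "t \<noteq> 0" for t
  proof (rule two_term_fixed[OF _ _ t])
    fix d :: "'a ^ 6"
    assume test: "\<And>a. a \<in> Fix \<Longrightarrow> hyp a d = 0 \<longleftrightarrow> hyp a (E (j + 3) + t *s E (i + 3)) = 0"
    have "E (j + 3) + t *s E (i + 3) \<in> hyp_isotropic"
      using ij t by (intro two_term_isotropic) auto
    from linked_ratio[OF L this test] show "d $ (i + 3) = t * d $ (j + 3)" using ij t by (simp add: mult.commute)
  qed (use ij in auto)
  then show "linked (j + 3) (i + 3)" using ij by (auto simp: linked_def)
qed

lemma linked_sym: "linked i j \<Longrightarrow> linked j i"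
  using linked_opposite(2)[OF linked_opposite(1), of i j] by simp

text \<open>Isotropic vectors with support \<open>i\<close>, \<open>j\<close>, \<open>j + 3\<close> are fixed: one ratio is known from \<open>linked_opposite\<close>
  and the other from isotropy. They determine the ratios for two entries at \<open>i + 3\<close> and \<open>j\<close>.\<close>

lemma linked_mixed:
  assumes L: "linked i j"
  shows "linked (i + 3) j"
proof -
  have ij: "i \<noteq> j" "j \<noteq> i + 3" "i \<noteq> j + 3" using L opp_swap by (auto simp: linked_def)
  note L' = linked_opposite(1)[OF L]
  have three: "E (j + 3) + b *s E i + E j \<in> Fix" if b: "b \<in> F4" "b \<noteq> 0" for b
  proof (rule fixed_if_determined)
    let ?q = "E (j + 3) + b *s E i + E j"
    have "?q $ j = 1" using ij by simp
    then have "?q \<noteq> 0" by force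
    then show q: "?q \<in> hyp_isotropic"
      using ij b by (simp add: hyp_isotropic_def rational_add rational_scale E_rational add_self)
    fix d :: "'a ^ 6"
    assume d: "d \<in> hyp_isotropic" and supp: "\<And>k. d $ k = 0 \<longleftrightarrow> ?q $ k = 0"
      and test: "\<And>a. a \<in> Fix \<Longrightarrow> hyp a d = 0 \<longleftrightarrow> hyp a ?q = 0"
    have supp': "d $ k = 0 \<longleftrightarrow> k \<noteq> i \<and> k \<noteq> j \<and> k \<noteq> j + 3" for k
      unfolding supp using ij b by auto
    have "d $ i = b * d $ j" using linked_ratio[OF L' q test] ij b by simp
    moreover have "d $ j = d $ (j + 3)"
      by (rule opposite_pair_ratio[OF d]) (use ij supp' in auto)
    ultimately have "d = d $ j *s ?q" using ij supp' by (auto simp: vec_eq_iff)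
    then show "\<exists>k. d = k *s ?q" ..
  qed
  have "E (i + 3) + t *s E j \<in> Fix" if t: "t \<in> F4" "t \<noteq> 0" for t
  proof (rule two_term_fixed[OF _ _ t])
    fix d :: "'a ^ 6"
    assume supp: "\<And>k. d $ k = 0 \<longleftrightarrow> k \<noteq> i + 3 \<and> k \<noteq> j"
      and test: "\<And>a. a \<in> Fix \<Longrightarrow> hyp a d = 0 \<longleftrightarrow> hyp a (E (i + 3) + t *s E j) = 0"
    \<comment> \<open>The middle coefficient makes this vector perpendicular to the given one.\<close>
    have "E (j + 3) + t\<^sup>2 *s E i + E j \<in> Fix" using t by (intro three) (auto simp: F4_power)
    moreover have "d $ (j + 3) = 0" using ij by (simp add: supp)
    ultimately have "(d $ j)\<^sup>2 = (t * d $ (i + 3))\<^sup>2"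
      using ij test[of "E (j + 3) + t\<^sup>2 *s E i + E j"] by (simp add: add_self add_eq_0 power_mult_distrib)
    then show "d $ j = t * d $ (i + 3)" by (simp only: sq_inj)
  qed (use ij in auto)
  then show ?thesis using ij by (auto simp: linked_def)
qed

context
  assumes ones: "E 0 + E 1 + E 2 \<in> Fix"
begin

lemma ones_ratio:
  assumes "\<And>a. a \<in> Fix \<Longrightarrow> hyp a d = 0 \<longleftrightarrow> hyp a c = 0"
  shows "(d $ 3)\<^sup>2 + (d $ 4)\<^sup>2 + (d $ 5)\<^sup>2 = 0 \<longleftrightarrow> (c $ 3)\<^sup>2 + (c $ 4)\<^sup>2 + (c $ 5)\<^sup>2 = 0"
  using assms[OF ones] by simp

lemma equal_entries_fixed: "E 3 + E 4 \<in> Fix" "E 3 + E 5 \<in> Fix" "E 4 + E 5 \<in> Fix"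
proof -
  have "E i + E j \<in> Fix" if ijk: "(i, j, k) \<in> {(3, 4, 5), (3, 5, 4), (4, 5, 3)}" for i j k :: 6
  proof -
    have "E i + 1 *s E j \<in> Fix"
    proof (rule two_term_fixed[OF _ _ F4_1])
      fix d :: "'a ^ 6"
      assume supp: "\<And>k. d $ k = 0 \<longleftrightarrow> k \<noteq> i \<and> k \<noteq> j"
        and test: "\<And>a. a \<in> Fix \<Longrightarrow> hyp a d = 0 \<longleftrightarrow> hyp a (E i + 1 *s E j) = 0"
      have "d $ k = 0" unfolding supp using ijk by auto
      moreover have "(d $ 3)\<^sup>2 + (d $ 4)\<^sup>2 + (d $ 5)\<^sup>2 = 0"
        using ones_ratio[OF test] ijk by (auto simp: add_self)
      ultimately show "d $ j = 1 * d $ i" using ijk by (auto simp: add_eq_0 sq_inj)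
    qed (use ijk in auto)
    then show ?thesis by simp
  qed
  then show "E 3 + E 4 \<in> Fix" "E 3 + E 5 \<in> Fix" "E 4 + E 5 \<in> Fix" by blast+
qed

text \<open>The remaining candidates for the image are the points of \<open>E 0 + s *s E 1\<close> with \<open>s \<noteq> 0\<close>, and the fixed
  point \<open>E 3 + E 4\<close> excludes \<open>s = 1\<close>.\<close>

lemma omega_point_image:
  assumes d: "d \<in> hyp_isotropic"
    and test: "\<And>a. a \<in> Fix \<Longrightarrow> hyp a d = 0 \<longleftrightarrow> hyp a (E 0 + omega *s E 1) = 0"
  shows "\<exists>k. d = k *s (E 0 + omega *s E 1) \<or> d = k *s (E 0 + omega\<^sup>2 *s E 1)"
proof -
  have supp: "d $ i = 0 \<longleftrightarrow> i \<noteq> 0 \<and> i \<noteq> 1" for i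
    using test[OF basis[of "i + 3"]] omega_neq by simp
  have "(d $ 0)\<^sup>2 + (d $ 1)\<^sup>2 \<noteq> 0"
    using test[OF equal_entries_fixed(1)] omega_neq by (simp add: add_eq_0 sq_inj[of 1, simplified])
  then have neq: "d $ 0 \<noteq> d $ 1" by (auto simp: add_self)
  define s where "s = d $ 1 / d $ 0"
  have d0: "d $ 0 \<noteq> 0" and d1: "d $ 1 \<noteq> 0" using supp by simp_all
  have "s \<in> F4" by (simp add: s_def F4_divide hyp_isotropic_nth[OF d])
  moreover have "s \<noteq> 0" "s \<noteq> 1" using d0 d1 neq by (auto simp: s_def)
  ultimately have "s = omega \<or> s = omega\<^sup>2" using F4_cases by blast
  moreover have "d = d $ 0 *s (E 0 + s *s E 1)"
    using supp d0 by (auto simp: vec_eq_iff s_def)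
  ultimately show ?thesis by metis
qed

context
  assumes omega_fixed: "E 0 + omega *s E 1 \<in> Fix"
begin

text \<open>Three points have to be told apart. The fixed points \<open>E 0 + E 1 + E 2\<close> and \<open>E 0 + \<omega> E 1\<close> recognise
  two of them.\<close>

lemma linked_34: "linked 3 4"
proof -
  have "E 3 + t *s E 4 \<in> Fix" if t: "t \<in> F4" "t \<noteq> 0" for t
  proof (rule two_term_fixed[OF _ _ t])
    fix d :: "'a ^ 6"
    assume d: "d \<in> hyp_isotropic" and supp: "\<And>k. d $ k = 0 \<longleftrightarrow> k \<noteq> 3 \<and> k \<noteq> 4"
      and test: "\<And>a. a \<in> Fix \<Longrightarrow> hyp a d = 0 \<longleftrightarrow> hyp a (E 3 + t *s E 4) = 0"
    have d3: "d $ 3 \<noteq> 0" and d4: "d $ 4 \<noteq> 0" and d5: "d $ 5 = 0" using supp by simp_all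
    define s where "s = d $ 4 / d $ 3"
    have s4: "d $ 4 = s * d $ 3" using d3 by (simp add: s_def)
    have s: "s \<in> F4" "s \<noteq> 0"
      using d3 d4 by (simp_all add: s_def F4_divide hyp_isotropic_nth[OF d])
    have one: "s = 1 \<longleftrightarrow> t = 1"
    proof -
      have "(d $ 3)\<^sup>2 * (1 + s\<^sup>2) = 0 \<longleftrightarrow> 1 + t\<^sup>2 = 0"
        using ones_ratio[OF test] by (simp add: d5 s4 power_mult_distrib algebra_simps)
      then show ?thesis using d3 sq_inj[of 1 s] sq_inj[of 1 t] by (auto simp: add_eq_0)
    qed
    have om: "s = omega \<longleftrightarrow> t = omega"
    proof -
      have inv: "1 + omega * x\<^sup>2 = 0 \<longleftrightarrow> x = omega" for x
      proof -
        have "1 + omega * x\<^sup>2 = omega * (omega\<^sup>2 + x\<^sup>2)"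
          using F4_mult_sq[OF omega_F4 omega_neq(1)] by (simp add: distrib_left)
        then show ?thesis using omega_neq sq_inj[of x omega] by (auto simp: add_eq_0)
      qed
      have "(d $ 3)\<^sup>2 * (1 + omega * s\<^sup>2) = 0 \<longleftrightarrow> 1 + omega * t\<^sup>2 = 0"
        using test[OF omega_fixed] by (simp add: s4 power_mult_distrib algebra_simps)
      then show ?thesis using d3 inv by simp
    qed
    have "s = t" using one om F4_cases[OF s(1)] F4_cases[OF t(1)] s(2) t(2) by metis
    then show "d $ 4 = t * d $ 3" using s4 by simp
  qed simp_all
  then show ?thesis by (simp add: linked_def)
qed

text \<open>These vectors transport the ratios from the first pair of basis points to the third basis point.\<close>

lemma linked_via_three_terms:
  assumes "{i, j} = {0, 1 :: 6}" and x: "t \<in> F4" "t \<noteq> 0"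
  shows "t *s E i + E j + E 2 \<in> Fix"
proof (rule fixed_if_determined)
  let ?c = "t *s E i + E j + E 2 :: 'a ^ 6"
  have ij: "i = 0 \<and> j = 1 \<or> i = 1 \<and> j = 0" using assms(1) by (auto simp: doubleton_eq_iff)
  have "?c $ 2 = 1" using ij by auto
  then have "?c \<noteq> 0" by force
  then show c: "?c \<in> hyp_isotropic"
    using ij x by (auto simp: hyp_isotropic_def rational_add rational_scale E_rational)
  fix d :: "'a ^ 6"
  assume d: "d \<in> hyp_isotropic" and supp: "\<And>k. d $ k = 0 \<longleftrightarrow> ?c $ k = 0"
    and test: "\<And>a. a \<in> Fix \<Longrightarrow> hyp a d = 0 \<longleftrightarrow> hyp a ?c = 0"
  have "d $ i = t * d $ j"
    using linked_ratio[OF linked_34 c test] ij x by (auto simp: mult.commute)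
  moreover have "d $ j = d $ 2"
    using test[OF equal_entries_fixed(2)] test[OF equal_entries_fixed(3)] ij x
    by (auto simp: add_eq_0 sq_inj add_self)
  moreover have "d $ k = 0" if "k \<noteq> i" "k \<noteq> j" "k \<noteq> 2" for k unfolding supp using that by simp
  moreover have "i \<noteq> j" "i \<noteq> 2" "j \<noteq> 2" using ij by auto
  ultimately have "d $ k = (d $ 2 *s ?c) $ k" for k
    by (cases "k = i"; cases "k = j"; cases "k = 2") (simp_all add: mult.commute)
  then have "d = d $ 2 *s ?c" unfolding vec_eq_iff by (rule allI)
  then show "\<exists>k. d = k *s ?c" ..
qed

lemma linked_35_45: "linked 3 5" "linked 4 5"
proof -
  have "E 3 + t *s E 5 \<in> Fix" if t: "t \<in> F4" "t \<noteq> 0" for t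
  proof (rule two_term_fixed[OF _ _ t])
    fix d :: "'a ^ 6"
    assume supp: "\<And>k. d $ k = 0 \<longleftrightarrow> k \<noteq> 3 \<and> k \<noteq> 5"
      and test: "\<And>a. a \<in> Fix \<Longrightarrow> hyp a d = 0 \<longleftrightarrow> hyp a (E 3 + t *s E 5) = 0"
    have "t\<^sup>2 *s E 0 + E 1 + E 2 \<in> Fix" using t by (intro linked_via_three_terms) (auto simp: F4_power)
    moreover have "d $ 4 = 0" by (simp add: supp)
    ultimately have "(t * d $ 3)\<^sup>2 = (d $ 5)\<^sup>2"
      using test[of "t\<^sup>2 *s E 0 + E 1 + E 2"] by (simp add: add_self add_eq_0 power_mult_distrib)
    then show "d $ 5 = t * d $ 3" by (simp only: sq_inj)
  qed simp_all
  then show "linked 3 5" by (simp add: linked_def)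
  have "E 4 + t *s E 5 \<in> Fix" if t: "t \<in> F4" "t \<noteq> 0" for t
  proof (rule two_term_fixed[OF _ _ t])
    fix d :: "'a ^ 6"
    assume supp: "\<And>k. d $ k = 0 \<longleftrightarrow> k \<noteq> 4 \<and> k \<noteq> 5"
      and test: "\<And>a. a \<in> Fix \<Longrightarrow> hyp a d = 0 \<longleftrightarrow> hyp a (E 4 + t *s E 5) = 0"
    have "t\<^sup>2 *s E 1 + E 0 + E 2 \<in> Fix" using t by (intro linked_via_three_terms) (auto simp: F4_power)
    moreover have "d $ 3 = 0" by (simp add: supp)
    ultimately have "(t * d $ 4)\<^sup>2 = (d $ 5)\<^sup>2"
      using test[of "t\<^sup>2 *s E 1 + E 0 + E 2"] by (simp add: add_self add_eq_0 power_mult_distrib)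
    then show "d $ 5 = t * d $ 4" by (simp only: sq_inj)
  qed simp_all
  then show "linked 4 5" by (simp add: linked_def)
qed

lemma linked_all:
  assumes "i \<noteq> j" "j \<noteq> i + 3"
  shows "linked i j"
proof -
  have spread: "linked (i + 3) (j + 3) \<and> linked (i + 3) j \<and> linked i (j + 3) \<and>
      linked j i \<and> linked (j + 3) (i + 3) \<and> linked j (i + 3) \<and> linked (j + 3) i" if "linked i j" for i j
  proof -
    have 1: "linked (i + 3) (j + 3)" "linked (j + 3) (i + 3)" using linked_opposite[OF that] by auto
    have 2: "linked (i + 3) j" by (rule linked_mixed[OF that])
    have 3: "linked i (j + 3)" using linked_opposite(1)[OF 2] by simp
    show ?thesis using 1 2 3 linked_sym[OF that] linked_sym[OF 2] linked_sym[OF 3] by blast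
  qed
  have "\<forall>i j. i \<noteq> j \<longrightarrow> j \<noteq> i + 3 \<longrightarrow> linked i j"
    using linked_34 linked_35_45 spread[OF linked_34] spread[OF linked_35_45(1)] spread[OF linked_35_45(2)]
    by (simp add: all_6)
  then show ?thesis using assms by blast
qed

text \<open>Ratios of entries at \<open>i\<close> and \<open>j\<close> with \<open>j \<noteq> i + 3\<close> are determined by \<open>linked_ratio\<close>. For opposite
  entries one passes through a third nonzero entry, and if there is none, isotropy makes the two
  entries equal.\<close>

theorem all_isotropic_fixed:
  assumes c: "c \<in> hyp_isotropic"
  shows "c \<in> Fix"
proof (rule fixed_if_determined[OF c])
  fix d :: "'a ^ 6"
  assume d: "d \<in> hyp_isotropic" and supp: "\<And>i. d $ i = 0 \<longleftrightarrow> c $ i = 0"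
    and test: "\<And>a. a \<in> Fix \<Longrightarrow> hyp a d = 0 \<longleftrightarrow> hyp a c = 0"
  have ratio: "d $ i * c $ j = c $ i * d $ j" if "c $ i \<noteq> 0" "c $ j \<noteq> 0" "j \<noteq> i + 3" for i j
  proof (cases "i = j")
    case False
    then have "linked (i + 3) (j + 3)" using that by (intro linked_all) auto
    from linked_ratio[OF this c test] show ?thesis using that by simp
  qed simp
  have ratio_opp: "d $ i * c $ (i + 3) = c $ i * d $ (i + 3)"
    if nz: "c $ i \<noteq> 0" "c $ (i + 3) \<noteq> 0" for i
  proof (cases "\<exists>k. k \<noteq> i \<and> k \<noteq> i + 3 \<and> c $ k \<noteq> 0")
    case True
    then obtain k where k: "k \<noteq> i" "k \<noteq> i + 3" "c $ k \<noteq> 0" by blast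
    have "d $ i * c $ k = c $ i * d $ k" "d $ k * c $ (i + 3) = c $ k * d $ (i + 3)"
      using k nz ratio by auto
    then have "c $ k * (d $ i * c $ (i + 3)) = c $ k * (c $ i * d $ (i + 3))"
      by algebra
    then show ?thesis using k by simp
  next
    case False
    have "c $ i = c $ (i + 3)" by (rule opposite_pair_ratio[OF c]) (use False nz in auto)
    moreover have "d $ i = d $ (i + 3)" by (rule opposite_pair_ratio[OF d]) (use False nz supp in auto)
    ultimately show ?thesis by (simp add: mult.commute)
  qed
  obtain i where i: "c $ i \<noteq> 0" using c by (auto simp: hyp_isotropic_def vec_eq_iff)
  have "d $ i * c $ j = c $ i * d $ j" for j
    using ratio[OF i, of j] ratio_opp[OF i] supp by (cases "c $ j = 0"; cases "j = i + 3") auto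
  then have "d = (d $ i / c $ i) *s c" using i by (simp add: vec_eq_iff field_simps)
  then show "\<exists>k. d = k *s c" ..
qed

end
end
end
end

section \<open>Hyperbolic frames\<close>

definition hyp_gram :: "'a::field ^ 6 ^ 6"
  where "hyp_gram = (\<chi> i j. if j = i + 3 then 1 else 0)"

definition frames :: "('a::field ^ 6 ^ 6) set"
  where "frames = {M. transpose M ** bar M = hyp_gram \<and> bar (bar M) = M}"

lemma hyp_gram_nth [simp]: "hyp_gram $ i $ j = (if j = i + 3 then 1 else 0)"
  by (simp add: hyp_gram_def)

lemma hyp_gram_square: "hyp_gram ** hyp_gram = (mat 1 :: 'a::field ^ 6 ^ 6)"
proof -
  have "(\<Sum>k\<in>UNIV. (if k = i + 3 then 1 else 0) * (if j = k + 3 then 1 else 0 :: 'a)) = (if i = j then 1 else 0)"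
    for i j :: 6
  proof -
    have "(\<Sum>k\<in>UNIV. (if k = i + 3 then 1 else 0) * (if j = k + 3 then 1 else 0 :: 'a))
        = (\<Sum>k\<in>{i + 3}. if j = k + 3 then 1 else 0)"
      by (rule sum.mono_neutral_cong_right) auto
    then show ?thesis by auto
  qed
  then show ?thesis by (simp add: vec_eq_iff matrix_matrix_mult_def mat_def)
qed

lemma transpose_hyp_gram: "transpose hyp_gram = hyp_gram"
  by (auto simp: vec_eq_iff opp_swap)

lemma bar_hyp_gram: "bar hyp_gram = hyp_gram"
  by (simp add: vec_eq_iff)

lemma matrix_axis: "(\<chi> i j. w j $ i) *v E k = (w k :: 'a::field ^ 6)"
proof -
  have "(\<Sum>j\<in>UNIV. w j $ i * (if j = k then 1 else 0)) = w k $ i" for i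
    by (simp add: if_distrib[of "\<lambda>a. _ * a"] cong: if_cong)
  then show ?thesis by (simp add: vec_eq_iff matrix_vector_mult_def)
qed

lemma mult_BijGroup:
  "\<sigma> \<in> Bij X \<Longrightarrow> \<tau> \<in> Bij X \<Longrightarrow> \<sigma> \<otimes>\<^bsub>BijGroup X\<^esub> \<tau> = compose X \<sigma> \<tau>"
  by (simp add: BijGroup_def)

context char2_closed
begin

lemma frame_herm:
  assumes M: "M \<in> frames"
  shows "herm (M *v x) (M *v y) = hyp x (y :: 'a ^ 6)"
proof -
  have "transpose M ** bar M = hyp_gram" using M by (simp add: frames_def)
  then have "herm (M *v x) (M *v y) =
      (\<Sum>j\<in>UNIV. \<Sum>k\<in>UNIV. x $ j * (y $ k)\<^sup>2 * (if k = j + 3 then 1 else 0))"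
    by (simp add: herm_matrix)
  then show ?thesis by (simp add: hyp_def if_distrib[of "\<lambda>a. _ * a"] cong: if_cong)
qed

definition frame_inverse :: "'a ^ 6 ^ 6 \<Rightarrow> 'a ^ 6 ^ 6"
  where "frame_inverse M = hyp_gram ** transpose (bar M)"

lemma frame_inverse:
  assumes M: "M \<in> frames"
  shows "frame_inverse M ** M = mat 1" "M ** frame_inverse M = mat 1"
    "bar (bar (frame_inverse M)) = frame_inverse M"
proof -
  have "transpose (bar M) ** M = transpose (transpose M ** bar M)" by (simp add: matrix_transpose_mul)
  also have "\<dots> = hyp_gram" using M by (simp add: frames_def transpose_hyp_gram)
  finally have "transpose (bar M) ** M = hyp_gram" .
  then show 1: "frame_inverse M ** M = mat 1"
    by (simp add: frame_inverse_def hyp_gram_square flip: matrix_mul_assoc)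
  then show "M ** frame_inverse M = mat 1" by (simp add: matrix_left_right_inverse)
  show "bar (bar (frame_inverse M)) = frame_inverse M"
    using M by (simp add: frame_inverse_def bar_mult bar_hyp_gram bar_transpose frames_def)
qed

lemma frame_cancel:
  assumes M: "M \<in> frames"
  shows "M *v (frame_inverse M *v x) = x" "frame_inverse M *v (M *v x) = x"
  by (simp_all add: matrix_vector_mul_assoc frame_inverse[OF M])

lemma frame_isotropic:
  fixes M :: "'a ^ 6 ^ 6"
  assumes M: "M \<in> frames"
  shows "M *v c \<in> isotropic_vectors \<longleftrightarrow> c \<in> hyp_isotropic"
proof -
  have bb: "bar (bar M) = M" using M by (simp add: frames_def)
  have "M *v c \<in> rational_vectors \<longleftrightarrow> c \<in> rational_vectors"
  proof
    assume "c \<in> rational_vectors" then show "M *v c \<in> rational_vectors"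
      by (simp add: rational_iff frob_matrix bb)
  next
    assume "M *v c \<in> rational_vectors"
    then have "frame_inverse M *v (M *v c) \<in> rational_vectors"
      by (simp only: rational_iff frob_matrix frame_inverse(3)[OF M])
    then show "c \<in> rational_vectors" by (simp only: frame_cancel[OF M])
  qed
  moreover have "M *v c = 0 \<longleftrightarrow> c = 0" using frame_cancel(2)[OF M, of c] by auto
  ultimately show ?thesis by (simp add: isotropic_vectors_def hyp_isotropic_def frame_herm[OF M])
qed

lemma frame_coordinates:
  fixes M :: "'a ^ 6 ^ 6"
  assumes M: "M \<in> frames" and v: "v \<in> isotropic_vectors"
  obtains c where "c \<in> hyp_isotropic" "v = M *v c"
  using frame_isotropic[OF M, of "frame_inverse M *v v"] frame_cancel(1)[OF M, of v] v that by metis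

lemma frame_bar:
  assumes M: "M \<in> frames"
  shows "bar M \<in> (frames :: ('a ^ 6 ^ 6) set)"
proof -
  have "bar (transpose M ** bar M) = bar hyp_gram" using M by (simp add: frames_def)
  then show ?thesis using M by (simp add: frames_def bar_mult bar_transpose bar_hyp_gram)
qed

text \<open>Both frames have the same Gram matrix.\<close>

lemma frame_change:
  assumes M: "M \<in> frames" and N: "N \<in> frames"
  shows "N ** frame_inverse M \<in> carrier (GU :: ('a ^ 6 ^ 6) monoid)"
    and "(N ** frame_inverse M) *v (M *v x) = N *v x"
proof -
  let ?I = "frame_inverse M"
  have "transpose (N ** ?I) ** bar (N ** ?I) = transpose ?I ** (transpose N ** bar N) ** bar ?I"
    by (simp add: matrix_transpose_mul bar_mult matrix_mul_assoc)
  also have "\<dots> = transpose ?I ** (transpose M ** bar M) ** bar ?I" using M N by (simp add: frames_def)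
  also have "\<dots> = transpose (M ** ?I) ** bar (M ** ?I)"
    by (simp add: matrix_transpose_mul bar_mult matrix_mul_assoc)
  also have "\<dots> = mat 1" by (simp add: frame_inverse[OF M] bar_mat_1)
  finally show "N ** ?I \<in> carrier GU" by (simp add: GU_iff)
  show "(N ** ?I) *v (M *v x) = N *v x"
    by (simp add: frame_cancel[OF M] flip: matrix_vector_mul_assoc)
qed

lemma frame_of_columns:
  fixes w :: "6 \<Rightarrow> 'a ^ 6"
  assumes "\<And>i. w i \<in> rational_vectors" "\<And>i j. herm (w i) (w j) = (if j = i + 3 then 1 else 0)"
  shows "(\<chi> i j. w j $ i) \<in> frames"
proof -
  have "(\<Sum>k\<in>UNIV. w i $ k * (w j $ k)\<^sup>2) = (if j = i + 3 then 1 else 0)" for i j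
    using assms(2)[of i j] by (simp add: herm_def)
  moreover have "((w j $ i)\<^sup>2)\<^sup>2 = w j $ i" for i j
    using assms(1)[of j] by (simp add: rational_vectors_def F4_pow4)
  ultimately show ?thesis
    by (simp add: frames_def vec_eq_iff matrix_matrix_mult_def)
qed

text \<open>Three orthogonal hyperbolic planes, one for each pair of coordinates, with basis \<open>(1, 1)\<close> and
  \<open>(\<omega>, \<omega>\<^sup>2)\<close>.\<close>

lemma exists_frame: "\<exists>M :: 'a ^ 6 ^ 6. M \<in> frames"
proof -
  define b where "b = omega\<^sup>2"
  have om: "omega * b = 1" "b * omega = 1" "omega + b = 1" "b + omega = 1" "b\<^sup>2 = omega" "omega\<^sup>2 = b"
    using F4_mult_sq[OF omega_F4 omega_neq(1)] omega F4_sq_sq[OF omega_F4]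
    by (simp_all add: b_def mult.commute add_eq_0 add.commute)
  define w :: "6 \<Rightarrow> 'a ^ 6" where "w j = (if j \<in> {0, 1, 2} then E (2 * j) + E (2 * j + 1)
    else omega *s E (2 * j) + b *s E (2 * j + 1))" for j
  have "w i \<in> rational_vectors" for i
    using omega_F4 F4_power[OF omega_F4, of 2] unfolding w_def b_def
    by (simp add: rational_add rational_scale E_rational)
  moreover have "\<forall>i j. herm (w i) (w j) = (if j = i + 3 then 1 else 0)"
    unfolding all_6 herm_def sum_6 by (simp add: w_def om add_self)
  ultimately have "(\<chi> i j. w j $ i) \<in> frames" by (intro frame_of_columns) auto
  then show ?thesis by blast
qed

section \<open>Collineations are semilinear\<close>

text \<open>Perpendicularity of points is thus a notion of the incidence structure and is preserved by
  collineations.\<close>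

lemma perp_iff_generator:
  fixes v w :: "'a ^ 6"
  assumes v: "v \<in> isotropic_vectors" and w: "w \<in> isotropic_vectors"
  shows "herm v w = 0 \<longleftrightarrow> (\<exists>W\<in>generators. v \<in> W \<and> w \<in> W)"
proof
  assume vw: "herm v w = 0"
  obtain P where P: "P \<in> generators" "v \<in> P" using exists_generator_containing[OF v] by blast
  show "\<exists>W\<in>generators. v \<in> W \<and> w \<in> W"
  proof (cases "w \<in> P")
    case False
    then show ?thesis
      using generator_through[OF P(1) w False] in_generator_through[OF P(1) w False] P(2) vw by blast
  qed (use P in blast)
qed (auto intro: generator_herm)

lemma span_in_points_in:
  "v \<in> isotropic_vectors \<Longrightarrow> W \<in> generators \<Longrightarrow> vec.span {v} \<in> points_in W \<longleftrightarrow> (v :: 'a ^ 6) \<in> W"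
  by (simp add: points_in_def span_in_points span_subset_generator)

lemma collineation_perp:
  fixes v w v' w' :: "'a ^ 6"
  assumes \<sigma>: "\<sigma> \<in> collineations"
    and iso: "v \<in> isotropic_vectors" "w \<in> isotropic_vectors" "v' \<in> isotropic_vectors" "w' \<in> isotropic_vectors"
    and eq: "\<sigma> (vec.span {v}) = vec.span {v'}" "\<sigma> (vec.span {w}) = vec.span {w'}"
  shows "herm v w = 0 \<longleftrightarrow> herm v' w' = 0"
proof -
  have mem: "x' \<in> V \<longleftrightarrow> x \<in> W"
    if "W \<in> generators" "V \<in> generators" "points_in V = \<sigma> ` points_in W"
      "x \<in> isotropic_vectors" "x' \<in> isotropic_vectors" "\<sigma> (vec.span {x}) = vec.span {x'}" for V W x x'
  proof -
    have "x' \<in> V \<longleftrightarrow> vec.span {x'} \<in> points_in V" using that span_in_points_in by blast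
    also have "\<dots> \<longleftrightarrow> \<sigma> (vec.span {x}) \<in> \<sigma> ` points_in W" by (simp only: that)
    also have "\<dots> \<longleftrightarrow> vec.span {x} \<in> points_in W"
      by (rule inj_on_image_mem_iff[OF collineationD(3)[OF \<sigma>] span_in_points[OF that(4)] points_in_subset])
    also have "\<dots> \<longleftrightarrow> x \<in> W" using that span_in_points_in by blast
    finally show ?thesis .
  qed
  show ?thesis unfolding perp_iff_generator[OF iso(1,2)] perp_iff_generator[OF iso(3,4)]
  proof
    assume "\<exists>W\<in>generators. v \<in> W \<and> w \<in> W"
    then obtain W where W: "W \<in> generators" "v \<in> W" "w \<in> W" by blast
    obtain V where V: "V \<in> generators" "points_in V = \<sigma> ` points_in W"
      using collineation_generator[OF \<sigma> W(1)] by blast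
    show "\<exists>W\<in>generators. v' \<in> W \<and> w' \<in> W"
      using mem[OF W(1) V iso(1,3) eq(1)] mem[OF W(1) V iso(2,4) eq(2)] W V by blast
  next
    assume "\<exists>W\<in>generators. v' \<in> W \<and> w' \<in> W"
    then obtain V where V: "V \<in> generators" "v' \<in> V" "w' \<in> V" by blast
    obtain W where W: "W \<in> generators" "points_in V = \<sigma> ` points_in W"
      using collineation_generator_inverse[OF \<sigma> V(1)] by blast
    show "\<exists>W\<in>generators. v \<in> W \<and> w \<in> W"
      using mem[OF W(1) V(1) W(2) iso(1,3) eq(1)] mem[OF W(1) V(1) W(2) iso(2,4) eq(2)] W V by blast
  qed
qed

definition frame_point :: "'a ^ 6 ^ 6 \<Rightarrow> 'a ^ 6 \<Rightarrow> ('a ^ 6) set"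
  where "frame_point M c = vec.span {M *v c}"

lemma E_hyp_isotropic: "E i \<in> (hyp_isotropic :: ('a ^ 6) set)"
proof -
  have "(E i :: 'a ^ 6) $ i \<noteq> 0" by simp
  then have "E i \<noteq> (0 :: 'a ^ 6)" by force
  then show ?thesis by (simp add: hyp_isotropic_def E_rational)
qed

lemma ones_hyp_isotropic: "E 0 + E 1 + E 2 \<in> (hyp_isotropic :: ('a ^ 6) set)"
proof -
  have "(E 0 + E 1 + E 2 :: 'a ^ 6) $ 0 \<noteq> 0" by simp
  then have "E 0 + E 1 + E 2 \<noteq> (0 :: 'a ^ 6)" by force
  then show ?thesis by (simp add: hyp_isotropic_def E_rational rational_add)
qed

lemma frame_point_in:
  "M \<in> frames \<Longrightarrow> c \<in> hyp_isotropic \<Longrightarrow> frame_point M c \<in> fermat_cubic_F4"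
  by (simp add: frame_point_def span_in_points frame_isotropic)

lemma collineation_frame_point:
  assumes M: "M \<in> frames" and \<sigma>: "\<sigma> \<in> collineations" and c: "c \<in> hyp_isotropic"
  obtains d where "d \<in> hyp_isotropic" "\<sigma> (frame_point M c) = frame_point M d"
proof -
  have "\<sigma> (frame_point M c) \<in> fermat_cubic_F4"
    using collineationD(4)[OF \<sigma>] frame_point_in[OF M c] by blast
  then obtain v where v: "v \<in> isotropic_vectors" "\<sigma> (frame_point M c) = vec.span {v}"
    using points_iff by blast
  obtain d where "d \<in> hyp_isotropic" "v = M *v d" by (rule frame_coordinates[OF M v(1)])
  then show ?thesis using that v by (simp add: frame_point_def)
qed

lemma span_scale_eq: "k \<noteq> 0 \<Longrightarrow> vec.span {k *s v} = vec.span {v :: 'a ^ 6}"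
proof -
  assume k: "k \<noteq> 0"
  have "v = inverse k *s (k *s v)" using k by simp
  then have "v \<in> vec.span {k *s v}" by (metis vec.span_base vec.span_scale singletonI)
  moreover have "k *s v \<in> vec.span {v}" by (simp add: vec.span_base vec.span_scale)
  ultimately show ?thesis by (intro subset_antisym vec.span_minimal) auto
qed

lemma frame_point_scale:
  "k *s c \<in> hyp_isotropic \<Longrightarrow> frame_point M (k *s c) = frame_point M c"
  by (cases "k = 0") (auto simp: hyp_isotropic_def frame_point_def vector_scalar_commute span_scale_eq)

lemma collineation_perp_frame:
  assumes M: "M \<in> frames" and \<sigma>: "\<sigma> \<in> collineations"
    and iso: "a \<in> hyp_isotropic" "c \<in> hyp_isotropic" "d \<in> hyp_isotropic"
    and a: "\<sigma> (frame_point M a) = frame_point M a" and c: "\<sigma> (frame_point M c) = frame_point M d"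
  shows "hyp a c = 0 \<longleftrightarrow> hyp a d = 0"
  unfolding frame_herm[OF M, symmetric]
  by (rule collineation_perp[OF \<sigma>]) (use iso a c in \<open>simp_all add: frame_isotropic[OF M] frame_point_def\<close>)

text \<open>Collineations preserve perpendicularity, so the frame coordinates of the points that a collineation
  fixes satisfy the hypothesis of the rigidity argument: \<open>d\<close> is a coordinate vector of the image.\<close>

lemma fixed_determined:
  assumes M: "M \<in> frames" and \<sigma>: "\<sigma> \<in> collineations" and c: "c \<in> hyp_isotropic"
  defines "Fix \<equiv> {c \<in> hyp_isotropic. \<sigma> (frame_point M c) = frame_point M c}"
  shows "\<exists>d\<in>hyp_isotropic. (\<forall>a\<in>Fix. hyp a c = 0 \<longleftrightarrow> hyp a d = 0) \<and> (\<forall>k. d = k *s c \<longrightarrow> c \<in> Fix)"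
proof -
  obtain d where d: "d \<in> hyp_isotropic" "\<sigma> (frame_point M c) = frame_point M d"
    by (rule collineation_frame_point[OF M \<sigma> c])
  have "hyp a c = 0 \<longleftrightarrow> hyp a d = 0" if "a \<in> Fix" for a
    using that collineation_perp_frame[OF M \<sigma> _ c d(1) _ d(2)] by (simp add: Fix_def)
  moreover have "c \<in> Fix" if "d = k *s c" for k
    using that d c frame_point_scale[of k c M] by (simp add: Fix_def)
  ultimately show ?thesis using d(1) by blast
qed

lemma collineation_fixing_frame:
  assumes M: "M \<in> frames" and \<sigma>: "\<sigma> \<in> collineations"
    and basis: "\<And>i. \<sigma> (frame_point M (E i)) = frame_point M (E i)"
    and ones: "\<sigma> (frame_point M (E 0 + E 1 + E 2)) = frame_point M (E 0 + E 1 + E 2)"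
  shows "\<sigma> (frame_point M (E 0 + omega *s E 1)) = frame_point M (E 0 + omega *s E 1) \<Longrightarrow>
      \<sigma> = (\<lambda>p\<in>fermat_cubic_F4. p)"
    and "\<sigma> (frame_point M (E 0 + omega *s E 1)) \<in>
      {frame_point M (E 0 + omega *s E 1), frame_point M (E 0 + omega\<^sup>2 *s E 1)}"
proof -
  define Fix where "Fix = {c \<in> hyp_isotropic. \<sigma> (frame_point M c) = frame_point M c}"
  note det = fixed_determined[OF M \<sigma>, folded Fix_def]
  have b: "E i \<in> Fix" for i using basis E_hyp_isotropic by (simp add: Fix_def)
  have o: "E 0 + E 1 + E 2 \<in> Fix" using ones ones_hyp_isotropic by (simp add: Fix_def)
  have w: "E 0 + omega *s E 1 \<in> hyp_isotropic" by (rule two_term_isotropic) (simp_all add: omega_F4)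
  show "\<sigma> = (\<lambda>p\<in>fermat_cubic_F4. p)"
    if "\<sigma> (frame_point M (E 0 + omega *s E 1)) = frame_point M (E 0 + omega *s E 1)"
  proof (rule extensionalityI[of _ fermat_cubic_F4])
    have "E 0 + omega *s E 1 \<in> Fix" using that w by (simp add: Fix_def)
    then have fixed: "c \<in> Fix" if "c \<in> hyp_isotropic" for c
      using that by (rule all_isotropic_fixed[OF det b o, rotated])
    fix p :: "('a ^ 6) set" assume p: "p \<in> fermat_cubic_F4"
    then obtain v where v: "v \<in> isotropic_vectors" "p = vec.span {v}" using points_iff by blast
    obtain c where c: "c \<in> hyp_isotropic" "v = M *v c" by (rule frame_coordinates[OF M v(1)])
    have "\<sigma> p = p" using fixed[OF c(1)] v c by (simp add: Fix_def frame_point_def)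
    then show "\<sigma> p = (\<lambda>p\<in>fermat_cubic_F4. p) p" using p by simp
  qed (use collineationD(5)[OF \<sigma>] in auto)
  obtain d where d: "d \<in> hyp_isotropic" "\<sigma> (frame_point M (E 0 + omega *s E 1)) = frame_point M d"
    by (rule collineation_frame_point[OF M \<sigma> w])
  have test: "hyp a d = 0 \<longleftrightarrow> hyp a (E 0 + omega *s E 1) = 0" if "a \<in> Fix" for a
    using that collineation_perp_frame[OF M \<sigma> _ w d(1) _ d(2)] by (simp add: Fix_def)
  have "\<exists>k. d = k *s (E 0 + omega *s E 1) \<or> d = k *s (E 0 + omega\<^sup>2 *s E 1)"
    by (rule omega_point_image[OF det b o d(1)], assumption, rule test, assumption)
  then obtain k c where kc: "d = k *s c" "c = E 0 + omega *s E 1 \<or> c = E 0 + omega\<^sup>2 *s E 1"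
    by blast
  have "frame_point M d = frame_point M c" using d(1) unfolding kc(1) by (rule frame_point_scale)
  then show "\<sigma> (frame_point M (E 0 + omega *s E 1)) \<in>
      {frame_point M (E 0 + omega *s E 1), frame_point M (E 0 + omega\<^sup>2 *s E 1)}"
    unfolding d(2) using kc(2) by blast
qed

text \<open>Images of the basis points have the right perpendicularities, so suitable multiples form a frame.
  There is still a free factor for each hyperbolic pair, and these factors are used to adjust the image
  of the unit point \<open>E 0 + E 1 + E 2\<close>.\<close>

lemma collineation_frame_image:
  assumes M: "M \<in> frames" and \<sigma>: "\<sigma> \<in> collineations"
  shows "\<exists>N\<in>frames. (\<forall>i. \<sigma> (frame_point M (E i)) = frame_point N (E i)) \<and>
    \<sigma> (frame_point M (E 0 + E 1 + E 2)) = frame_point N (E 0 + E 1 + E 2)"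
proof -
  have ex: "\<exists>v\<in>isotropic_vectors. \<sigma> (frame_point M c) = vec.span {v}" if "c \<in> hyp_isotropic" for c
    using collineationD(4)[OF \<sigma> frame_point_in[OF M that]] points_iff by blast
  have "\<forall>i. \<exists>v. v \<in> isotropic_vectors \<and> \<sigma> (frame_point M (E i)) = vec.span {v}"
    using ex[OF E_hyp_isotropic] by blast
  from choice[OF this] obtain w
    where w: "\<And>i. w i \<in> isotropic_vectors" "\<And>i. \<sigma> (frame_point M (E i)) = vec.span {w i}"
    by blast
  have perp: "herm (M *v c) (M *v c') = 0 \<longleftrightarrow> herm v v' = 0"
    if "c \<in> hyp_isotropic" "c' \<in> hyp_isotropic" "v \<in> isotropic_vectors" "v' \<in> isotropic_vectors"
      "\<sigma> (frame_point M c) = vec.span {v}" "\<sigma> (frame_point M c') = vec.span {v'}" for c c' v v'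
    by (rule collineation_perp[OF \<sigma>]) (use that in \<open>simp_all add: frame_isotropic[OF M] frame_point_def\<close>)
  have ww: "herm (w i) (w j) = 0 \<longleftrightarrow> j \<noteq> i + 3" for i j
    using perp[OF E_hyp_isotropic E_hyp_isotropic w(1) w(1) w(2) w(2), of i j] opp_swap[of i j]
    by (auto simp: frame_herm[OF M])
  \<comment> \<open>Scaling a vector in the second argument multiplies the form by the square, and
    \<open>a * a\<^sup>2 = 1\<close> for \<open>a \<noteq> 0\<close>; so these factors make the pairings equal to 1.\<close>
  define r where "r i = (if i \<in> {0, 1, 2} then 1 else herm (w (i + 3)) (w i))" for i
  define w' where "w' i = r i *s w i" for i
  have h: "herm (w (i + 3)) (w i) \<in> F4" "herm (w (i + 3)) (w i) \<noteq> 0" for i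
    using ww[of "i + 3" i] w(1) isotropic_rational by (auto intro: herm_rational)
  have r: "r i \<in> F4" "r i \<noteq> 0" for i
    using h[of i] F4_1 by (auto simp: r_def)
  have w'_span: "vec.span {w' i} = vec.span {w i}" for i
    using r(2)[of i] by (simp add: w'_def span_scale_eq)
  have w'_rat: "w' i \<in> rational_vectors" for i
    using w(1)[of i] r(1)[of i] isotropic_rational by (simp add: w'_def rational_scale)
  have w'_iso: "w' i \<in> isotropic_vectors" for i
    using w(1)[of i] r[of i] w'_rat[of i]
    by (auto simp: w'_def isotropic_vectors_def herm_scale_left herm_scale_right)
  have w'_0: "herm (w' i) (w' j) = 0" if "j \<noteq> i + 3" for i j
    using ww[of i j] that by (simp add: w'_def herm_scale_left herm_scale_right)
  have w'_1: "herm (w' i) (w' (i + 3)) = 1" if i: "i \<in> {0, 1, 2}" for i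
  proof -
    have "r i = 1" "r (i + 3) = herm (w i) (w (i + 3))" using i by (auto simp: r_def)
    then show ?thesis using F4_mult_sq[OF h[of "i + 3"]]
      by (simp add: w'_def herm_scale_right mult.commute)
  qed
  have w'_2: "herm (w' (i + 3)) (w' i) = 1" if i: "i \<in> {0, 1, 2}" for i
    using w'_1[OF i] herm_sym[OF w'_rat, of "i + 3" "w' i"] by simp
  have gram: "herm (w' i) (w' j) = (if j = i + 3 then 1 else 0)" for i j
  proof -
    have "i \<in> {0, 1, 2} \<or> (\<exists>k\<in>{0, 1, 2}. i = k + 3)" using UNIV_6 by auto
    then show ?thesis using w'_0[of j i] w'_1[of i] w'_2[of "i + 3"] by auto
  qed
  define N where "N = (\<chi> i j. w' j $ i)"
  have N: "N \<in> frames" unfolding N_def by (rule frame_of_columns[OF w'_rat gram])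
  have NE: "N *v E i = w' i" for i unfolding N_def by (rule matrix_axis)
  obtain z where z: "z \<in> isotropic_vectors" "\<sigma> (frame_point M (E 0 + E 1 + E 2)) = vec.span {z}"
    using ex[OF ones_hyp_isotropic] by blast
  obtain c where c: "c \<in> hyp_isotropic" "z = N *v c" by (rule frame_coordinates[OF N z(1)])
  have c0: "c $ k = 0 \<longleftrightarrow> k \<in> {3, 4, 5}" for k
  proof -
    have "hyp (E (k + 3)) (E 0 + E 1 + E 2 :: 'a ^ 6) = 0 \<longleftrightarrow> hyp (E (k + 3)) c = 0"
      using perp[OF E_hyp_isotropic ones_hyp_isotropic w'_iso z(1) _ z(2), of "k + 3" "k + 3"] w(2) w'_span
      by (simp add: frame_herm[OF M] c(2) frame_herm[OF N] flip: NE)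
    moreover have "(E 0 + E 1 + E 2 :: 'a ^ 6) $ k = 0 \<longleftrightarrow> k \<in> {3, 4, 5}"
      using UNIV_6 by auto
    ultimately show ?thesis by simp
  qed
  \<comment> \<open>The entries of the image of the unit point, repeated on the opposite indices, so that the
    pairings stay equal to \<open>s i * (s i)\<^sup>2 = 1\<close>.\<close>
  define s where "s i = (if i \<in> {0, 1, 2} then c $ i else c $ (i + 3))" for i
  have s: "s i \<in> F4" "s i \<noteq> 0" "s (i + 3) = s i" for i
  proof -
    show "s i \<in> F4" using hyp_isotropic_nth[OF c(1)] by (simp add: s_def)
    show "s i \<noteq> 0" "s (i + 3) = s i" using c0 UNIV_6 by (auto simp: s_def)
  qed
  define N' where "N' = (\<chi> i j. (s j *s w' j) $ i)"
  have N': "N' \<in> frames" unfolding N'_def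
  proof (rule frame_of_columns)
    show "s i *s w' i \<in> rational_vectors" for i using s w'_rat by (simp add: rational_scale)
    show "herm (s i *s w' i) (s j *s w' j) = (if j = i + 3 then 1 else 0)" for i j
      using F4_mult_sq[OF s(1,2)[of i]] s(3) by (simp add: herm_scale_left herm_scale_right gram mult.commute)
  qed
  have N'E: "N' *v E i = s i *s w' i" for i unfolding N'_def by (rule matrix_axis)
  have "\<sigma> (frame_point M (E i)) = frame_point N' (E i)" for i
    using w(2)[of i] w'_span[of i] s(2)[of i] by (simp add: frame_point_def N'E span_scale_eq)
  moreover have "N' *v (E 0 + E 1 + E 2) = z"
  proof -
    have "c = (\<Sum>i\<in>UNIV. c $ i *s E i)" by (simp add: basis_expansion)
    also have "\<dots> = c $ 0 *s E 0 + c $ 1 *s E 1 + c $ 2 *s E 2"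
      using c0[of 3] c0[of 4] c0[of 5] by (simp add: sum_6)
    finally have "z = N *v (c $ 0 *s E 0 + c $ 1 *s E 1 + c $ 2 *s E 2)" using c(2) by metis
    then show ?thesis
      by (simp add: matrix_vector_right_distrib vector_scalar_commute NE N'E s_def)
  qed
  ultimately show ?thesis using N' z by (auto simp: frame_point_def)
qed

lemma PGammaU_cancel:
  assumes \<tau>: "\<tau> \<in> carrier PGammaU" and \<sigma>: "\<sigma> \<in> collineations"
    and comp: "compose fermat_cubic_F4 \<tau> \<sigma> \<in> carrier PGammaU"
  shows "(\<sigma> :: ('a ^ 6) set \<Rightarrow> ('a ^ 6) set) \<in> carrier PGammaU"
proof -
  let ?G = "BijGroup (fermat_cubic_F4 :: ('a ^ 6) set set)"
  interpret G: group ?G by (rule group_BijGroup)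
  have B: "\<sigma> \<in> carrier ?G" "\<tau> \<in> carrier ?G"
    using \<sigma> \<tau> PGammaU_subset collineationD(1) by (auto simp: BijGroup_def)
  have "compose fermat_cubic_F4 \<tau> \<sigma> = \<tau> \<otimes>\<^bsub>?G\<^esub> \<sigma>" using B by (simp add: BijGroup_def)
  then have "\<sigma> = inv\<^bsub>?G\<^esub> \<tau> \<otimes>\<^bsub>?G\<^esub> compose fermat_cubic_F4 \<tau> \<sigma>"
    using B by (simp add: G.inv_solve_left)
  also have "\<dots> \<in> carrier PGammaU"
    using subgroup.m_closed[OF subgroup_PGammaU subgroup.m_inv_closed[OF subgroup_PGammaU \<tau>] comp] .
  finally show ?thesis .
qed

lemma compose_collineations:
  assumes "\<tau> \<in> collineations" "\<sigma> \<in> collineations"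
  shows "compose fermat_cubic_F4 \<tau> \<sigma> \<in> (collineations :: (('a ^ 6) set \<Rightarrow> _) set)"
  using subgroup.m_closed[OF subgroup_collineations assms]
  by (simp only: mult_BijGroup collineationD(1)[OF assms(1)] collineationD(1)[OF assms(2)])

lemma matrix_perm_frame_point:
  assumes "M \<in> frames" "N \<in> frames" "c \<in> hyp_isotropic"
  shows "matrix_perm (N ** frame_inverse M) (frame_point M c) = frame_point N c"
  using assms frame_point_in by (simp add: matrix_perm_def frame_point_def matrix_span frame_change(2))

lemma frob_perm_frame_point:
  assumes "M \<in> frames" "c \<in> hyp_isotropic"
  shows "frob_perm (frame_point M c) = frame_point (bar M) (frob c)"
  using assms frame_point_in by (simp add: frob_perm_def frame_point_def frob_span frob_matrix)

lemma frob_hyp_isotropic: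
  assumes "c \<in> hyp_isotropic"
  shows "frob c \<in> (hyp_isotropic :: ('a ^ 6) set)"
proof -
  obtain M :: "'a ^ 6 ^ 6" where M: "M \<in> frames" using exists_frame by blast
  have "frob (M *v c) \<in> isotropic_vectors" using assms frob_isotropic frame_isotropic[OF M] by blast
  then show ?thesis using frame_isotropic[OF frame_bar[OF M]] by (simp add: frob_matrix)
qed

text \<open>The element \<open>\<psi>\<close> used in the second case squares the coordinates with respect to \<open>M\<close>. It is not the
  Galois element itself, because a hyperbolic frame cannot be chosen over the prime field: there, the
  form is alternating on the isotropic vectors and degenerate on their span.\<close>

theorem collineations_subset_PGammaU:
  assumes \<sigma>: "\<sigma> \<in> collineations"
  shows "(\<sigma> :: ('a ^ 6) set \<Rightarrow> ('a ^ 6) set) \<in> carrier PGammaU"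
proof -
  let ?X = "fermat_cubic_F4 :: ('a ^ 6) set set" and ?w = "E 0 + omega *s E 1"
    and ?w2 = "E 0 + omega\<^sup>2 *s E 1" and ?e = "E 0 + E 1 + E 2 :: 'a ^ 6"
  have id: "(\<lambda>p\<in>?X. p) \<in> carrier PGammaU"
    using subgroup.one_closed[OF subgroup_PGammaU] by (simp add: BijGroup_def)
  obtain M :: "'a ^ 6 ^ 6" where M: "M \<in> frames" using exists_frame by blast
  obtain N where N: "N \<in> frames" "\<And>i. \<sigma> (frame_point M (E i)) = frame_point N (E i)"
    "\<sigma> (frame_point M ?e) = frame_point N ?e"
    using collineation_frame_image[OF M \<sigma>] by blast
  define \<gamma> where "\<gamma> = matrix_perm (M ** frame_inverse N)"
  have \<gamma>: "\<gamma> \<in> carrier PGammaU" "\<gamma> \<in> collineations"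
    using frame_change(1)[OF N(1) M] by (simp_all add: \<gamma>_def matrix_perm_PGammaU matrix_perm_collineation)
  define \<delta> where "\<delta> = compose ?X \<gamma> \<sigma>"
  have \<delta>: "\<delta> \<in> collineations" unfolding \<delta>_def by (rule compose_collineations[OF \<gamma>(2) \<sigma>])
  have \<delta>E: "\<delta> (frame_point M (E i)) = frame_point M (E i)" for i
    using N(2) frame_point_in[OF M E_hyp_isotropic]
    by (simp add: \<delta>_def \<gamma>_def compose_eq matrix_perm_frame_point[OF N(1) M E_hyp_isotropic])
  have \<delta>e: "\<delta> (frame_point M ?e) = frame_point M ?e"
    using N(3) frame_point_in[OF M ones_hyp_isotropic]
    by (simp add: \<delta>_def \<gamma>_def compose_eq matrix_perm_frame_point[OF N(1) M ones_hyp_isotropic])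
  note \<delta>_fix = collineation_fixing_frame[OF M \<delta> \<delta>E \<delta>e]
  have "\<delta> \<in> carrier PGammaU"
  proof (cases "\<delta> (frame_point M ?w) = frame_point M ?w")
    case True
    then show ?thesis using \<delta>_fix(1) id by simp
  next
    case False
    then have swap: "\<delta> (frame_point M ?w) = frame_point M ?w2" using \<delta>_fix(2) by blast
    define \<theta> where "\<theta> = matrix_perm (M ** frame_inverse (bar M))"
    have \<theta>: "\<theta> \<in> carrier PGammaU" "\<theta> \<in> collineations"
      using frame_change(1)[OF frame_bar[OF M] M]
      by (simp_all add: \<theta>_def matrix_perm_PGammaU matrix_perm_collineation)
    define \<psi> where "\<psi> = compose ?X \<theta> frob_perm"
    have \<psi>: "\<psi> \<in> collineations" unfolding \<psi>_def
      by (rule compose_collineations[OF \<theta>(2) frob_perm_collineation])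
    have "\<psi> = \<theta> \<otimes>\<^bsub>BijGroup ?X\<^esub> frob_perm"
      unfolding \<psi>_def
      by (rule mult_BijGroup[OF collineationD(1)[OF \<theta>(2)] collineationD(1)[OF frob_perm_collineation], symmetric])
    then have \<psi>P: "\<psi> \<in> carrier PGammaU"
      using subgroup.m_closed[OF subgroup_PGammaU \<theta>(1) frob_perm_PGammaU] by simp
    have \<psi>_point: "\<psi> (frame_point M c) = frame_point M (frob c)" if c: "c \<in> hyp_isotropic" for c
      using frame_point_in[OF M c]
      by (simp add: \<psi>_def \<theta>_def compose_eq frob_perm_frame_point[OF M c]
          matrix_perm_frame_point[OF frame_bar[OF M] M frob_hyp_isotropic[OF c]])
    have frobE: "frob (E i) = (E i :: 'a ^ 6)" for i by (simp add: frob_def vec_eq_iff)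
    define \<epsilon> where "\<epsilon> = compose ?X \<psi> \<delta>"
    have \<epsilon>: "\<epsilon> \<in> collineations" unfolding \<epsilon>_def by (rule compose_collineations[OF \<psi> \<delta>])
    have \<epsilon>E: "\<epsilon> (frame_point M (E i)) = frame_point M (E i)" for i
      using frame_point_in[OF M E_hyp_isotropic]
      by (simp add: \<epsilon>_def compose_eq \<delta>E \<psi>_point[OF E_hyp_isotropic] frobE)
    have \<epsilon>e: "\<epsilon> (frame_point M ?e) = frame_point M ?e"
      using frame_point_in[OF M ones_hyp_isotropic]
      by (simp add: \<epsilon>_def compose_eq \<delta>e \<psi>_point[OF ones_hyp_isotropic] frobE frob_add)
    have w: "?w \<in> hyp_isotropic" "?w2 \<in> hyp_isotropic"
      by (rule two_term_isotropic; simp add: omega_F4 F4_power)+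
    have "\<epsilon> (frame_point M ?w) = frame_point M ?w"
      using frame_point_in[OF M w(1)]
      by (simp add: \<epsilon>_def compose_eq swap \<psi>_point[OF w(2)] frobE frob_add frob_scale F4_pow4[OF omega_F4])
    then have "\<epsilon> = (\<lambda>p\<in>?X. p)" by (rule collineation_fixing_frame(1)[OF M \<epsilon> \<epsilon>E \<epsilon>e])
    then show ?thesis using PGammaU_cancel[OF \<psi>P \<delta>] id by (simp add: \<epsilon>_def)
  qed
  then show ?thesis using PGammaU_cancel[OF \<gamma>(1) \<sigma>] by (simp add: \<delta>_def)
qed

theorem PGammaU_eq_collineations: "carrier (PGammaU :: (('a ^ 6) set \<Rightarrow> _) monoid) = collineations"
  using PGammaU_subset collineations_subset_PGammaU by blast

theorem rho_planes_iso:
  "(rho_planes :: (('a ^ 6) set \<Rightarrow> ('a ^ 6) set) \<Rightarrow> _) \<in> iso PGammaU Aut_planes"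
  unfolding iso_def mem_Collect_eq
proof
  show "bij_betw (rho_planes :: (('a ^ 6) set \<Rightarrow> ('a ^ 6) set) \<Rightarrow> _) (carrier PGammaU) (carrier Aut_planes)"
    unfolding PGammaU_eq_collineations by (rule rho_planes_bij_collineations)
  show "(rho_planes :: (('a ^ 6) set \<Rightarrow> ('a ^ 6) set) \<Rightarrow> _) \<in> hom PGammaU Aut_planes"
    unfolding hom_def mem_Collect_eq PGammaU_eq_collineations
  proof (intro conjI ballI funcsetI)
    fix \<sigma> \<tau> :: "('a ^ 6) set \<Rightarrow> ('a ^ 6) set"
    assume \<sigma>: "\<sigma> \<in> collineations"
    show "rho_planes \<sigma> \<in> carrier Aut_planes" by (rule rho_planes_Aut[OF \<sigma>])
    assume \<tau>: "\<tau> \<in> collineations"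
    have "rho_planes \<sigma> \<in> Bij planes" "rho_planes \<tau> \<in> Bij planes"
      using rho_planes_Aut[OF \<sigma>] rho_planes_Aut[OF \<tau>] by (simp_all add: Aut_planes_carrier)
    then show "rho_planes (\<sigma> \<otimes>\<^bsub>PGammaU\<^esub> \<tau>) = rho_planes \<sigma> \<otimes>\<^bsub>Aut_planes\<^esub> rho_planes \<tau>"
      using rho_planes_compose[OF \<sigma> \<tau>] collineationD(1)[OF \<sigma>] collineationD(1)[OF \<tau>]
      by (simp add: PGammaU_def Aut_planes_def BijGroup_def)
  qed
qed

end

theorem corollary1p6:
  assumes "CHAR('a::alg_closed_field) = 2"
  shows "(rho_planes :: (('a ^ 6) set \<Rightarrow> ('a ^ 6) set) \<Rightarrow> ('a ^ 6) set set \<Rightarrow> ('a ^ 6) set set)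
    \<in> iso PGammaU Aut_planes"
proof -
  interpret char2_closed "TYPE('a)" using assms by unfold_locales
  show ?thesis by (rule rho_planes_iso)
qed

end
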